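(* Assume the BSDE $Y_t=\xi+\int_{t\wedge\tau}^{\tau} f(s,Y_s)\,ds-\int_{t\wedge\tau}^{\tau} Z_s\,dW_s$, $t\ge 0$, has a solution $(Y,Z)\in\mathcal S^4\times\mathcal H^4$. Assume (h), (R-q) with $q=4$, ($\pi$-F) with some $p>8$ and ($\pi$-T) with $p=8$. Then there exist a random variable $V\in L^2$ and a constant $C>0$, neither depending on $h$, such that for every $h\in(0,h_0]$ $$\sup_{t\in\pi_h}\mathbb E\big[|Y_t-\bar Y_t|^2\big]\le Ch+\mathbb E\Big[\exp\big(3L_f(\tau\vee\tau_h)\big)\Big(|\xi-\bar\xi|^2+2V|\tau-\tau_h|+\tfrac{3}{2L_f}\int_0^\tau \Delta F_s^2\,ds\Big)\Big],$$ where $\Delta F_s=f(s,Y_s)-f_h(\phi(s),Y_s)$.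
   Context: Let $(\Omega,\mathcal F,(\mathcal F_t)_{t\ge0},\mathbb P)$ be a filtered probability space whose filtration is generated by a $d$-dimensional Brownian motion $W$ and augmented by all $\mathbb P$-null sets; write $\mathbb E_t[\cdot]=\mathbb E[\cdot\mid\mathcal F_t]$. Let $\tau$ be a stopping time with $\exp(m\tau)\in L^1$ for some $m>0$, let $\xi\in L^{p_0}(\mathcal F_\tau)$ for some $p_0\ge4$, and let $f:[0,\infty)\times\Omega\times\mathbb R\to\mathbb R$ be Lipschitz in its last variable with constant $L_f>0$. $\mathcal S^p=\{Y:\mathbb E[\sup_{s\ge0}|Y_s|^p]<\infty\}$, $\mathcal H^p=\{Z:\mathbb E[(\int_0^\infty\|Z_s\|^2ds)^{p/2}]<\infty\}$. For $h>0$ let $\pi_h=\{nh:n\in\mathbb N_0\}$ and $\phi(s)=\max\{t\in\pi_h:t\le s\}$. For each $h\in(0,h_0]$ there are given a finite $\pi_h$-valued stopping time $\tau_h$, an $\mathcal F_{\tau_h}$-measurable random variable $\bar\xi$ (depending on $h$), and a map $f_h:\pi_h\times\Omega\times\mathbb R\to\mathbb R$. The discrete approximation $(\bar Y_t)_{t\in\pi_h}$ is the solution of $\bar Y_t=1_{\{t\ge\tau_h\}}\bar\xi+1_{\{t<\tau_h\}}(\mathbb E_t[\bar Y_{t+h}]+hf_h(t,\bar Y_t))$, $t\in\pi_h$, given by $\bar Y_t=1_{\{t\ge\tau_h\}}\bar\xi+1_{\{t<\tau_h\}}\bar Y^*_t$, where $\bar Y^*$ is the unique fixed point of $T(R)_t=1_{\{t<\tau_h\}}\mathbb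 E_t[R_{t+h}]+1_{\{t<\tau_h\}}hf_h(t,R_t)+1_{\{t=\tau_h\}}\bar\xi$ in the Banach space of adapted sequences $(R_t)_{t\in\pi_h}$ with $R_t\in L^2(\mathcal F_t)$, $1_{\{t>\tau_h\}}R_t=0$ and $\sum_{t\in\pi_h}(1-3L_fh)^{-t/h}\|1_{\{t\le\tau_h\}}R_t\|_{L^2}<\infty$. Assumptions: (h) $h_0<\min\{L_f,\frac1{12L_f}\}$ and $h\in(0,h_0]$. (R-q) for a parameter $q\ge2$: there is $\rho>4qL_f$ with $\exp(\rho\tau)\in L^1$ and $\sup_{h\in(0,h_0]}\exp(\rho\tau_h)\in L^1$. ($\pi$-F) for a parameter $p$: each $f_h$ is Lipschitz in its last variable with the constant $L_f$, $f_h(t,A)$ is $\mathcal F_t$-measurable for every $\mathcal F_t$-measurable $A$, and $\mathbb E[\sup_{h\in(0,h_0]}\sup_{t\in\pi_h\cap[0,\tau\vee\tau_h]}|f_h(t,0)|^p]<\infty$. ($\pi$-T) for a parameter $p$: $\bar\xi$ is $\mathcal F_{\tau_h}$-measurable and $\mathbb E[\sup_{h\in(0,h_0]}|\bar\xi|^p]<\infty$. *)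

theory Defs
  imports "HOL-Probability.Probability"
begin

definition brownian_motion :: "'a measure \<Rightarrow> (real \<Rightarrow> 'a \<Rightarrow> real^'d::finite) \<Rightarrow> bool" where
  "brownian_motion M W \<longleftrightarrow>
     prob_space M \<and>
     (\<forall>t\<ge>0. W t \<in> borel_measurable M) \<and>
     (\<forall>\<omega>\<in>space M. W 0 \<omega> = 0 \<and> continuous_on {0..} (\<lambda>t. W t \<omega>)) \<and>
     (\<forall>ts::real list. ts \<noteq> [] \<and> sorted_wrt (<) ts \<and> 0 \<le> hd ts \<longrightarrow>
        prob_space.indep_vars M (\<lambda>_. borel) (\<lambda>i \<omega>. W (ts ! Suc i) \<omega> - W (ts ! i) \<omega>)
          {..<length ts - 1}) \<and>
     (\<forall>s t. 0 \<le> s \<and> s < t \<longrightarrow>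
        distributed M lborel (\<lambda>\<omega>. W t \<omega> - W s \<omega>)
          (\<lambda>x. ennreal (\<Prod>i\<in>UNIV. normal_density 0 (sqrt (t - s)) (x $ i))))"

definition bm_filtration :: "'a measure \<Rightarrow> (real \<Rightarrow> 'a \<Rightarrow> real^'d::finite) \<Rightarrow> real \<Rightarrow> 'a measure" where
  "bm_filtration M W t = sigma (space M)
     ({W s -` B \<inter> space M | s B. 0 \<le> s \<and> s \<le> t \<and> B \<in> sets borel} \<union> null_sets M)"

definition progressive :: "(real \<Rightarrow> 'a measure) \<Rightarrow> (real \<Rightarrow> 'a \<Rightarrow> 'b::topological_space) \<Rightarrow> bool" where
  "progressive F X \<longleftrightarrow>
     (\<forall>t\<ge>0. (\<lambda>(s, \<omega>). X s \<omega>) \<in> borel_measurable (restrict_space lborel {0..t} \<Otimes>\<^sub>M F t))"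

definition simple_integral :: "(real \<Rightarrow> 'a measure) \<Rightarrow> (real \<Rightarrow> 'a \<Rightarrow> real^'d::finite)
     \<Rightarrow> (real \<Rightarrow> 'a \<Rightarrow> real^'d) \<Rightarrow> ('a \<Rightarrow> real) \<Rightarrow> bool" where
  "simple_integral F W H I \<longleftrightarrow>
     (\<exists>(n::nat) (tt::nat \<Rightarrow> real) (Hs::nat \<Rightarrow> 'a \<Rightarrow> real^'d).
        0 \<le> tt 0 \<and> mono tt \<and>
        (\<forall>i<n. Hs i \<in> borel_measurable (F (tt i)) \<and> (\<exists>B. \<forall>\<omega>. norm (Hs i \<omega>) \<le> B)) \<and>
        (\<forall>s \<omega>. H s \<omega> = (\<Sum>i<n. indicator {tt i<..tt (Suc i)} s *\<^sub>R Hs i \<omega>)) \<and>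
        (\<forall>\<omega>. I \<omega> = (\<Sum>i<n. inner (Hs i \<omega>) (W (tt (Suc i)) \<omega> - W (tt i) \<omega>))))"

definition ito_integral :: "'a measure \<Rightarrow> (real \<Rightarrow> 'a \<Rightarrow> real^'d::finite)
     \<Rightarrow> (real \<Rightarrow> 'a \<Rightarrow> real^'d) \<Rightarrow> ('a \<Rightarrow> real) \<Rightarrow> bool" where
  "ito_integral M W Z I \<longleftrightarrow>
     I \<in> borel_measurable M \<and>
     (\<exists>(Hn::nat \<Rightarrow> real \<Rightarrow> 'a \<Rightarrow> real^'d) (In::nat \<Rightarrow> 'a \<Rightarrow> real).
        (\<forall>k. simple_integral (bm_filtration M W) W (Hn k) (In k)) \<and>
        (\<lambda>k. \<integral>\<^sup>+\<omega>. (\<integral>\<^sup>+s\<in>{0..}. ennreal ((norm (Hn k s \<omega> - Z s \<omega>))\<^sup>2) \<partial>lborel) \<partial>M)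
          \<longlonglongrightarrow> 0 \<and>
        (\<lambda>k. \<integral>\<^sup>+\<omega>. ennreal ((In k \<omega> - I \<omega>)\<^sup>2) \<partial>M) \<longlonglongrightarrow> 0)"

definition bsde_solution :: "'a measure \<Rightarrow> (real \<Rightarrow> 'a \<Rightarrow> real^'d::finite) \<Rightarrow> ('a \<Rightarrow> real)
     \<Rightarrow> ('a \<Rightarrow> real) \<Rightarrow> (real \<Rightarrow> 'a \<Rightarrow> real \<Rightarrow> real)
     \<Rightarrow> (real \<Rightarrow> 'a \<Rightarrow> real) \<Rightarrow> (real \<Rightarrow> 'a \<Rightarrow> real^'d) \<Rightarrow> bool" where
  "bsde_solution M W \<tau> \<xi> f Y Z \<longleftrightarrow>
     progressive (bm_filtration M W) Y \<and> progressive (bm_filtration M W) Z \<and>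
     (\<integral>\<^sup>+\<omega>. (SUP s\<in>{0..}. ennreal (\<bar>Y s \<omega>\<bar> ^ 4)) \<partial>M) < \<infinity> \<and>
     (\<integral>\<^sup>+\<omega>. (\<integral>\<^sup>+s\<in>{0..}. ennreal ((norm (Z s \<omega>))\<^sup>2) \<partial>lborel) ^ 2 \<partial>M) < \<infinity> \<and>
     (\<forall>t\<ge>0. \<exists>I. ito_integral M W (\<lambda>s \<omega>. indicator {min t (\<tau> \<omega>)<..\<tau> \<omega>} s *\<^sub>R Z s \<omega>) I \<and>
        (AE \<omega> in M. set_integrable lborel {min t (\<tau> \<omega>)..\<tau> \<omega>} (\<lambda>s. f s \<omega> (Y s \<omega>)) \<and>
           Y t \<omega> = \<xi> \<omega> + set_lebesgue_integral lborel {min t (\<tau> \<omega>)..\<tau> \<omega>} (\<lambda>s. f s \<omega> (Y s \<omega>))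
                    - I \<omega>))"

definition grid :: "real \<Rightarrow> real set" where
  "grid h = range (\<lambda>n::nat. real n * h)"

definition phi :: "real \<Rightarrow> real \<Rightarrow> real" where
  "phi h s = h * of_int \<lfloor>s / h\<rfloor>"

definition scheme_op :: "'a measure \<Rightarrow> (real \<Rightarrow> 'a measure) \<Rightarrow> real \<Rightarrow> ('a \<Rightarrow> real) \<Rightarrow> ('a \<Rightarrow> real)
     \<Rightarrow> (real \<Rightarrow> 'a \<Rightarrow> real \<Rightarrow> real) \<Rightarrow> (real \<Rightarrow> 'a \<Rightarrow> real) \<Rightarrow> real \<Rightarrow> 'a \<Rightarrow> real" where
  "scheme_op M F h \<tau>h \<xi>b fh R t \<omega> =
     indicator {\<omega>. t < \<tau>h \<omega>} \<omega> * real_cond_exp M (F t) (R (t + h)) \<omega>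
     + indicator {\<omega>. t < \<tau>h \<omega>} \<omega> * h * fh t \<omega> (R t \<omega>)
     + indicator {\<omega>. t = \<tau>h \<omega>} \<omega> * \<xi>b \<omega>"

definition scheme_space :: "'a measure \<Rightarrow> (real \<Rightarrow> 'a measure) \<Rightarrow> real \<Rightarrow> real \<Rightarrow> ('a \<Rightarrow> real)
     \<Rightarrow> (real \<Rightarrow> 'a \<Rightarrow> real) \<Rightarrow> bool" where
  "scheme_space M F L h \<tau>h R \<longleftrightarrow>
     (\<forall>t\<in>grid h. R t \<in> borel_measurable (F t) \<and> integrable M (\<lambda>\<omega>. (R t \<omega>)\<^sup>2) \<and>
        (\<forall>\<omega>\<in>space M. t > \<tau>h \<omega> \<longrightarrow> R t \<omega> = 0)) \<and>
     summable (\<lambda>n::nat. (1 - 3 * L * h) powr (- real n) *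
        sqrt (\<integral>\<omega>. (indicator {\<omega>. real n * h \<le> \<tau>h \<omega>} \<omega> * R (real n * h) \<omega>)\<^sup>2 \<partial>M))"

definition discrete_solution :: "'a measure \<Rightarrow> (real \<Rightarrow> 'a measure) \<Rightarrow> real \<Rightarrow> real \<Rightarrow> ('a \<Rightarrow> real)
     \<Rightarrow> ('a \<Rightarrow> real) \<Rightarrow> (real \<Rightarrow> 'a \<Rightarrow> real \<Rightarrow> real) \<Rightarrow> (real \<Rightarrow> 'a \<Rightarrow> real) \<Rightarrow> bool" where
  "discrete_solution M F L h \<tau>h \<xi>b fh Yb \<longleftrightarrow>
     (\<exists>R. scheme_space M F L h \<tau>h R \<and>
        (\<forall>t\<in>grid h. AE \<omega> in M. R t \<omega> = scheme_op M F h \<tau>h \<xi>b fh R t \<omega>) \<and>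
        (\<forall>t\<in>grid h. AE \<omega> in M. Yb t \<omega> = (if \<tau>h \<omega> \<le> t then \<xi>b \<omega> else R t \<omega>)))"

end

(*
  At a grid point t let D be the error Y - Yb. On {t < tau_h} the scheme and the BSDE give
  D_t = E_t[D_(t+h) + G] + h (f_h(t, Y_t) - f_h(t, Yb_t)), and after tau_h the same identity
  holds without the last term. Conditional expectations contract L2, so with x = L h
  (1 - x)^2 E[D_t^2] <= E[(D_(t+h) + G)^2], and Young's inequality with the weight
  1 + eps = exp(3x) (1 - x)^2 turns this into a recursion with growth factor exactly exp(3x);
  no Ito formula is needed. The error term G^2 is split into Delta F^2, the increment of Y over
  one step, and a term supported between tau and tau_h. Young's inequality leaves enough room
  for the coefficient of Delta F^2 to stay below 3 / (2 L). The increments of Y are controlled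
  by Ito's isometry, and summed over the grid they cost h times an exponential moment of
  int |Z|^2. Summability of the weighted norms in the space of the scheme kills the remainder
  at infinity.

  The suprema over h and s in the hypotheses need not be measurable, and the nonnegative integral
  of a non-measurable function is a lower integral. It still has a measurable lower envelope
  which dominates almost surely every single measurable member of the family; that envelope
  yields the random variable V.
*)

theory Submission
  imports Defs
begin

section \<open>Independence of Brownian increments\<close>

text \<open>The growth constant 3 L is what an implicit step affords: absorbing the Lipschitz term
  costs (1 - x)^(-2), about 1 + 2 x, and the remaining x is spent on Young's inequality, whose
  factor is then about 1 / (L h). Cauchy-Schwarz over a step returns one h, so a squared local error
  costs about 1 / L per unit of time, as in the claimed coefficient. Stopping shapes the recursion:
  \<tau>_h is grid-valued but \<tau> is not. Steps before \<tau>_h and steps between \<tau>_h and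
  \<tau> are therefore estimated separately, on events of F t, and every one-step estimate is
  localised to such an event. The random weight exp(3 L max(\<tau>, \<tau>_h)) is not adapted; it
  enters only after all conditional arguments, as an upper bound of deterministic weights on paths
  that are still active. The stochastic integral is only an L2 limit of simple integrals and is
  chosen for each t separately. Its centring and isometry on events of F t come from independent
  increments, and integrals at two times are related through the equation itself.\<close>

locale brownian = prob_space M for M :: "'a measure" +
  fixes W :: "real \<Rightarrow> 'a \<Rightarrow> real^'d::finite"
  assumes BM: "brownian_motion M W"
begin

abbreviation "F \<equiv> bm_filtration M W"

lemma W_meas: "0 \<le> t \<Longrightarrow> W t \<in> borel_measurable M"
  using BM by (auto simp: brownian_motion_def)

lemma W_0: "\<omega> \<in> space M \<Longrightarrow> W 0 \<omega> = 0"
  using BM by (auto simp: brownian_motion_def)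

lemma gen_subset:
  "{W s -` B \<inter> space M | s B. 0 \<le> s \<and> s \<le> t \<and> B \<in> sets borel} \<union> null_sets M \<subseteq> sets M"
  using W_meas by auto

lemma gen_Pow:
  "{W s -` B \<inter> space M | s B. 0 \<le> s \<and> s \<le> t \<and> B \<in> sets borel} \<union> null_sets M \<subseteq> Pow (space M)"
  using gen_subset[of t] sets.space_closed by blast

lemma space_F [simp]: "space (F t) = space M"
  unfolding bm_filtration_def using gen_Pow by (simp add: space_measure_of_conv)

lemma sets_F: "sets (F t) = sigma_sets (space M)
    ({W s -` B \<inter> space M | s B. 0 \<le> s \<and> s \<le> t \<and> B \<in> sets borel} \<union> null_sets M)"
  unfolding bm_filtration_def by (rule sets_measure_of[OF gen_Pow])

lemma sets_F_subset: "sets (F t) \<subseteq> sets M"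
  unfolding sets_F by (rule sets.sigma_sets_subset[OF gen_subset])

lemma subalg: "subalgebra M (F t)"
  using sets_F_subset by (auto simp: subalgebra_def)

lemma F_mono: "s \<le> t \<Longrightarrow> sets (F s) \<subseteq> sets (F t)"
  unfolding sets_F by (rule sigma_sets_mono') (auto intro: order_trans)

lemma filt: "filtration (space M) F"
  by unfold_locales (auto dest: F_mono[THEN subsetD])

lemma W_F: "0 \<le> s \<Longrightarrow> s \<le> t \<Longrightarrow> W s \<in> borel_measurable (F t)"
  by (rule measurableI) (auto simp: sets_F intro!: sigma_sets.Basic)

text \<open>The increments along the sorted times 0, ..., a, b are independent, and each value of W
  up to a is a sum of increments before the last one; hence the last increment is independent of the
  whole vector of values.\<close>

lemma indep_finite_dim:
  assumes S: "finite S" "S \<subseteq> {0..a}" and ab: "0 \<le> a" "a < b"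
    and B: "\<And>s. s \<in> S \<Longrightarrow> B s \<in> sets borel" and D: "D \<in> sets borel"
  shows "prob ({\<omega>\<in>space M. \<forall>s\<in>S. W s \<omega> \<in> B s} \<inter> ((\<lambda>\<omega>. W b \<omega> - W a \<omega>) -` D \<inter> space M))
    = prob {\<omega>\<in>space M. \<forall>s\<in>S. W s \<omega> \<in> B s} * prob ((\<lambda>\<omega>. W b \<omega> - W a \<omega>) -` D \<inter> space M)"
proof -
  \<comment> \<open>Inserting 0 makes every \<open>W (l ! i)\<close> a sum of increments because W
    starts at 0; inserting a makes the last increment exactly \<open>W b - W a\<close>.\<close>
  define l where "l = sorted_list_of_set (insert 0 (insert a S))"
  define ts where "ts = l @ [b]"
  define n where "n = length l"
  have fin: "finite (insert 0 (insert a S))" using S by simp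
  have set_l: "set l = insert 0 (insert a S)" unfolding l_def by (rule set_sorted_list_of_set[OF fin])
  have sl: "sorted_wrt (<) l" unfolding l_def by (rule strict_sorted_list_of_set)
  have le_a: "x \<le> a" "0 \<le> x" if "x \<in> set l" for x using that S ab unfolding set_l by auto
  have n: "n \<ge> 1" using set_l unfolding n_def by (cases l) auto
  have sts: "sorted_wrt (<) ts" unfolding ts_def sorted_wrt_append using sl le_a ab by force
  have l0: "l ! 0 = 0"
  proof -
    obtain i where i: "i < n" "l ! i = 0" using set_l unfolding n_def by (metis in_set_conv_nth insertI1)
    show ?thesis
    proof (rule ccontr)
      assume "l ! 0 \<noteq> 0"
      then have "0 < i" using i by (cases i) auto
      then have "l ! 0 < l ! i" using sorted_wrt_nth_less[OF sl, of 0 i] i unfolding n_def by blast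
      moreover have "l ! 0 \<in> set l" using n unfolding n_def by (intro nth_mem) linarith
      ultimately show False using le_a i by force
    qed
  qed
  have ln: "l ! (n - 1) = a"
  proof -
    obtain i where i: "i < n" "l ! i = a" using set_l unfolding n_def by (metis in_set_conv_nth insertI1 insertI2)
    show ?thesis
    proof (rule ccontr)
      assume *: "l ! (n - 1) \<noteq> a"
      then have "i < n - 1" using i by (cases "i = n - 1") auto
      then have "l ! i < l ! (n - 1)" using sorted_wrt_nth_less[OF sl, of i "n - 1"] i n unfolding n_def by simp
      moreover have "l ! (n - 1) \<in> set l" using n unfolding n_def by (intro nth_mem) linarith
      ultimately show False using le_a i by force
    qed
  qed
  define X where "X = (\<lambda>i \<omega>. W (ts ! Suc i) \<omega> - W (ts ! i) \<omega>)"
  have ind: "indep_vars (\<lambda>_. borel) X {..<n}"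
  proof -
    have "ts \<noteq> []" "hd ts = 0" using l0 n unfolding ts_def n_def by (cases l; simp)+
    then have "indep_vars (\<lambda>_. borel) (\<lambda>i \<omega>. W (ts ! Suc i) \<omega> - W (ts ! i) \<omega>) {..<length ts - 1}"
      using BM sts unfolding brownian_motion_def by auto
    then show ?thesis unfolding X_def by (simp add: ts_def n_def)
  qed
  have Xl: "X (n - 1) = (\<lambda>\<omega>. W b \<omega> - W a \<omega>)"
    using n ln unfolding X_def ts_def by (auto simp: nth_append n_def)
  have Wsum: "W (l ! i) \<omega> = (\<Sum>j<i. X j \<omega>)" if "i < n" "\<omega> \<in> space M" for i \<omega>
    using that(1)
  proof (induction i)
    case 0 then show ?case using l0 W_0 that by simp
  next
    case (Suc i)
    then show ?case by (simp add: X_def ts_def nth_append n_def)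
  qed
  \<comment> \<open>Disjoint blocks of independent variables are independent. The first block is
    empty when 0 and a are the only times.\<close>
  have iv: "indep_var (PiM {..<n-1} (\<lambda>_. borel)) (\<lambda>\<omega>. restrict (\<lambda>i. X i \<omega>) {..<n-1})
     (PiM {n-1} (\<lambda>_. borel)) (\<lambda>\<omega>. restrict (\<lambda>i. X i \<omega>) {n-1})"
    by (rule indep_var_restrict[OF ind]) (use n in auto)
  \<comment> \<open>The cylinder event, rewritten as a condition on partial sums of the first n - 1
    increments.\<close>
  define E where "E = {x \<in> space (PiM {..<n-1} (\<lambda>_. borel :: (real^'d) measure)).
      \<forall>i\<in>{i. i < n \<and> l ! i \<in> S}. (\<Sum>j<i. x j) \<in> B (l ! i)}"
  have E: "E \<in> sets (PiM {..<n-1} (\<lambda>_. borel))"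
    unfolding E_def
  proof (intro sets.sets_Collect_finite_All)
    fix i assume i: "i \<in> {i. i < n \<and> l ! i \<in> S}"
    have m: "(\<lambda>x. \<Sum>j<i. x j) \<in> borel_measurable (PiM {..<n-1} (\<lambda>_. borel :: (real^'d) measure))"
      by (rule borel_measurable_sum) (use i in \<open>auto intro!: measurable_component_singleton\<close>)
    have "B (l ! i) \<in> sets borel" using B i by auto
    from measurable_sets[OF m this]
    show "{x \<in> space (PiM {..<n-1} (\<lambda>_. borel)). (\<Sum>j<i. x j) \<in> B (l ! i)} \<in> sets (PiM {..<n-1} (\<lambda>_. borel))"
      by (simp add: vimage_def Int_def conj_commute)
  qed auto
  define D' where "D' = {x \<in> space (PiM {n-1} (\<lambda>_. borel :: (real^'d) measure)). x (n-1) \<in> D}"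
  have D': "D' \<in> sets (PiM {n-1} (\<lambda>_. borel))"
    unfolding D'_def using D by measurable
  have e1: "(\<lambda>\<omega>. restrict (\<lambda>i. X i \<omega>) {..<n-1}) -` E \<inter> space M = {\<omega>\<in>space M. \<forall>s\<in>S. W s \<omega> \<in> B s}" (is "?l = ?r")
  proof (intro set_eqI)
    fix \<omega>
    have "\<omega> \<in> ?l \<longleftrightarrow> \<omega> \<in> space M \<and> (\<forall>i. i < n \<and> l ! i \<in> S \<longrightarrow> (\<Sum>j<i. restrict (\<lambda>i. X i \<omega>) {..<n-1} j) \<in> B (l ! i))"
      by (auto simp: E_def space_PiM)
    also have "\<dots> \<longleftrightarrow> \<omega> \<in> space M \<and> (\<forall>i. i < n \<and> l ! i \<in> S \<longrightarrow> W (l ! i) \<omega> \<in> B (l ! i))"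
    proof -
      have "(\<Sum>j<i. restrict (\<lambda>i. X i \<omega>) {..<n-1} j) = W (l ! i) \<omega>" if "i < n" "\<omega> \<in> space M" for i
        unfolding Wsum[OF that] by (rule sum.cong) (use that in auto)
      then show ?thesis by auto
    qed
    also have "\<dots> \<longleftrightarrow> \<omega> \<in> ?r"
    proof -
      have "s \<in> S \<Longrightarrow> \<exists>i<n. l ! i = s" for s using set_l unfolding n_def by (metis in_set_conv_nth insertI2)
      then show ?thesis by blast
    qed
    finally show "\<omega> \<in> ?l \<longleftrightarrow> \<omega> \<in> ?r" .
  qed
  have e2: "(\<lambda>\<omega>. restrict (\<lambda>i. X i \<omega>) {n-1}) -` D' \<inter> space M = (\<lambda>\<omega>. W b \<omega> - W a \<omega>) -` D \<inter> space M"
    unfolding D'_def Xl[symmetric] by (auto simp: space_PiM)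
  have e3: "(\<lambda>\<omega>. (restrict (\<lambda>i. X i \<omega>) {..<n-1}, restrict (\<lambda>i. X i \<omega>) {n-1})) -` (E \<times> D') \<inter> space M
     = {\<omega>\<in>space M. \<forall>s\<in>S. W s \<omega> \<in> B s} \<inter> ((\<lambda>\<omega>. W b \<omega> - W a \<omega>) -` D \<inter> space M)"
    unfolding e1[symmetric] e2[symmetric] by auto
  show ?thesis using indep_varD[OF iv E D'] unfolding e1 e2 e3 .
qed

text \<open>A pi-system argument: cylinders over finitely many times, together with the null sets,
  are intersection stable and generate a sigma-algebra containing F a. Events at a single time are
  not intersection stable, whence the cylinders.\<close>

lemma indep_increment:
  assumes ab: "0 \<le> a" "a < b"
  shows "indep_set (sets (F a)) (sigma_sets (space M) {(\<lambda>\<omega>. W b \<omega> - W a \<omega>) -` D \<inter> space M | D. D \<in> sets borel})"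
proof -
  define G where "G = {{\<omega>\<in>space M. \<forall>s\<in>S. W s \<omega> \<in> B s} | S B. finite S \<and> S \<subseteq> {0..a} \<and> (\<forall>s\<in>S. B s \<in> sets borel)} \<union> null_sets M"
  define H where "H = {(\<lambda>\<omega>. W b \<omega> - W a \<omega>) -` D \<inter> space M | D. D \<in> sets borel}"
  have [measurable]: "W b \<in> borel_measurable M" "W a \<in> borel_measurable M" using W_meas ab by auto
  have fd: "{\<omega>\<in>space M. \<forall>s\<in>S. W s \<omega> \<in> B s} \<in> sets M"
    if "finite S" "S \<subseteq> {0..a}" "\<forall>s\<in>S. B s \<in> sets borel" for S and B :: "real \<Rightarrow> (real^'d) set"
  proof -
    have "{\<omega>\<in>space M. W s \<omega> \<in> B s} \<in> sets M" if "s \<in> S" for s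
    proof -
      have "W s \<in> borel_measurable M" using that \<open>S \<subseteq> {0..a}\<close> W_meas by auto
      then show ?thesis using \<open>\<forall>s\<in>S. B s \<in> sets borel\<close> that by measurable
    qed
    then show ?thesis using that(1) by (intro sets.sets_Collect_finite_All) auto
  qed
  have G_ev: "G \<subseteq> events" unfolding G_def using fd by auto
  have H_ev: "H \<subseteq> events" unfolding H_def by auto
  have iGH: "indep_set G H"
  proof (rule indep_setI[OF G_ev H_ev])
    fix x y assume x: "x \<in> G" and y: "y \<in> H"
    show "prob (x \<inter> y) = prob x * prob y"
    \<comment> \<open>Null sets are independent of everything, so augmenting the filtration is
      harmless.\<close>
    proof (cases "x \<in> null_sets M")
      case True
      then have "x \<inter> y \<in> null_sets M" using y H_ev by (intro null_set_Int2) auto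
      then show ?thesis using True by (simp add: measure_eq_0_null_sets)
    next
      case False
      then obtain S B where "x = {\<omega>\<in>space M. \<forall>s\<in>S. W s \<omega> \<in> B s}" "finite S" "S \<subseteq> {0..a}" "\<forall>s\<in>S. B s \<in> sets borel"
        using x unfolding G_def by auto
      moreover obtain D where "y = (\<lambda>\<omega>. W b \<omega> - W a \<omega>) -` D \<inter> space M" "D \<in> sets borel"
        using y unfolding H_def by auto
      ultimately show ?thesis using indep_finite_dim[OF _ _ ab] by auto
    qed
  qed
  have sG: "Int_stable G"
    unfolding Int_stable_def
  proof (intro ballI)
    fix x y assume x: "x \<in> G" and y: "y \<in> G"
    show "x \<inter> y \<in> G"
    proof (cases "x \<in> null_sets M \<or> y \<in> null_sets M")
      case True
      then have "x \<inter> y \<in> null_sets M" using x y G_ev by (auto intro: null_set_Int1 null_set_Int2)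
      then show ?thesis unfolding G_def by auto
    next
      case False
      then obtain S B where 1: "x = {\<omega>\<in>space M. \<forall>s\<in>S. W s \<omega> \<in> B s}" "finite S" "S \<subseteq> {0..a}" "\<forall>s\<in>S. B s \<in> sets borel"
        using x unfolding G_def by blast
      from False obtain S' B' where 2: "y = {\<omega>\<in>space M. \<forall>s\<in>S'. W s \<omega> \<in> B' s}" "finite S'" "S' \<subseteq> {0..a}" "\<forall>s\<in>S'. B' s \<in> sets borel"
        using y unfolding G_def by blast
      \<comment> \<open>A time occurring in only one of the two cylinders is unconstrained in the
        other.\<close>
      define C where "C = (\<lambda>s. (if s \<in> S then B s else UNIV) \<inter> (if s \<in> S' then B' s else UNIV))"
      have "x \<inter> y = {\<omega>\<in>space M. \<forall>s\<in>S \<union> S'. W s \<omega> \<in> C s}"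
        unfolding 1(1) 2(1) C_def by auto
      moreover have "\<forall>s\<in>S \<union> S'. C s \<in> sets borel" using 1 2 unfolding C_def by auto
      moreover have "finite (S \<union> S')" "S \<union> S' \<subseteq> {0..a}" using 1 2 by auto
      ultimately have "\<exists>S B. x \<inter> y = {\<omega>\<in>space M. \<forall>s\<in>S. W s \<omega> \<in> B s} \<and> finite S \<and> S \<subseteq> {0..a} \<and> (\<forall>s\<in>S. B s \<in> sets borel)"
        by (intro exI[of _ "S \<union> S'"] exI[of _ C]) simp
      then show ?thesis unfolding G_def by (intro UnI1 CollectI)
    qed
  qed
  have sH: "Int_stable H"
    unfolding Int_stable_def H_def
  proof safe
    fix D D' :: "(real^'d) set" assume "D \<in> sets borel" "D' \<in> sets borel"
    then show "\<exists>Da. (\<lambda>\<omega>. W b \<omega> - W a \<omega>) -` D \<inter> space M \<inter> ((\<lambda>\<omega>. W b \<omega> - W a \<omega>) -` D' \<inter> space M)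
       = (\<lambda>\<omega>. W b \<omega> - W a \<omega>) -` Da \<inter> space M \<and> Da \<in> sets borel"
      by (intro exI[of _ "D \<inter> D'"]) auto
  qed
  have GH: "indep_set (sigma_sets (space M) G) (sigma_sets (space M) H)"
    by (rule indep_set_sigma_sets[OF iGH sG sH])
  have FG: "sets (F a) \<subseteq> sigma_sets (space M) G"
    unfolding sets_F
  proof (rule sigma_sets_mono')
    have "W s -` B \<inter> space M \<in> G" if "0 \<le> s" "s \<le> a" "B \<in> sets borel" for s B
    proof -
      have "W s -` B \<inter> space M = {\<omega>\<in>space M. \<forall>r\<in>{s}. W r \<omega> \<in> B}" by auto
      moreover have "finite {s}" "{s} \<subseteq> {0..a}" "\<forall>r\<in>{s}. B \<in> sets borel" using that by auto
      ultimately have "\<exists>S Bs. W s -` B \<inter> space M = {\<omega>\<in>space M. \<forall>r\<in>S. W r \<omega> \<in> Bs r} \<and> finite S \<and> S \<subseteq> {0..a} \<and> (\<forall>r\<in>S. Bs r \<in> sets borel)"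
        by (intro exI[of _ "{s}"] exI[of _ "\<lambda>_. B"]) simp
      then show ?thesis unfolding G_def by (intro UnI1 CollectI)
    qed
    then show "{W s -` B \<inter> space M | s B. 0 \<le> s \<and> s \<le> a \<and> B \<in> sets borel} \<union> null_sets M \<subseteq> G"
      by (auto simp: G_def)
  qed
  show ?thesis
    unfolding H_def[symmetric]
  proof (rule indep_setI[OF sets_F_subset sets.sigma_sets_subset[OF H_ev]])
    fix x y assume "x \<in> sets (F a)" "y \<in> sigma_sets (space M) H"
    then show "prob (x \<inter> y) = prob x * prob y" using indep_setD[OF GH] FG by blast
  qed
qed

text \<open>The two generated sigma-algebras lie inside the independent ones of the preceding
  lemma.\<close>

lemma indep_var_increment:
  fixes X :: "'a \<Rightarrow> real" and g :: "real^'d \<Rightarrow> real"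
  assumes ab: "0 \<le> a" "a < b" and X: "X \<in> borel_measurable (F a)" and g: "g \<in> borel_measurable borel"
  shows "indep_var borel X borel (\<lambda>\<omega>. g (W b \<omega> - W a \<omega>))"
proof -
  have [measurable]: "W b \<in> borel_measurable M" "W a \<in> borel_measurable M" using W_meas ab by auto
  have XM[measurable]: "X \<in> borel_measurable M" using measurable_from_subalg[OF subalg X] .
  note g[measurable]
  show ?thesis
    unfolding indep_var_eq
  proof safe
    have 1: "sigma_sets (space M) {X -` A \<inter> space M |A. A \<in> sets borel} \<subseteq> sets (F a)"
    proof -
      have "{X -` A \<inter> space M |A. A \<in> sets borel} \<subseteq> sets (F a)" using measurable_sets[OF X] by auto
      from sets.sigma_sets_subset[OF this] show ?thesis by simp
    qed
    have 2: "sigma_sets (space M) {(\<lambda>\<omega>. g (W b \<omega> - W a \<omega>)) -` A \<inter> space M |A. A \<in> sets borel}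
      \<subseteq> sigma_sets (space M) {(\<lambda>\<omega>. W b \<omega> - W a \<omega>) -` D \<inter> space M | D. D \<in> sets borel}"
    proof (rule sigma_sets_mono', safe)
      fix A :: "real set" assume "A \<in> sets borel"
      then have "g -` A \<in> sets borel" using measurable_sets[OF g, of A] by simp
      then show "\<exists>D. (\<lambda>\<omega>. g (W b \<omega> - W a \<omega>)) -` A \<inter> space M = (\<lambda>\<omega>. W b \<omega> - W a \<omega>) -` D \<inter> space M \<and> D \<in> sets borel"
        by (intro exI[of _ "g -` A"]) auto
    qed
    from indep_increment[OF ab] have 3: "\<forall>x\<in>sets (F a). \<forall>y\<in>sigma_sets (space M) {(\<lambda>\<omega>. W b \<omega> - W a \<omega>) -` D \<inter> space M | D. D \<in> sets borel}.
      prob (x \<inter> y) = prob x * prob y" unfolding indep_sets2_eq by blast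
    show "indep_set (sigma_sets (space M) {X -` A \<inter> space M |A. A \<in> sets borel})
     (sigma_sets (space M) {(\<lambda>\<omega>. g (W b \<omega> - W a \<omega>)) -` A \<inter> space M |A. A \<in> sets borel})"
    proof (rule indep_setI)
      show "sigma_sets (space M) {X -` A \<inter> space M |A. A \<in> sets borel} \<subseteq> events" using 1 sets_F_subset by blast
      show "sigma_sets (space M) {(\<lambda>\<omega>. g (W b \<omega> - W a \<omega>)) -` A \<inter> space M |A. A \<in> sets borel} \<subseteq> events"
        by (rule sets.sigma_sets_subset) auto
      show "prob (x \<inter> y) = prob x * prob y" if "x \<in> sigma_sets (space M) {X -` A \<inter> space M |A. A \<in> sets borel}"
        "y \<in> sigma_sets (space M) {(\<lambda>\<omega>. g (W b \<omega> - W a \<omega>)) -` A \<inter> space M |A. A \<in> sets borel}" for x y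
        using 3 that 1 2 by blast
    qed
  qed measurable
qed

end

section \<open>Moments of Gaussian increments and of simple integrals\<close>

text \<open>Lebesgue measure on a Euclidean space is the image of the product measure on the
  coordinates, so Fubini factorises the integral.\<close>

lemma lborel_prod_Basis:
  fixes f :: "'b::euclidean_space \<Rightarrow> real \<Rightarrow> real"
  assumes f: "\<And>b. b \<in> Basis \<Longrightarrow> integrable lborel (f b)"
  shows "integrable (lborel :: 'b measure) (\<lambda>x. \<Prod>b\<in>Basis. f b (x \<bullet> b))" (is ?A)
    and "(\<integral>x. (\<Prod>b\<in>Basis. f b (x \<bullet> b)) \<partial>(lborel :: 'b measure)) = (\<Prod>b\<in>Basis. \<integral>y. f b y \<partial>lborel)" (is ?B)
proof -
  interpret P: product_sigma_finite "\<lambda>_::'b. lborel :: real measure" ..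
  have m: "(\<lambda>g. \<Sum>b\<in>Basis. g b *\<^sub>R b) \<in> (\<Pi>\<^sub>M b\<in>(Basis::'b set). (lborel :: real measure)) \<rightarrow>\<^sub>M (borel :: 'b measure)"
    by measurable
  have [measurable]: "b \<in> Basis \<Longrightarrow> f b \<in> borel_measurable borel" for b
    using borel_measurable_integrable[OF f] by simp
  have m2: "(\<lambda>x. \<Prod>b\<in>Basis. f b (x \<bullet> b)) \<in> borel_measurable (borel :: 'b measure)"
    by measurable
  have eq: "(\<Prod>b\<in>Basis. f b ((\<Sum>c\<in>Basis. g c *\<^sub>R c) \<bullet> b)) = (\<Prod>b\<in>Basis. f b (g b))" for g :: "'b \<Rightarrow> real"
    by (intro prod.cong refl) simp
  show ?A
    unfolding lborel_eq[where 'a='b] integrable_distr_eq[OF m m2] eq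
    by (rule P.product_integrable_prod) (use f in auto)
  show ?B
    unfolding lborel_eq[where 'a='b] integral_distr[OF m m2] eq
    by (subst P.product_integral_prod) (use f in auto)
qed

text \<open>The density of an increment is a product over the index type rather than over
  \<open>Basis\<close>; the bijection sending i to \<open>axis i 1\<close> matches the two.\<close>

lemma lborel_prod_vec:
  fixes f :: "'d::finite \<Rightarrow> real \<Rightarrow> real"
  assumes f: "\<And>i. integrable lborel (f i)"
  shows "integrable (lborel :: (real^'d) measure) (\<lambda>x. \<Prod>i\<in>UNIV. f i (x $ i))"
    and "(\<integral>x. (\<Prod>i\<in>UNIV. f i (x $ i)) \<partial>(lborel :: (real^'d) measure)) = (\<Prod>i\<in>UNIV. \<integral>y. f i y \<partial>lborel)"
proof -
  define e where "e = (\<lambda>i::'d. axis i (1::real))"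
  have inj: "inj e" by (auto simp: inj_on_def e_def axis_eq_axis)
  have rng: "range e = Basis" by (auto simp: Basis_vec_def e_def)
  have b: "bij_betw e UNIV Basis" using inj rng by (simp add: bij_betw_def)
  have inv: "inv e (e i) = i" for i using inj by simp
  have eq1: "(\<Prod>b\<in>Basis. f (inv e b) (x \<bullet> b)) = (\<Prod>i\<in>UNIV. f i (x $ i))" for x :: "real^'d"
    unfolding prod.reindex_bij_betw[OF b, symmetric] inv by (simp add: e_def cart_eq_inner_axis)
  have eq2: "(\<Prod>b\<in>Basis. \<integral>y. f (inv e b) y \<partial>lborel) = (\<Prod>i\<in>UNIV. \<integral>y. f i y \<partial>lborel)"
    unfolding prod.reindex_bij_betw[OF b, symmetric] inv ..
  show "integrable (lborel :: (real^'d) measure) (\<lambda>x. \<Prod>i\<in>UNIV. f i (x $ i))"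
    using lborel_prod_Basis(1)[where f = "\<lambda>b. f (inv e b)"] f unfolding eq1 by simp
  show "(\<integral>x. (\<Prod>i\<in>UNIV. f i (x $ i)) \<partial>(lborel :: (real^'d) measure)) = (\<Prod>i\<in>UNIV. \<integral>y. f i y \<partial>lborel)"
    using lborel_prod_Basis(2)[where f = "\<lambda>b. f (inv e b)"] f unfolding eq1 eq2 by simp
qed

lemma gaussian_vec_first:
  fixes k :: "'d::finite"
  assumes "\<sigma> > 0"
  shows "integrable (lborel :: (real^'d) measure) (\<lambda>x. (\<Prod>i\<in>UNIV. normal_density 0 \<sigma> (x $ i)) * x $ k)"
    and "(\<integral>x. (\<Prod>i\<in>UNIV. normal_density 0 \<sigma> (x $ i)) * x $ k \<partial>(lborel :: (real^'d) measure)) = 0"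
proof -
  \<comment> \<open>The factor y is attached to coordinate k only, whose integral is then the
    vanishing mean.\<close>
  define f where "f = (\<lambda>i y. normal_density 0 \<sigma> y * (if i = k then y else 1))"
  have eq: "(\<Prod>i\<in>UNIV. f i (x $ i)) = (\<Prod>i\<in>UNIV. normal_density 0 \<sigma> (x $ i)) * x $ k" for x :: "real^'d"
    unfolding f_def prod.distrib by simp
  have int: "integrable lborel (f i)" for i
    unfolding f_def using assms by (cases "i = k") (auto simp: integrable_normal_moment_nz_1)
  have "(\<integral>y. f k y \<partial>lborel) = 0" unfolding f_def using assms by (simp add: integral_normal_moment_nz_1)
  then have 0: "(\<Prod>i\<in>UNIV. \<integral>y. f i y \<partial>lborel) = 0" by (intro prod_zero) auto
  show "integrable (lborel :: (real^'d) measure) (\<lambda>x. (\<Prod>i\<in>UNIV. normal_density 0 \<sigma> (x $ i)) * x $ k)"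
    using lborel_prod_vec(1)[of f, OF int] unfolding eq .
  show "(\<integral>x. (\<Prod>i\<in>UNIV. normal_density 0 \<sigma> (x $ i)) * x $ k \<partial>(lborel :: (real^'d) measure)) = 0"
    using lborel_prod_vec(2)[of f, OF int] unfolding eq 0 .
qed

lemma gaussian_vec_second:
  fixes k l :: "'d::finite"
  assumes \<sigma>: "\<sigma> > 0"
  shows "integrable (lborel :: (real^'d) measure) (\<lambda>x. (\<Prod>i\<in>UNIV. normal_density 0 \<sigma> (x $ i)) * (x $ k * x $ l))"
    and "(\<integral>x. (\<Prod>i\<in>UNIV. normal_density 0 \<sigma> (x $ i)) * (x $ k * x $ l) \<partial>(lborel :: (real^'d) measure))
      = (if k = l then \<sigma>\<^sup>2 else 0)"
proof -
  \<comment> \<open>The coordinates k and l each receive a factor y: for k = l they meet in one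
    second moment, otherwise a vanishing mean appears in the product.\<close>
  define f where "f = (\<lambda>i y. normal_density 0 \<sigma> y * ((if i = k then y else 1) * (if i = l then y else 1)))"
  have eq: "(\<Prod>i\<in>UNIV. f i (x $ i)) = (\<Prod>i\<in>UNIV. normal_density 0 \<sigma> (x $ i)) * (x $ k * x $ l)" for x :: "real^'d"
    unfolding f_def prod.distrib by simp
  have sq: "integrable lborel (\<lambda>y. normal_density 0 \<sigma> y * (y * y))"
    using integrable_normal_moment[OF \<sigma>, of 0 2] by (simp add: power2_eq_square)
  have sqv: "(\<integral>y. normal_density 0 \<sigma> y * (y * y) \<partial>lborel) = \<sigma>\<^sup>2"
    using integral_normal_moment_even[OF \<sigma>, of 0 1] by (simp add: power2_eq_square)
  have int: "integrable lborel (f i)" for i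
    unfolding f_def using \<sigma> sq by (cases "i = k"; cases "i = l") (auto simp: integrable_normal_moment_nz_1)
  have v: "(\<Prod>i\<in>UNIV. \<integral>y. f i y \<partial>lborel) = (if k = l then \<sigma>\<^sup>2 else 0)"
  proof (cases "k = l")
    case True
    have "(\<integral>y. f i y \<partial>lborel) = (if i = k then \<sigma>\<^sup>2 else 1)" for i
      unfolding f_def using True \<sigma> sqv by auto
    then show ?thesis using True by simp
  next
    case False
    have "(\<integral>y. f k y \<partial>lborel) = 0" unfolding f_def using \<sigma> False by (simp add: integral_normal_moment_nz_1)
    then show ?thesis using False by (auto intro!: prod_zero)
  qed
  show "integrable (lborel :: (real^'d) measure) (\<lambda>x. (\<Prod>i\<in>UNIV. normal_density 0 \<sigma> (x $ i)) * (x $ k * x $ l))"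
    using lborel_prod_vec(1)[of f, OF int] unfolding eq .
  show "(\<integral>x. (\<Prod>i\<in>UNIV. normal_density 0 \<sigma> (x $ i)) * (x $ k * x $ l) \<partial>(lborel :: (real^'d) measure))
      = (if k = l then \<sigma>\<^sup>2 else 0)"
    using lborel_prod_vec(2)[of f, OF int] unfolding eq v .
qed

context brownian
begin

lemma distributed_increment:
  assumes "0 \<le> a" "a < b"
  shows "distributed M lborel (\<lambda>\<omega>. W b \<omega> - W a \<omega>)
          (\<lambda>x. ennreal (\<Prod>i\<in>UNIV. normal_density 0 (sqrt (b - a)) (x $ i)))"
  using BM assms by (auto simp: brownian_motion_def)

lemma increment_moments:
  assumes ab: "0 \<le> a" "a < b"
  shows "integrable M (\<lambda>\<omega>. (W b \<omega> - W a \<omega>) $ k)" "(\<integral>\<omega>. (W b \<omega> - W a \<omega>) $ k \<partial>M) = 0"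
    "integrable M (\<lambda>\<omega>. (W b \<omega> - W a \<omega>) $ k * (W b \<omega> - W a \<omega>) $ l)"
    "(\<integral>\<omega>. (W b \<omega> - W a \<omega>) $ k * (W b \<omega> - W a \<omega>) $ l \<partial>M) = (if k = l then b - a else 0)"
proof -
  have s: "sqrt (b - a) > 0" "(sqrt (b - a))\<^sup>2 = b - a" using ab by auto
  have nn: "0 \<le> (\<Prod>i\<in>UNIV. normal_density 0 (sqrt (b - a)) (x $ i))" for x :: "real^'d"
    by (intro prod_nonneg) auto
  note D = distributed_increment[OF ab]
  show "integrable M (\<lambda>\<omega>. (W b \<omega> - W a \<omega>) $ k)"
    using distributed_integrable[OF D, of "\<lambda>x. x $ k"] gaussian_vec_first(1)[OF s(1)] nn by auto
  show "(\<integral>\<omega>. (W b \<omega> - W a \<omega>) $ k \<partial>M) = 0"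
    using distributed_integral[OF D, of "\<lambda>x. x $ k"] gaussian_vec_first(2)[OF s(1), of k] nn by simp
  show "integrable M (\<lambda>\<omega>. (W b \<omega> - W a \<omega>) $ k * (W b \<omega> - W a \<omega>) $ l)"
    using distributed_integrable[OF D, of "\<lambda>x. x $ k * x $ l"] gaussian_vec_second(1)[OF s(1)] nn by auto
  show "(\<integral>\<omega>. (W b \<omega> - W a \<omega>) $ k * (W b \<omega> - W a \<omega>) $ l \<partial>M) = (if k = l then b - a else 0)"
    using distributed_integral[OF D, of "\<lambda>x. x $ k * x $ l"] gaussian_vec_second(2)[OF s(1), of k l] nn s(2)
    by (cases "k = l") simp_all
qed

text \<open>Independence of the increment from F a factorises the expectation, and the increment is
  centred. The case a = b is included because partitions are only required to be monotone; the
  increment then has no density and is treated apart.\<close>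

lemma increment_first:
  assumes ab: "0 \<le> a" "a \<le> b" and X: "X \<in> borel_measurable (F a)" "integrable M X"
  shows "integrable M (\<lambda>\<omega>. X \<omega> * (W b \<omega> - W a \<omega>) $ k)" "(\<integral>\<omega>. X \<omega> * (W b \<omega> - W a \<omega>) $ k \<partial>M) = 0"
proof -
  have "integrable M (\<lambda>\<omega>. X \<omega> * (W b \<omega> - W a \<omega>) $ k) \<and> (\<integral>\<omega>. X \<omega> * (W b \<omega> - W a \<omega>) $ k \<partial>M) = 0"
  proof (cases "a = b")
    case False
    then have ab: "0 \<le> a" "a < b" using ab by auto
    have i: "indep_var borel X borel (\<lambda>\<omega>. (W b \<omega> - W a \<omega>) $ k)"
      by (rule indep_var_increment[OF ab X(1)]) auto
    show ?thesis
      using indep_var_lebesgue_integral[OF i X(2) increment_moments(1)[OF ab]]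
        indep_var_integrable[OF i X(2) increment_moments(1)[OF ab]] increment_moments(2)[OF ab, of k] by simp
  qed auto
  then show "integrable M (\<lambda>\<omega>. X \<omega> * (W b \<omega> - W a \<omega>) $ k)" "(\<integral>\<omega>. X \<omega> * (W b \<omega> - W a \<omega>) $ k \<partial>M) = 0" by auto
qed

lemma increment_second:
  assumes ab: "0 \<le> a" "a \<le> b" and X: "X \<in> borel_measurable (F a)" "integrable M X"
  shows "integrable M (\<lambda>\<omega>. X \<omega> * ((W b \<omega> - W a \<omega>) $ k * (W b \<omega> - W a \<omega>) $ l))"
    "(\<integral>\<omega>. X \<omega> * ((W b \<omega> - W a \<omega>) $ k * (W b \<omega> - W a \<omega>) $ l) \<partial>M) = (\<integral>\<omega>. X \<omega> \<partial>M) * (if k = l then b - a else 0)"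
proof -
  have "integrable M (\<lambda>\<omega>. X \<omega> * ((W b \<omega> - W a \<omega>) $ k * (W b \<omega> - W a \<omega>) $ l)) \<and>
    (\<integral>\<omega>. X \<omega> * ((W b \<omega> - W a \<omega>) $ k * (W b \<omega> - W a \<omega>) $ l) \<partial>M) = (\<integral>\<omega>. X \<omega> \<partial>M) * (if k = l then b - a else 0)"
  proof (cases "a = b")
    case False
    then have ab: "0 \<le> a" "a < b" using ab by auto
    have i: "indep_var borel X borel (\<lambda>\<omega>. (W b \<omega> - W a \<omega>) $ k * (W b \<omega> - W a \<omega>) $ l)"
      by (rule indep_var_increment[OF ab X(1), of "\<lambda>x. x $ k * x $ l"]) auto
    show ?thesis
      using indep_var_lebesgue_integral[OF i X(2) increment_moments(3)[OF ab]]
        indep_var_integrable[OF i X(2) increment_moments(3)[OF ab]] increment_moments(4)[OF ab, of k l] by simp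
  qed auto
  then show "integrable M (\<lambda>\<omega>. X \<omega> * ((W b \<omega> - W a \<omega>) $ k * (W b \<omega> - W a \<omega>) $ l))"
    "(\<integral>\<omega>. X \<omega> * ((W b \<omega> - W a \<omega>) $ k * (W b \<omega> - W a \<omega>) $ l) \<partial>M) = (\<integral>\<omega>. X \<omega> \<partial>M) * (if k = l then b - a else 0)" by auto
qed

lemma integrable_bounded_mult:
  fixes f g :: "'a \<Rightarrow> real"
  assumes f: "integrable M f" and g: "g \<in> borel_measurable M" "\<And>\<omega>. \<bar>g \<omega>\<bar> \<le> B"
  shows "integrable M (\<lambda>\<omega>. f \<omega> * g \<omega>)"
proof (rule Bochner_Integration.integrable_bound)
  show "integrable M (\<lambda>\<omega>. B * \<bar>f \<omega>\<bar>)" using f by auto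
  show "(\<lambda>\<omega>. f \<omega> * g \<omega>) \<in> borel_measurable M" using f g by measurable
  have "\<bar>f \<omega> * g \<omega>\<bar> \<le> \<bar>B * \<bar>f \<omega>\<bar>\<bar>" for \<omega>
  proof -
    have "\<bar>f \<omega> * g \<omega>\<bar> \<le> \<bar>f \<omega>\<bar> * B" using mult_left_mono[OF g(2)[of \<omega>], of "\<bar>f \<omega>\<bar>"] by (simp add: abs_mult)
    also have "\<dots> \<le> \<bar>B * \<bar>f \<omega>\<bar>\<bar>" by (simp add: mult.commute)
    finally show ?thesis .
  qed
  then show "AE \<omega> in M. norm (f \<omega> * g \<omega>) \<le> norm (B * \<bar>f \<omega>\<bar>)" by auto
qed

text \<open>Induction on the number of intervals. The new term is a bounded F a-measurable vector
  paired with a centred independent increment, hence orthogonal to the partial sum; distinct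
  coordinates of the increment are uncorrelated, so only the diagonal contributes to its
  variance.\<close>

lemma simple_sum_moments:
  fixes G :: "nat \<Rightarrow> 'a \<Rightarrow> real^'d" and tt :: "nat \<Rightarrow> real"
  assumes tt: "mono tt" "0 \<le> tt 0"
    and G: "\<And>i. i < n \<Longrightarrow> G i \<in> borel_measurable (F (tt i))" "\<And>i. i < n \<Longrightarrow> \<exists>B. \<forall>\<omega>. norm (G i \<omega>) \<le> B"
  defines "S \<equiv> \<lambda>n \<omega>. \<Sum>i<n. G i \<omega> \<bullet> (W (tt (Suc i)) \<omega> - W (tt i) \<omega>)"
  shows "S n \<in> borel_measurable (F (tt n))" "integrable M (S n)" "(\<integral>\<omega>. S n \<omega> \<partial>M) = 0"
    "integrable M (\<lambda>\<omega>. (S n \<omega>)\<^sup>2)"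
    "(\<integral>\<omega>. (S n \<omega>)\<^sup>2 \<partial>M) = (\<Sum>i<n. (tt (Suc i) - tt i) * (\<integral>\<omega>. (norm (G i \<omega>))\<^sup>2 \<partial>M))"
proof -
  have "S n \<in> borel_measurable (F (tt n)) \<and> integrable M (S n) \<and> (\<integral>\<omega>. S n \<omega> \<partial>M) = 0 \<and>
    integrable M (\<lambda>\<omega>. (S n \<omega>)\<^sup>2) \<and>
    (\<integral>\<omega>. (S n \<omega>)\<^sup>2 \<partial>M) = (\<Sum>i<n. (tt (Suc i) - tt i) * (\<integral>\<omega>. (norm (G i \<omega>))\<^sup>2 \<partial>M))"
    using G
  proof (induction n)
    case 0
    then show ?case by (simp add: S_def)
  next
    case (Suc n)
    define a where "a = tt n"
    define b where "b = tt (Suc n)"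
    have ab: "0 \<le> a" "a \<le> b" using tt monoD[OF tt(1), of 0 n] monoD[OF tt(1), of n "Suc n"] by (auto simp: a_def b_def)
    have IH: "S n \<in> borel_measurable (F a)" "integrable M (S n)" "(\<integral>\<omega>. S n \<omega> \<partial>M) = 0"
      "integrable M (\<lambda>\<omega>. (S n \<omega>)\<^sup>2)"
      "(\<integral>\<omega>. (S n \<omega>)\<^sup>2 \<partial>M) = (\<Sum>i<n. (tt (Suc i) - tt i) * (\<integral>\<omega>. (norm (G i \<omega>))\<^sup>2 \<partial>M))"
      using Suc.IH Suc.prems unfolding a_def by auto
    obtain B where B: "norm (G n \<omega>) \<le> B" for \<omega> using Suc.prems(2)[of n] by auto
    \<comment> \<open>Coordinates reduce the inner product to scalar products of an adapted factor
      and an increment; boundedness keeps each of them integrable.\<close>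
    define g where "g = (\<lambda>k \<omega>. G n \<omega> $ k)"
    define d where "d = (\<lambda>k \<omega>. (W b \<omega> - W a \<omega>) $ k)"
    have gF: "g k \<in> borel_measurable (F a)" for k
      using Suc.prems(1)[of n] unfolding g_def a_def by (auto intro!: measurable_compose[OF _ borel_measurable_nth])
    have gM: "g k \<in> borel_measurable M" for k by (rule measurable_from_subalg[OF subalg gF])
    have gB: "\<bar>g k \<omega>\<bar> \<le> B" for k \<omega>
      using B[of \<omega>] component_le_norm_cart[of "G n \<omega>" k] unfolding g_def by (meson order_trans)
    have int1: "integrable M (\<lambda>_. 1::real)" by simp
    have ig: "integrable M (g k)" for k using integrable_bounded_mult[OF int1 gM gB] by simp
    have igg: "integrable M (\<lambda>\<omega>. g k \<omega> * g l \<omega>)" for k l using integrable_bounded_mult[OF ig gM gB] .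
    have iSg: "integrable M (\<lambda>\<omega>. S n \<omega> * g l \<omega>)" for l using integrable_bounded_mult[OF IH(2) gM gB] .
    have ggF: "(\<lambda>\<omega>. g k \<omega> * g l \<omega>) \<in> borel_measurable (F a)" for k l using gF by measurable
    have SgF: "(\<lambda>\<omega>. S n \<omega> * g l \<omega>) \<in> borel_measurable (F a)" for l using gF IH(1) by measurable
    define T where "T = (\<lambda>\<omega>. G n \<omega> \<bullet> (W b \<omega> - W a \<omega>))"
    have T: "T \<omega> = (\<Sum>k\<in>UNIV. g k \<omega> * d k \<omega>)" for \<omega>
      unfolding T_def g_def d_def inner_vec_def by simp
    have S': "S (Suc n) = (\<lambda>\<omega>. S n \<omega> + T \<omega>)" unfolding S_def T_def a_def b_def by simp
    have ST: "S n \<omega> * T \<omega> = (\<Sum>k\<in>UNIV. S n \<omega> * g k \<omega> * d k \<omega>)" for \<omega>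
      unfolding T sum_distrib_left by (simp add: mult.assoc)
    have TT: "(T \<omega>)\<^sup>2 = (\<Sum>k\<in>UNIV. \<Sum>l\<in>UNIV. g k \<omega> * g l \<omega> * (d k \<omega> * d l \<omega>))" for \<omega>
      unfolding T power2_eq_square sum_product by (simp add: mult_ac)
    have iT: "integrable M T" unfolding T using increment_first(1)[OF ab gF ig] by (auto simp: d_def)
    have eT: "(\<integral>\<omega>. T \<omega> \<partial>M) = 0" unfolding T
      using increment_first[OF ab gF ig] by (subst Bochner_Integration.integral_sum) (auto simp: d_def)
    have iST: "integrable M (\<lambda>\<omega>. S n \<omega> * T \<omega>)" unfolding ST using increment_first(1)[OF ab SgF iSg] by (auto simp: d_def)
    have eST: "(\<integral>\<omega>. S n \<omega> * T \<omega> \<partial>M) = 0" unfolding ST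
      using increment_first[OF ab SgF iSg] by (subst Bochner_Integration.integral_sum) (auto simp: d_def)
    have iTT: "integrable M (\<lambda>\<omega>. (T \<omega>)\<^sup>2)" unfolding TT using increment_second(1)[OF ab ggF igg] by (auto simp: d_def)
    have "(\<integral>\<omega>. (T \<omega>)\<^sup>2 \<partial>M) = (\<Sum>k\<in>UNIV. \<Sum>l\<in>UNIV. \<integral>\<omega>. g k \<omega> * g l \<omega> * (d k \<omega> * d l \<omega>) \<partial>M)"
      unfolding TT using increment_second(1)[OF ab ggF igg]
      by (subst Bochner_Integration.integral_sum, force simp: d_def, subst Bochner_Integration.integral_sum)
         (auto simp: d_def)
    also have "\<dots> = (\<Sum>k\<in>UNIV. \<Sum>l\<in>UNIV. (\<integral>\<omega>. g k \<omega> * g l \<omega> \<partial>M) * (if k = l then b - a else 0))"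
      unfolding d_def increment_second(2)[OF ab ggF igg] ..
    also have "\<dots> = (\<Sum>k\<in>UNIV. \<Sum>l\<in>UNIV. if k = l then (\<integral>\<omega>. g k \<omega> * g k \<omega> \<partial>M) * (b - a) else 0)"
      by (intro sum.cong refl) auto
    also have "\<dots> = (b - a) * (\<integral>\<omega>. (\<Sum>k\<in>UNIV. g k \<omega> * g k \<omega>) \<partial>M)"
      using igg by (subst Bochner_Integration.integral_sum) (auto simp: sum_distrib_left mult.commute)
    also have "(\<lambda>\<omega>. (\<Sum>k\<in>UNIV. g k \<omega> * g k \<omega>)) = (\<lambda>\<omega>. (norm (G n \<omega>))\<^sup>2)"
      unfolding g_def power2_norm_eq_inner inner_vec_def by simp
    finally have eTT: "(\<integral>\<omega>. (T \<omega>)\<^sup>2 \<partial>M) = (b - a) * (\<integral>\<omega>. (norm (G n \<omega>))\<^sup>2 \<partial>M)" .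
    have sq: "(S (Suc n) \<omega>)\<^sup>2 = (S n \<omega>)\<^sup>2 + 2 * (S n \<omega> * T \<omega>) + (T \<omega>)\<^sup>2" for \<omega>
      unfolding S' by (simp add: power2_eq_square algebra_simps)
    have FF: "subalgebra (F b) (F a)" using F_mono[OF ab(2)] by (auto simp: subalgebra_def)
    have Wm: "W b \<in> borel_measurable (F b)" "W a \<in> borel_measurable (F b)" using W_F ab by auto
    have Gm: "G n \<in> borel_measurable (F b)"
      using Suc.prems(1)[of n] measurable_from_subalg[OF FF] unfolding a_def by blast
    have "S (Suc n) \<in> borel_measurable (F b)"
      unfolding S' T_def using measurable_from_subalg[OF FF IH(1)] Wm Gm by measurable
    moreover have "integrable M (S (Suc n))" unfolding S' using IH(2) iT by auto
    moreover have "(\<integral>\<omega>. S (Suc n) \<omega> \<partial>M) = 0" unfolding S' using IH iT eT by simp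
    moreover have "integrable M (\<lambda>\<omega>. (S (Suc n) \<omega>)\<^sup>2)" unfolding sq using IH iST iTT by auto
    moreover have "(\<integral>\<omega>. (S (Suc n) \<omega>)\<^sup>2 \<partial>M) = (\<integral>\<omega>. (S n \<omega>)\<^sup>2 \<partial>M) + (b - a) * (\<integral>\<omega>. (norm (G n \<omega>))\<^sup>2 \<partial>M)"
      unfolding sq using IH iST iTT eST eTT by simp
    ultimately show ?case using IH(5) unfolding a_def b_def by simp
  qed
  then show "S n \<in> borel_measurable (F (tt n))" "integrable M (S n)" "(\<integral>\<omega>. S n \<omega> \<partial>M) = 0"
    "integrable M (\<lambda>\<omega>. (S n \<omega>)\<^sup>2)"
    "(\<integral>\<omega>. (S n \<omega>)\<^sup>2 \<partial>M) = (\<Sum>i<n. (tt (Suc i) - tt i) * (\<integral>\<omega>. (norm (G i \<omega>))\<^sup>2 \<partial>M))"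
    by auto
qed

end

section \<open>Measure-theoretic tools\<close>

text \<open>The supremum of the integrals of simple functions below f is reached along a sequence,
  and the pointwise supremum g of that sequence has the full lower integral. A measurable u below f
  exceeding g on a non-null set would make the maximum of g and u a measurable minorant with a
  larger integral.\<close>

lemma nn_integral_lower_envelope:
  fixes f :: "'a \<Rightarrow> ennreal"
  assumes fin: "(\<integral>\<^sup>+x. f x \<partial>M) < \<infinity>"
  shows "\<exists>g\<in>borel_measurable M. (\<integral>\<^sup>+x. g x \<partial>M) < \<infinity> \<and>
    (\<forall>u\<in>borel_measurable M. (\<forall>x\<in>space M. u x \<le> f x) \<longrightarrow> (AE x in M. u x \<le> g x))"
proof -
  let ?S = "{g. simple_function M g \<and> g \<le> f}"
  have "integral\<^sup>S M ` ?S \<noteq> {}" by (auto intro!: exI[of _ "\<lambda>_. 0"] simp: le_fun_def)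
  from ennreal_Sup_countable_SUP[OF this]
  obtain c :: "nat \<Rightarrow> ennreal" where c: "range c \<subseteq> integral\<^sup>S M ` ?S" "Sup (integral\<^sup>S M ` ?S) = (SUP i. c i)"
    by auto
  have "\<forall>i. \<exists>g. g \<in> ?S \<and> c i = integral\<^sup>S M g" using c(1) by blast
  then obtain gs where gs: "\<And>i. gs i \<in> ?S" "\<And>i. c i = integral\<^sup>S M (gs i)" by metis
  define g where "g = (\<lambda>x. SUP i. gs i x)"
  have gm[measurable]: "g \<in> borel_measurable M"
    unfolding g_def using gs(1) by (intro borel_measurable_SUP) (auto intro: borel_measurable_simple_function)
  have gf: "g x \<le> f x" for x unfolding g_def using gs(1) by (auto intro!: SUP_least simp: le_fun_def)
  have le: "(\<integral>\<^sup>+x. g x \<partial>M) \<le> (\<integral>\<^sup>+x. f x \<partial>M)" by (rule nn_integral_mono) (rule gf)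
  have ge: "(\<integral>\<^sup>+x. f x \<partial>M) \<le> (\<integral>\<^sup>+x. g x \<partial>M)"
  proof -
    have "(\<integral>\<^sup>+x. f x \<partial>M) = (SUP i. c i)" unfolding nn_integral_def c(2) ..
    also have "\<dots> \<le> (\<integral>\<^sup>+x. g x \<partial>M)"
    proof (rule SUP_least)
      fix i
      have "c i = (\<integral>\<^sup>+x. gs i x \<partial>M)" using gs by (simp add: nn_integral_eq_simple_integral)
      also have "\<dots> \<le> (\<integral>\<^sup>+x. g x \<partial>M)" unfolding g_def by (intro nn_integral_mono SUP_upper) auto
      finally show "c i \<le> (\<integral>\<^sup>+x. g x \<partial>M)" .
    qed
    finally show ?thesis .
  qed
  have AE: "AE x in M. u x \<le> g x" if u[measurable]: "u \<in> borel_measurable M" and uf: "\<And>x. x \<in> space M \<Longrightarrow> u x \<le> f x" for u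
  proof -
    have "(\<integral>\<^sup>+x. max (g x) (u x) \<partial>M) \<le> (\<integral>\<^sup>+x. f x \<partial>M)"
      by (rule nn_integral_mono) (use gf uf in auto)
    with le ge have 1: "(\<integral>\<^sup>+x. max (g x) (u x) \<partial>M) \<le> (\<integral>\<^sup>+x. g x \<partial>M)" by auto
    have "(\<integral>\<^sup>+x. max (g x) (u x) - g x \<partial>M) = (\<integral>\<^sup>+x. max (g x) (u x) \<partial>M) - (\<integral>\<^sup>+x. g x \<partial>M)"
      by (rule nn_integral_diff) (use le fin in auto)
    also have "\<dots> = 0" using 1 le fin by (simp add: diff_eq_0_iff_ennreal top.not_eq_extremum)
    finally have "AE x in M. max (g x) (u x) - g x = 0" by (subst (asm) nn_integral_0_iff_AE) auto
    moreover have "AE x in M. g x \<noteq> \<infinity>" by (rule nn_integral_PInf_AE) (use le fin in auto)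
    ultimately show ?thesis
    proof eventually_elim
      case (elim x)
      then have "max (g x) (u x) \<le> g x" using diff_eq_0_iff_ennreal by (auto simp: top.not_eq_extremum)
      then show ?case by simp
    qed
  qed
  show ?thesis
  proof (intro bexI[of _ g] conjI ballI impI)
    show "(\<integral>\<^sup>+x. g x \<partial>M) < \<infinity>" using le fin by (rule order_le_less_trans)
  qed (use AE gm in auto)
qed

text \<open>A Caratheodory argument: X is rounded to countably many values, for which the
  composition is measurable, and the Lipschitz bound passes to the limit.\<close>

lemma measurable_lipschitz_compose:
  fixes \<phi> :: "'a \<Rightarrow> real \<Rightarrow> real"
  assumes lip: "\<And>x y y'. x \<in> space N \<Longrightarrow> \<bar>\<phi> x y - \<phi> x y'\<bar> \<le> L * \<bar>y - y'\<bar>"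
    and m: "\<And>y. (\<lambda>x. \<phi> x y) \<in> borel_measurable N" and X: "X \<in> borel_measurable N"
  shows "(\<lambda>x. \<phi> x (X x)) \<in> borel_measurable N"
proof (rule borel_measurable_LIMSEQ_real)
  define q where "q = (\<lambda>k x. real_of_int \<lfloor>X x * real (Suc k)\<rfloor> / real (Suc k))"
  show "(\<lambda>x. \<phi> x (q k x)) \<in> borel_measurable N" for k
  proof -
    have "(\<lambda>x. \<lfloor>X x * real (Suc k)\<rfloor>) \<in> measurable N (count_space UNIV)" using X by measurable
    from measurable_compose_countable[OF m this, of "\<lambda>i. real_of_int i / real (Suc k)"]
    show ?thesis unfolding q_def .
  qed
  fix x assume x: "x \<in> space N"
  have q: "\<bar>q k x - X x\<bar> \<le> inverse (real (Suc k))" for k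
  proof -
    have "\<bar>real_of_int \<lfloor>X x * real (Suc k)\<rfloor> - X x * real (Suc k)\<bar> \<le> 1" by linarith
    then have "\<bar>real_of_int \<lfloor>X x * real (Suc k)\<rfloor> - X x * real (Suc k)\<bar> / real (Suc k) \<le> 1 / real (Suc k)"
      by (rule divide_right_mono) simp
    moreover have "q k x - X x = (real_of_int \<lfloor>X x * real (Suc k)\<rfloor> - X x * real (Suc k)) / real (Suc k)"
      unfolding q_def by (simp add: field_simps)
    ultimately show ?thesis by (simp add: inverse_eq_divide)
  qed
  have "(\<lambda>k. q k x - X x) \<longlonglongrightarrow> 0"
    by (rule Lim_null_comparison[OF _ LIMSEQ_inverse_real_of_nat]) (use q in auto)
  then have "(\<lambda>k. L * \<bar>q k x - X x\<bar>) \<longlonglongrightarrow> 0"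
    by (intro tendsto_mult_right_zero tendsto_rabs_zero)
  then have "(\<lambda>k. \<phi> x (q k x) - \<phi> x (X x)) \<longlonglongrightarrow> 0"
    by (rule Lim_null_comparison[rotated]) (use lip[OF x] in simp_all)
  then show "(\<lambda>k. \<phi> x (q k x)) \<longlonglongrightarrow> \<phi> x (X x)" by (simp add: LIM_zero_iff)
qed

text \<open>Cauchy-Schwarz with the indicator as one factor. If the integrand is not integrable, its
  Bochner integral is 0 by convention and the bound is trivial.\<close>

lemma sq_integral_le_nn_integral:
  fixes k :: "'a \<Rightarrow> real"
  assumes k: "k \<in> borel_measurable M" and A: "A \<in> sets M"
  shows "ennreal ((\<integral>x. indicator A x * k x \<partial>M)\<^sup>2) \<le> emeasure M A * (\<integral>\<^sup>+x\<in>A. ennreal ((k x)\<^sup>2) \<partial>M)"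
proof (cases "integrable M (\<lambda>x. indicator A x * k x)")
  case True
  note k[measurable] A[measurable]
  let ?I = "\<integral>x. indicator A x * k x \<partial>M"
  have "\<bar>?I\<bar> \<le> (\<integral>x. \<bar>indicator A x * k x\<bar> \<partial>M)" by (rule integral_abs_bound)
  then have "ennreal \<bar>?I\<bar> \<le> ennreal (\<integral>x. \<bar>indicator A x * k x\<bar> \<partial>M)" by (rule ennreal_leI)
  also have "\<dots> = (\<integral>\<^sup>+x. ennreal \<bar>indicator A x * k x\<bar> \<partial>M)"
    by (rule nn_integral_eq_integral[symmetric]) (use True in auto)
  also have "\<dots> = (\<integral>\<^sup>+x. indicator A x * (ennreal \<bar>k x\<bar> * indicator A x) \<partial>M)"
    by (rule nn_integral_cong) (auto split: split_indicator)
  finally have 1: "ennreal \<bar>?I\<bar> \<le> (\<integral>\<^sup>+x. indicator A x * (ennreal \<bar>k x\<bar> * indicator A x) \<partial>M)" .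
  have "ennreal (?I\<^sup>2) = (ennreal \<bar>?I\<bar>)\<^sup>2" by (simp add: ennreal_power)
  also have "\<dots> \<le> (\<integral>\<^sup>+x. indicator A x * (ennreal \<bar>k x\<bar> * indicator A x) \<partial>M)\<^sup>2"
    by (rule power_mono[OF 1]) auto
  also have "\<dots> \<le> (\<integral>\<^sup>+x. (indicator A x)\<^sup>2 \<partial>M) * (\<integral>\<^sup>+x. (ennreal \<bar>k x\<bar> * indicator A x)\<^sup>2 \<partial>M)"
    by (rule Cauchy_Schwarz_nn_integral) measurable
  also have "(\<integral>\<^sup>+x. (indicator A x)\<^sup>2 \<partial>M) = (\<integral>\<^sup>+x. indicator A x \<partial>M)"
    by (rule nn_integral_cong) (auto split: split_indicator)
  also have "(\<integral>\<^sup>+x. (ennreal \<bar>k x\<bar> * indicator A x)\<^sup>2 \<partial>M) = (\<integral>\<^sup>+x\<in>A. ennreal ((k x)\<^sup>2) \<partial>M)"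
    by (rule nn_integral_cong) (auto split: split_indicator simp: ennreal_power)
  finally show ?thesis by simp
qed (simp add: not_integrable_integral_eq)

text \<open>Transfers an isometry to the limit: \<^term>\<open>u n\<close> is the common value of both sides for the
  \<^term>\<open>n\<close>-th approximation, and the hypotheses are Young's inequality for its distance to the limit.\<close>

lemma ennreal_limit_le:
  fixes a b :: ennreal and u r :: "nat \<Rightarrow> ennreal" and c :: "real \<Rightarrow> ennreal"
  assumes 1: "\<And>\<delta> n. \<delta> > 0 \<Longrightarrow> a \<le> ennreal (1 + \<delta>) * u n + c \<delta> * r n"
    and 2: "\<And>\<delta> n. \<delta> > 0 \<Longrightarrow> u n \<le> ennreal (1 + \<delta>) * b + c \<delta> * r n"
    and r: "r \<longlonglongrightarrow> 0" and c: "\<And>\<delta>. \<delta> > 0 \<Longrightarrow> c \<delta> < \<infinity>"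
  shows "a \<le> b"
proof (cases "b = \<infinity>")
  case False
  have *: "a \<le> ennreal ((1 + \<delta>)\<^sup>2) * b" if \<delta>: "\<delta> > 0" for \<delta>
  proof (rule LIMSEQ_le_const)
    define C where "C = ennreal (1 + \<delta>) * c \<delta> + c \<delta>"
    have C: "C < \<infinity>" unfolding C_def using c[OF \<delta>] by (simp add: ennreal_mult_less_top)
    have "(\<lambda>n. C * r n) \<longlonglongrightarrow> C * 0" by (rule ennreal_tendsto_cmult[OF _ r]) (use C in auto)
    then have "(\<lambda>n. ennreal ((1 + \<delta>)\<^sup>2) * b + C * r n) \<longlonglongrightarrow> ennreal ((1 + \<delta>)\<^sup>2) * b + C * 0"
      by (intro tendsto_add tendsto_const)
    then show "(\<lambda>n. ennreal ((1 + \<delta>)\<^sup>2) * b + C * r n) \<longlonglongrightarrow> ennreal ((1 + \<delta>)\<^sup>2) * b" by simp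
    have "a \<le> ennreal ((1 + \<delta>)\<^sup>2) * b + C * r n" for n
    proof -
      have "a \<le> ennreal (1 + \<delta>) * u n + c \<delta> * r n" by (rule 1[OF \<delta>])
      also have "\<dots> \<le> ennreal (1 + \<delta>) * (ennreal (1 + \<delta>) * b + c \<delta> * r n) + c \<delta> * r n"
        by (intro add_mono mult_left_mono 2[OF \<delta>]) auto
      also have "\<dots> = (ennreal (1 + \<delta>) * ennreal (1 + \<delta>)) * b + C * r n"
        unfolding C_def by (simp add: algebra_simps)
      also have "ennreal (1 + \<delta>) * ennreal (1 + \<delta>) = ennreal ((1 + \<delta>)\<^sup>2)"
        using \<delta> by (simp add: ennreal_mult[symmetric] power2_eq_square del: ennreal_plus)
      finally show ?thesis .
    qed
    then show "\<exists>N. \<forall>n\<ge>N. a \<le> ennreal ((1 + \<delta>)\<^sup>2) * b + C * r n" by blast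
  qed
  have "(\<lambda>n. ennreal ((1 + inverse (real (Suc n)))\<^sup>2)) \<longlonglongrightarrow> ennreal ((1 + 0)\<^sup>2)"
    by (intro tendsto_ennrealI tendsto_intros LIMSEQ_inverse_real_of_nat)
  then have "(\<lambda>n. b * ennreal ((1 + inverse (real (Suc n)))\<^sup>2)) \<longlonglongrightarrow> b * ennreal ((1 + 0)\<^sup>2)"
    using False by (intro ennreal_tendsto_cmult) (auto simp: less_top)
  then have "(\<lambda>n. ennreal ((1 + inverse (real (Suc n)))\<^sup>2) * b) \<longlonglongrightarrow> b"
    by (simp add: mult.commute)
  then show ?thesis by (rule LIMSEQ_le_const) (use * in \<open>auto intro!: exI[of _ 0]\<close>)
qed simp

text \<open>Young's inequality, read off from the square of
  \<open>sqrt \<delta> *\<^sub>R x - (1 / sqrt \<delta>) *\<^sub>R y\<close>.\<close>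

lemma norm_sq_add_le:
  fixes x y :: "'b::real_inner"
  assumes "\<delta> > 0"
  shows "(norm (x + y))\<^sup>2 \<le> (1 + \<delta>) * (norm x)\<^sup>2 + (1 + 1 / \<delta>) * (norm y)\<^sup>2"
proof -
  have "0 \<le> (norm (sqrt \<delta> *\<^sub>R x - (1 / sqrt \<delta>) *\<^sub>R y))\<^sup>2" by simp
  also have "\<dots> = \<delta> * (norm x)\<^sup>2 - 2 * (x \<bullet> y) + (1 / \<delta>) * (norm y)\<^sup>2"
    using assms unfolding power2_norm_eq_inner
    by (simp add: inner_diff inner_commute algebra_simps divide_simps)
  finally show ?thesis
    unfolding power2_norm_eq_inner by (simp add: inner_add inner_commute algebra_simps)
qed

text \<open>Monotonicity makes the half-open intervals disjoint, so at most one summand is non-zero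
  at each s.\<close>

lemma norm_sq_step:
  fixes v :: "nat \<Rightarrow> 'b::real_inner"
  assumes "mono (tt :: nat \<Rightarrow> real)"
  shows "(norm (\<Sum>i<n. indicator {tt i<..tt (Suc i)} s *\<^sub>R v i))\<^sup>2
    = (\<Sum>i<n. indicator {tt i<..tt (Suc i)} s * (norm (v i))\<^sup>2)"
proof (induction n)
  case (Suc n)
  show ?case
  proof (cases "s \<in> {tt n<..tt (Suc n)}")
    case True
    have "indicator {tt i<..tt (Suc i)} s = (0::real)" if "i < n" for i
      using True monoD[OF assms, of "Suc i" n] that by (auto simp: indicator_def)
    then show ?thesis using True by simp
  next
    case False
    then show ?thesis using Suc by simp
  qed
qed simp

text \<open>The set B will be \<open>{0..t}\<close> or \<open>{t<..}\<close>: the energy of a simple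
  integrand on either side of a cut at t.\<close>

lemma nn_integral_step_sq:
  fixes v :: "nat \<Rightarrow> 'b::real_inner"
  assumes "mono (tt :: nat \<Rightarrow> real)" and B: "B \<in> sets borel"
  shows "(\<integral>\<^sup>+s\<in>B. ennreal ((norm (\<Sum>i<n. indicator {tt i<..tt (Suc i)} s *\<^sub>R v i))\<^sup>2) \<partial>lborel)
    = (\<Sum>i<n. emeasure lborel ({tt i<..tt (Suc i)} \<inter> B) * ennreal ((norm (v i))\<^sup>2))"
proof -
  have "(\<integral>\<^sup>+s\<in>B. ennreal ((norm (\<Sum>i<n. indicator {tt i<..tt (Suc i)} s *\<^sub>R v i))\<^sup>2) \<partial>lborel)
    = (\<integral>\<^sup>+s. (\<Sum>i<n. ennreal ((norm (v i))\<^sup>2) * indicator ({tt i<..tt (Suc i)} \<inter> B) s) \<partial>lborel)"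
    unfolding norm_sq_step[OF assms(1)]
  proof (rule nn_integral_cong)
    fix s
    have "ennreal (\<Sum>i<n. indicator {tt i<..tt (Suc i)} s * (norm (v i))\<^sup>2)
      = (\<Sum>i<n. ennreal (indicator {tt i<..tt (Suc i)} s * (norm (v i))\<^sup>2))"
      by (rule sum_ennreal[symmetric]) simp
    then show "ennreal (\<Sum>i<n. indicator {tt i<..tt (Suc i)} s * (norm (v i))\<^sup>2) * indicator B s
      = (\<Sum>i<n. ennreal ((norm (v i))\<^sup>2) * indicator ({tt i<..tt (Suc i)} \<inter> B) s)"
      by (simp only: sum_distrib_right) (intro sum.cong refl, auto split: split_indicator)
  qed
  also have "\<dots> = (\<Sum>i<n. \<integral>\<^sup>+s. ennreal ((norm (v i))\<^sup>2) * indicator ({tt i<..tt (Suc i)} \<inter> B) s \<partial>lborel)"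
    using B by (intro nn_integral_sum) auto
  also have "\<dots> = (\<Sum>i<n. emeasure lborel ({tt i<..tt (Suc i)} \<inter> B) * ennreal ((norm (v i))\<^sup>2))"
    using B by (intro sum.cong refl, subst nn_integral_cmult_indicator) (auto simp: mult.commute)
  finally show ?thesis .
qed

section \<open>The Ito isometry\<close>

lemma ennreal_lincomb:
  assumes "0 \<le> a" "0 \<le> b" "0 \<le> x" "0 \<le> y"
  shows "ennreal (a * x + b * y) = ennreal a * ennreal x + ennreal b * ennreal y"
  using assms by (simp add: ennreal_mult)

context brownian
begin

lemma integrable_indicator_mult:
  fixes X :: "'a \<Rightarrow> real"
  shows "A \<in> sets M \<Longrightarrow> integrable M X \<Longrightarrow> integrable M (\<lambda>\<omega>. indicator A \<omega> * X \<omega>)"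
  using integrable_mult_indicator[of A M X] by simp

lemma sets_F_M: "A \<in> sets (F t) \<Longrightarrow> A \<in> sets M"
  using sets_F_subset by blast

lemma meas_F_M: "f \<in> borel_measurable (F t) \<Longrightarrow> f \<in> borel_measurable M"
  by (rule measurable_from_subalg[OF subalg])

lemma meas_F_mono: "f \<in> borel_measurable (F s) \<Longrightarrow> s \<le> t \<Longrightarrow> f \<in> borel_measurable (F t)"
  by (rule measurable_from_subalg[of _ "F s"]) (use F_mono[of s t] in \<open>auto simp: subalgebra_def\<close>)

abbreviation sqn :: "'a set \<Rightarrow> ('a \<Rightarrow> real) \<Rightarrow> ennreal" where
  "sqn A X \<equiv> \<integral>\<^sup>+\<omega>\<in>A. ennreal ((X \<omega>)\<^sup>2) \<partial>M"

text \<open>The isometry in terms of nonnegative integrals, because it will be compared with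
  energies that may a priori be infinite.\<close>

lemma simple_sum_nn_isometry:
  fixes G :: "nat \<Rightarrow> 'a \<Rightarrow> real^'d" and tt :: "nat \<Rightarrow> real"
  assumes tt: "mono tt" "0 \<le> tt 0"
    and G: "\<And>i. i < n \<Longrightarrow> G i \<in> borel_measurable (F (tt i))" "\<And>i. i < n \<Longrightarrow> \<exists>B. \<forall>\<omega>. norm (G i \<omega>) \<le> B"
  shows "(\<integral>\<^sup>+\<omega>. ennreal ((\<Sum>i<n. G i \<omega> \<bullet> (W (tt (Suc i)) \<omega> - W (tt i) \<omega>))\<^sup>2) \<partial>M)
    = (\<integral>\<^sup>+\<omega>. (\<Sum>i<n. ennreal (tt (Suc i) - tt i) * ennreal ((norm (G i \<omega>))\<^sup>2)) \<partial>M)"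
proof -
  have d: "0 \<le> tt (Suc i) - tt i" for i using monoD[OF tt(1), of i "Suc i"] by simp
  have Gm: "G i \<in> borel_measurable M" if "i < n" for i using meas_F_M[OF G(1)[OF that]] .
  have iG: "integrable M (\<lambda>\<omega>. (norm (G i \<omega>))\<^sup>2)" if i: "i < n" for i
  proof -
    obtain B where B: "\<And>\<omega>. norm (G i \<omega>) \<le> B" using G(2)[OF i] by auto
    show ?thesis
      by (rule integrable_const_bound[of _ "B\<^sup>2"]) (use B Gm[OF i] in \<open>auto intro!: power_mono\<close>)
  qed
  have "(\<integral>\<^sup>+\<omega>. ennreal ((\<Sum>i<n. G i \<omega> \<bullet> (W (tt (Suc i)) \<omega> - W (tt i) \<omega>))\<^sup>2) \<partial>M)
    = ennreal (\<integral>\<omega>. (\<Sum>i<n. G i \<omega> \<bullet> (W (tt (Suc i)) \<omega> - W (tt i) \<omega>))\<^sup>2 \<partial>M)"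
    by (rule nn_integral_eq_integral) (use simple_sum_moments(4)[OF tt G] in auto)
  also have "\<dots> = ennreal (\<Sum>i<n. (tt (Suc i) - tt i) * (\<integral>\<omega>. (norm (G i \<omega>))\<^sup>2 \<partial>M))"
    by (subst simple_sum_moments(5)[OF tt G]) auto
  also have "\<dots> = (\<Sum>i<n. ennreal (tt (Suc i) - tt i) * ennreal (\<integral>\<omega>. (norm (G i \<omega>))\<^sup>2 \<partial>M))"
    using d by (subst sum_ennreal[symmetric]) (auto simp: ennreal_mult' intro!: mult_nonneg_nonneg)
  also have "\<dots> = (\<Sum>i<n. ennreal (tt (Suc i) - tt i) * (\<integral>\<^sup>+\<omega>. ennreal ((norm (G i \<omega>))\<^sup>2) \<partial>M))"
    using iG by (intro sum.cong refl) (subst nn_integral_eq_integral, auto)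
  also have "\<dots> = (\<Sum>i<n. (\<integral>\<^sup>+\<omega>. ennreal (tt (Suc i) - tt i) * ennreal ((norm (G i \<omega>))\<^sup>2) \<partial>M))"
    using Gm by (intro sum.cong refl nn_integral_cmult[symmetric]) auto
  also have "\<dots> = (\<integral>\<^sup>+\<omega>. (\<Sum>i<n. ennreal (tt (Suc i) - tt i) * ennreal ((norm (G i \<omega>))\<^sup>2)) \<partial>M)"
    using Gm by (intro nn_integral_sum[symmetric]) auto
  finally show ?thesis .
qed

text \<open>A simple integrand is cut at time \<^term>\<open>t\<close>. For approximations of an integrand vanishing up to
  \<^term>\<open>t\<close> the first part is negligible, while the second part is conditionally centred given \<^term>\<open>F t\<close>.\<close>

lemma simple_integral_split:
  assumes S: "simple_integral F W H I" and t: "0 \<le> t"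
  obtains I1 I2 where "\<And>\<omega>. I \<omega> = I1 \<omega> + I2 \<omega>" "I1 \<in> borel_measurable M" "I2 \<in> borel_measurable M"
    "(\<lambda>(\<omega>, s). H s \<omega>) \<in> borel_measurable (M \<Otimes>\<^sub>M lborel)"
    "(\<integral>\<^sup>+\<omega>. ennreal ((I1 \<omega>)\<^sup>2) \<partial>M) = (\<integral>\<^sup>+\<omega>. (\<integral>\<^sup>+s\<in>{0..t}. ennreal ((norm (H s \<omega>))\<^sup>2) \<partial>lborel) \<partial>M)"
    "integrable M I2" "integrable M (\<lambda>\<omega>. (I2 \<omega>)\<^sup>2)"
    "\<And>A. A \<in> sets (F t) \<Longrightarrow> (\<integral>\<omega>. indicator A \<omega> * I2 \<omega> \<partial>M) = 0"
    "\<And>A. A \<in> sets (F t) \<Longrightarrow> (sqn A I2)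
      = (\<integral>\<^sup>+\<omega>\<in>A. (\<integral>\<^sup>+s\<in>{t<..}. ennreal ((norm (H s \<omega>))\<^sup>2) \<partial>lborel) \<partial>M)"
proof -
  obtain n tt Hs where tt: "0 \<le> tt 0" "mono tt"
    and Hs: "\<And>i. i < n \<Longrightarrow> Hs i \<in> borel_measurable (F (tt i))" "\<And>i. i < n \<Longrightarrow> \<exists>B. \<forall>\<omega>. norm (Hs i \<omega>) \<le> B"
    and H: "\<And>s \<omega>. H s \<omega> = (\<Sum>i<n. indicator {tt i<..tt (Suc i)} s *\<^sub>R Hs i \<omega>)"
    and I: "\<And>\<omega>. I \<omega> = (\<Sum>i<n. Hs i \<omega> \<bullet> (W (tt (Suc i)) \<omega> - W (tt i) \<omega>))"
    using S unfolding simple_integral_def by blast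
  have tt_nn: "0 \<le> tt i" for i using tt monoD[OF tt(2), of 0 i] by simp
  have tt_le: "tt i \<le> tt (Suc i)" for i using monoD[OF tt(2), of i "Suc i"] by simp
  have HsM: "Hs i \<in> borel_measurable M" if "i < n" for i by (rule meas_F_M[OF Hs(1)[OF that]])
  define u where "u = (\<lambda>i. min (tt i) t)"
  define v where "v = (\<lambda>i. max (tt i) t)"
  have u: "mono u" "0 \<le> u 0" using tt t unfolding u_def by (auto intro!: monoI min.mono dest: monoD)
  have v: "mono v" "0 \<le> v 0" using tt t unfolding v_def by (auto intro!: monoI max.mono dest: monoD)
  \<comment> \<open>For tt i > t the truncated interval is degenerate at t, while Hs i need not be F
    t-measurable. Replacing it by 0 keeps G1 adapted and does not change the sum.\<close>
  define G1 where "G1 = (\<lambda>i \<omega>. if tt i \<le> t then Hs i \<omega> else 0)"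
  define I1 where "I1 = (\<lambda>\<omega>. \<Sum>i<n. G1 i \<omega> \<bullet> (W (u (Suc i)) \<omega> - W (u i) \<omega>))"
  define I2 where "I2 = (\<lambda>\<omega>. \<Sum>i<n. Hs i \<omega> \<bullet> (W (v (Suc i)) \<omega> - W (v i) \<omega>))"
  have G1m: "G1 i \<in> borel_measurable (F (u i))" if "i < n" for i
    using Hs(1)[OF that] unfolding G1_def u_def by (cases "tt i \<le> t") (auto simp: min_absorb1)
  have G1b: "\<exists>B. \<forall>\<omega>. norm (G1 i \<omega>) \<le> B" if "i < n" for i
    using Hs(2)[OF that] unfolding G1_def by (cases "tt i \<le> t") auto
  \<comment> \<open>Moving a left endpoint to the later time v i keeps Hs i adapted.\<close>
  have G2m: "Hs i \<in> borel_measurable (F (v i))" if "i < n" for i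
    using meas_F_mono[OF Hs(1)[OF that], of "v i"] unfolding v_def by auto
  have split: "I \<omega> = I1 \<omega> + I2 \<omega>" for \<omega>
    unfolding I I1_def I2_def sum.distrib[symmetric]
  proof (rule sum.cong)
    fix i assume "i \<in> {..<n}"
    show "Hs i \<omega> \<bullet> (W (tt (Suc i)) \<omega> - W (tt i) \<omega>)
      = G1 i \<omega> \<bullet> (W (u (Suc i)) \<omega> - W (u i) \<omega>) + Hs i \<omega> \<bullet> (W (v (Suc i)) \<omega> - W (v i) \<omega>)"
      using tt_le[of i] unfolding G1_def u_def v_def
      by (cases "tt i \<le> t"; cases "tt (Suc i) \<le> t")
         (auto simp: min_def max_def inner_diff_right[symmetric] inner_add_right[symmetric] simp del: inner_diff_right)
  qed simp
  have m1: "I1 \<in> borel_measurable M"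
    unfolding I1_def by (rule meas_F_M[OF simple_sum_moments(1)[OF u G1m G1b]])
  have m2: "I2 \<in> borel_measurable M" "integrable M I2" "integrable M (\<lambda>\<omega>. (I2 \<omega>)\<^sup>2)"
    unfolding I2_def using meas_F_M[OF simple_sum_moments(1)[OF v G2m Hs(2)]]
      simple_sum_moments(2,4)[OF v G2m Hs(2)] by auto
  have Hm: "(\<lambda>(\<omega>, s). H s \<omega>) \<in> borel_measurable (M \<Otimes>\<^sub>M lborel)"
    unfolding H split_beta' using HsM
    by (intro borel_measurable_sum borel_measurable_scaleR measurable_compose[OF measurable_fst] measurable_compose[OF measurable_snd])
       auto
  have "(\<integral>\<^sup>+\<omega>. ennreal ((I1 \<omega>)\<^sup>2) \<partial>M) = (\<integral>\<^sup>+\<omega>. (\<Sum>i<n. ennreal (u (Suc i) - u i) * ennreal ((norm (G1 i \<omega>))\<^sup>2)) \<partial>M)"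
    unfolding I1_def by (rule simple_sum_nn_isometry[OF u G1m G1b])
  also have "\<dots> = (\<integral>\<^sup>+\<omega>. (\<integral>\<^sup>+s\<in>{0..t}. ennreal ((norm (H s \<omega>))\<^sup>2) \<partial>lborel) \<partial>M)"
    unfolding H nn_integral_step_sq[OF tt(2) borel_closed[OF closed_atLeastAtMost]]
  proof (intro nn_integral_cong sum.cong refl)
    fix i \<omega>
    have "{tt i<..tt (Suc i)} \<inter> {0..t} = {u i<..u (Suc i)}"
      using tt_nn[of i] unfolding u_def by auto
    moreover have "u i \<le> u (Suc i)" using monoD[OF u(1), of i "Suc i"] by simp
    ultimately have "emeasure lborel ({tt i<..tt (Suc i)} \<inter> {0..t}) = ennreal (u (Suc i) - u i)" by simp
    moreover have "t < tt i \<Longrightarrow> u (Suc i) - u i = 0" using tt_le[of i] unfolding u_def by simp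
    ultimately show "ennreal (u (Suc i) - u i) * ennreal ((norm (G1 i \<omega>))\<^sup>2)
      = emeasure lborel ({tt i<..tt (Suc i)} \<inter> {0..t}) * ennreal ((norm (Hs i \<omega>))\<^sup>2)"
      unfolding G1_def by auto
  qed
  finally have e1: "(\<integral>\<^sup>+\<omega>. ennreal ((I1 \<omega>)\<^sup>2) \<partial>M) = (\<integral>\<^sup>+\<omega>. (\<integral>\<^sup>+s\<in>{0..t}. ennreal ((norm (H s \<omega>))\<^sup>2) \<partial>lborel) \<partial>M)" .
  have A2: "(\<integral>\<omega>. indicator A \<omega> * I2 \<omega> \<partial>M) = 0 \<and> (sqn A I2)
      = (\<integral>\<^sup>+\<omega>\<in>A. (\<integral>\<^sup>+s\<in>{t<..}. ennreal ((norm (H s \<omega>))\<^sup>2) \<partial>lborel) \<partial>M)" if A: "A \<in> sets (F t)" for A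
  proof -
    \<comment> \<open>A belongs to F t and hence to every F (v i), so its indicator can be absorbed
      into the adapted coefficients.\<close>
    define G2 where "G2 = (\<lambda>i \<omega>. indicator A \<omega> *\<^sub>R Hs i \<omega>)"
    have AF: "A \<in> sets (F (v i))" for i using A F_mono[of t "v i"] unfolding v_def by auto
    have G2m': "G2 i \<in> borel_measurable (F (v i))" if "i < n" for i
      unfolding G2_def using G2m[OF that] AF[of i] by measurable
    have G2b': "\<exists>B. \<forall>\<omega>. norm (G2 i \<omega>) \<le> B" if i: "i < n" for i
    proof -
      obtain B where B: "\<And>\<omega>. norm (Hs i \<omega>) \<le> B" using Hs(2)[OF i] by auto
      have "norm (G2 i \<omega>) \<le> \<bar>B\<bar>" for \<omega> using B[of \<omega>] unfolding G2_def by (auto simp: indicator_def)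
      then show ?thesis by blast
    qed
    have eq: "indicator A \<omega> * I2 \<omega> = (\<Sum>i<n. G2 i \<omega> \<bullet> (W (v (Suc i)) \<omega> - W (v i) \<omega>))" for \<omega>
      unfolding I2_def G2_def by (simp add: sum_distrib_left)
    have 1: "(\<integral>\<omega>. indicator A \<omega> * I2 \<omega> \<partial>M) = 0"
      unfolding eq by (rule simple_sum_moments(3)[OF v G2m' G2b'])
    have "(sqn A I2) = (\<integral>\<^sup>+\<omega>. ennreal ((indicator A \<omega> * I2 \<omega>)\<^sup>2) \<partial>M)"
      by (intro nn_integral_cong) (auto split: split_indicator)
    also have "\<dots> = (\<integral>\<^sup>+\<omega>. (\<Sum>i<n. ennreal (v (Suc i) - v i) * ennreal ((norm (G2 i \<omega>))\<^sup>2)) \<partial>M)"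
      unfolding eq by (rule simple_sum_nn_isometry[OF v G2m' G2b'])
    also have "\<dots> = (\<integral>\<^sup>+\<omega>\<in>A. (\<integral>\<^sup>+s\<in>{t<..}. ennreal ((norm (H s \<omega>))\<^sup>2) \<partial>lborel) \<partial>M)"
      unfolding H nn_integral_step_sq[OF tt(2) borel_open[OF open_greaterThan]] sum_distrib_right
    proof (intro nn_integral_cong sum.cong refl)
      fix i \<omega>
      have "{tt i<..tt (Suc i)} \<inter> {t<..} = {v i<..v (Suc i)}"
        unfolding v_def by auto
      moreover have "v i \<le> v (Suc i)" using monoD[OF v(1), of i "Suc i"] by simp
      ultimately have "emeasure lborel ({tt i<..tt (Suc i)} \<inter> {t<..}) = ennreal (v (Suc i) - v i)" by simp
      then show "ennreal (v (Suc i) - v i) * ennreal ((norm (G2 i \<omega>))\<^sup>2)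
        = emeasure lborel ({tt i<..tt (Suc i)} \<inter> {t<..}) * ennreal ((norm (Hs i \<omega>))\<^sup>2) * indicator A \<omega>"
        unfolding G2_def by (auto simp: indicator_def)
    qed
    finally show ?thesis using 1 by simp
  qed
  show ?thesis
    by (rule that[OF split m1 m2(1) Hm e1 m2(2,3)]) (use A2 in auto)
qed

text \<open>Since H vanishes up to t, the part of each approximation before t is negligible in L2,
  and I is the L2 limit of the parts after t. These are centred and isometric on every event of F t,
  and both properties survive the limit.\<close>

lemma ito_isometry:
  assumes ito: "ito_integral M W H I" and t: "0 \<le> t"
    and H0: "\<And>s \<omega>. s \<le> t \<Longrightarrow> H s \<omega> = 0"
    and Hm[measurable]: "(\<lambda>(\<omega>, s). H s \<omega>) \<in> borel_measurable (M \<Otimes>\<^sub>M lborel)"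
  shows "integrable M (\<lambda>\<omega>. (I \<omega>)\<^sup>2)"
    and "A \<in> sets (F t) \<Longrightarrow> (\<integral>\<omega>. indicator A \<omega> * I \<omega> \<partial>M) = 0"
    and "A \<in> sets (F t) \<Longrightarrow> (sqn A I)
      = (\<integral>\<^sup>+\<omega>\<in>A. (\<integral>\<^sup>+s. ennreal ((norm (H s \<omega>))\<^sup>2) \<partial>lborel) \<partial>M)"
proof -
  obtain Hn In where Im[measurable]: "I \<in> borel_measurable M"
    and simp: "\<And>k. simple_integral F W (Hn k) (In k)"
    and lim1: "(\<lambda>k. \<integral>\<^sup>+\<omega>. (\<integral>\<^sup>+s\<in>{0..}. ennreal ((norm (Hn k s \<omega> - H s \<omega>))\<^sup>2) \<partial>lborel) \<partial>M) \<longlonglongrightarrow> 0"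
    and lim2: "(\<lambda>k. \<integral>\<^sup>+\<omega>. ennreal ((In k \<omega> - I \<omega>)\<^sup>2) \<partial>M) \<longlonglongrightarrow> 0"
    using ito unfolding ito_integral_def by blast
  \<comment> \<open>The properties of a split of the k-th approximation are collected so that splits
    can be chosen for all k at once.\<close>
  define P where "P = (\<lambda>k (I1, I2). (\<forall>\<omega>. In k \<omega> = I1 \<omega> + I2 \<omega>) \<and> I1 \<in> borel_measurable M \<and> I2 \<in> borel_measurable M \<and>
    (\<lambda>(\<omega>, s). Hn k s \<omega>) \<in> borel_measurable (M \<Otimes>\<^sub>M lborel) \<and>
    (\<integral>\<^sup>+\<omega>. ennreal ((I1 \<omega>)\<^sup>2) \<partial>M) = (\<integral>\<^sup>+\<omega>. (\<integral>\<^sup>+s\<in>{0..t}. ennreal ((norm (Hn k s \<omega>))\<^sup>2) \<partial>lborel) \<partial>M) \<and>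
    integrable M I2 \<and> integrable M (\<lambda>\<omega>. (I2 \<omega>)\<^sup>2) \<and>
    (\<forall>A. A \<in> sets (F t) \<longrightarrow> (\<integral>\<omega>. indicator A \<omega> * I2 \<omega> \<partial>M) = 0 \<and> (sqn A I2)
      = (\<integral>\<^sup>+\<omega>\<in>A. (\<integral>\<^sup>+s\<in>{t<..}. ennreal ((norm (Hn k s \<omega>))\<^sup>2) \<partial>lborel) \<partial>M)))"
  have "\<exists>J. P k J" for k
  proof -
    show ?thesis
    proof (rule simple_integral_split[OF simp[of k] t], goal_cases)
      case (1 I1 I2)
      then show ?case by (intro exI[of _ "(I1, I2)"]) (simp add: P_def)
    qed
  qed
  then obtain J where J: "\<And>k. P k (J k)" by metis
  define I1 where "I1 = (\<lambda>k. fst (J k))"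
  define I2 where "I2 = (\<lambda>k. snd (J k))"
  have P: "P k (I1 k, I2 k)" for k using J unfolding I1_def I2_def by simp
  have [measurable]: "I1 k \<in> borel_measurable M" "I2 k \<in> borel_measurable M"
    "(\<lambda>(\<omega>, s). Hn k s \<omega>) \<in> borel_measurable (M \<Otimes>\<^sub>M lborel)" for k using P[of k] unfolding P_def by auto
  have In: "In k \<omega> = I1 k \<omega> + I2 k \<omega>" for k \<omega> using P[of k] unfolding P_def by auto
  have iso1: "(\<integral>\<^sup>+\<omega>. ennreal ((I1 k \<omega>)\<^sup>2) \<partial>M) = (\<integral>\<^sup>+\<omega>. (\<integral>\<^sup>+s\<in>{0..t}. ennreal ((norm (Hn k s \<omega>))\<^sup>2) \<partial>lborel) \<partial>M)"
    and iI2: "integrable M (I2 k)" "integrable M (\<lambda>\<omega>. (I2 k \<omega>)\<^sup>2)" for k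
    using P[of k] unfolding P_def by auto
  have mean2: "(\<integral>\<omega>. indicator A \<omega> * I2 k \<omega> \<partial>M) = 0" if "A \<in> sets (F t)" for k A
    using P[of k] that unfolding P_def by auto
  have iso2: "(sqn A (I2 k))
      = (\<integral>\<^sup>+\<omega>\<in>A. (\<integral>\<^sup>+s\<in>{t<..}. ennreal ((norm (Hn k s \<omega>))\<^sup>2) \<partial>lborel) \<partial>M)" if "A \<in> sets (F t)" for k A
    using P[of k] that unfolding P_def by auto
  define e where "e = (\<lambda>k. \<integral>\<^sup>+\<omega>. (\<integral>\<^sup>+s\<in>{0..}. ennreal ((norm (Hn k s \<omega> - H s \<omega>))\<^sup>2) \<partial>lborel) \<partial>M)"
  define d where "d = (\<lambda>k. \<integral>\<^sup>+\<omega>. ennreal ((In k \<omega> - I \<omega>)\<^sup>2) \<partial>M)"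
  \<comment> \<open>One null sequence for both errors: I - I2 = (I - In) + I1, and the square of a
    sum of two terms costs a factor 2.\<close>
  define r where "r = (\<lambda>k. 2 * d k + 2 * e k)"
  have r0: "r \<longlonglongrightarrow> 0"
  proof -
    have "r \<longlonglongrightarrow> 2 * 0 + 2 * 0" unfolding r_def d_def e_def
      by (intro tendsto_add ennreal_tendsto_cmult lim1 lim2) auto
    then show ?thesis by simp
  qed
  have er: "e k \<le> r k" for k unfolding r_def mult_2
    by (intro add_increasing zero_le order_refl)
  \<comment> \<open>On [0, t] the integrand H is 0, so the energy of Hn there is part of the
    approximation error.\<close>
  have I1e: "(\<integral>\<^sup>+\<omega>. ennreal ((I1 k \<omega>)\<^sup>2) \<partial>M) \<le> e k" for k
    unfolding iso1 e_def using H0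
    by (intro nn_integral_mono) (auto split: split_indicator)
  have II2: "(\<integral>\<^sup>+\<omega>. ennreal ((I \<omega> - I2 k \<omega>)\<^sup>2) \<partial>M) \<le> r k" for k
  proof -
    have "(\<integral>\<^sup>+\<omega>. ennreal ((I \<omega> - I2 k \<omega>)\<^sup>2) \<partial>M) \<le> (\<integral>\<^sup>+\<omega>. 2 * ennreal ((In k \<omega> - I \<omega>)\<^sup>2) + 2 * ennreal ((I1 k \<omega>)\<^sup>2) \<partial>M)"
    proof (rule nn_integral_mono)
      fix \<omega>
      have "(I \<omega> - I2 k \<omega>)\<^sup>2 = (I1 k \<omega> + - (In k \<omega> - I \<omega>))\<^sup>2" unfolding In by (simp add: algebra_simps)
      also have "\<dots> \<le> 2 * (In k \<omega> - I \<omega>)\<^sup>2 + 2 * (I1 k \<omega>)\<^sup>2"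
        using norm_sq_add_le[of 1 "I1 k \<omega>" "- (In k \<omega> - I \<omega>)"] by (simp add: power2_commute)
      finally have "ennreal ((I \<omega> - I2 k \<omega>)\<^sup>2) \<le> ennreal (2 * (In k \<omega> - I \<omega>)\<^sup>2 + 2 * (I1 k \<omega>)\<^sup>2)"
        by (rule ennreal_leI)
      then show "ennreal ((I \<omega> - I2 k \<omega>)\<^sup>2) \<le> 2 * ennreal ((In k \<omega> - I \<omega>)\<^sup>2) + 2 * ennreal ((I1 k \<omega>)\<^sup>2)"
        by (simp add: ennreal_mult)
    qed
    also have "\<dots> = 2 * d k + 2 * (\<integral>\<^sup>+\<omega>. ennreal ((I1 k \<omega>)\<^sup>2) \<partial>M)"
      unfolding d_def by (subst nn_integral_add) (auto simp: nn_integral_cmult In)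
    also have "\<dots> \<le> r k" unfolding r_def by (intro add_left_mono mult_left_mono I1e) auto
    finally show ?thesis .
  qed
  have L2: "integrable M (\<lambda>\<omega>. (I \<omega>)\<^sup>2)"
  proof -
    \<comment> \<open>One approximation at finite distance is enough for square integrability of the
      limit.\<close>
    obtain k where k: "r k < 1"
      using order_tendstoD(2)[OF r0, of 1] by (auto simp: eventually_sequentially)
    have "(\<integral>\<^sup>+\<omega>. ennreal ((I \<omega>)\<^sup>2) \<partial>M) \<le> (\<integral>\<^sup>+\<omega>. 2 * ennreal ((I2 k \<omega>)\<^sup>2) + 2 * ennreal ((I \<omega> - I2 k \<omega>)\<^sup>2) \<partial>M)"
    proof (rule nn_integral_mono)
      fix \<omega>
      have "(I \<omega>)\<^sup>2 \<le> 2 * (I2 k \<omega>)\<^sup>2 + 2 * (I \<omega> - I2 k \<omega>)\<^sup>2"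
        using norm_sq_add_le[of 1 "I2 k \<omega>" "I \<omega> - I2 k \<omega>"] by simp
      then have "ennreal ((I \<omega>)\<^sup>2) \<le> ennreal (2 * (I2 k \<omega>)\<^sup>2 + 2 * (I \<omega> - I2 k \<omega>)\<^sup>2)"
        by (rule ennreal_leI)
      then show "ennreal ((I \<omega>)\<^sup>2) \<le> 2 * ennreal ((I2 k \<omega>)\<^sup>2) + 2 * ennreal ((I \<omega> - I2 k \<omega>)\<^sup>2)"
        by (simp add: ennreal_mult)
    qed
    also have "\<dots> = 2 * (\<integral>\<^sup>+\<omega>. ennreal ((I2 k \<omega>)\<^sup>2) \<partial>M) + 2 * (\<integral>\<^sup>+\<omega>. ennreal ((I \<omega> - I2 k \<omega>)\<^sup>2) \<partial>M)"
      by (subst nn_integral_add) (auto simp: nn_integral_cmult)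
    also have "\<dots> < \<infinity>"
    proof -
      have "(\<integral>\<^sup>+\<omega>. ennreal ((I2 k \<omega>)\<^sup>2) \<partial>M) < \<infinity>" using iI2(2)[of k] by (simp add: integrable_iff_bounded)
      moreover have "(\<integral>\<^sup>+\<omega>. ennreal ((I \<omega> - I2 k \<omega>)\<^sup>2) \<partial>M) < \<infinity>" using order.strict_trans[OF order_le_less_trans[OF II2 k] ennreal_one_less_top] by simp
      ultimately show ?thesis by (auto simp: ennreal_mult_less_top)
    qed
    finally show ?thesis by (intro integrableI_bounded) auto
  qed
  then show "integrable M (\<lambda>\<omega>. (I \<omega>)\<^sup>2)" .
  have iI: "integrable M I" by (rule square_integrable_imp_integrable[OF Im L2])
  show "(\<integral>\<omega>. indicator A \<omega> * I \<omega> \<partial>M) = 0" if A: "A \<in> sets (F t)"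
  proof -
    have AM[measurable]: "A \<in> sets M" using sets_F_M[OF A] .
    let ?x = "ennreal ((\<integral>\<omega>. indicator A \<omega> * I \<omega> \<partial>M)\<^sup>2)"
    have "?x \<le> r k" for k
    proof -
      have "(\<integral>\<omega>. indicator A \<omega> * I \<omega> \<partial>M) = (\<integral>\<omega>. indicator A \<omega> * (I \<omega> - I2 k \<omega>) \<partial>M)"
        unfolding right_diff_distrib using iI iI2(1)[of k] mean2[OF A, of k]
        by (subst Bochner_Integration.integral_diff) (auto intro: integrable_indicator_mult[OF AM])
      then have "?x \<le> emeasure M A * (\<integral>\<^sup>+\<omega>\<in>A. ennreal ((I \<omega> - I2 k \<omega>)\<^sup>2) \<partial>M)"
        using sq_integral_le_nn_integral[of "\<lambda>\<omega>. I \<omega> - I2 k \<omega>" M A] AM by simp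
      also have "\<dots> \<le> 1 * (\<integral>\<^sup>+\<omega>. ennreal ((I \<omega> - I2 k \<omega>)\<^sup>2) \<partial>M)"
        by (intro mult_mono emeasure_le_1 nn_integral_mono) (auto split: split_indicator)
      also have "\<dots> \<le> r k" using II2 by simp
      finally show ?thesis .
    qed
    then have "?x \<le> 0" by (intro LIMSEQ_le_const[OF r0]) auto
    then show ?thesis by (simp add: ennreal_eq_0_iff)
  qed
  show "(sqn A I) = (\<integral>\<^sup>+\<omega>\<in>A. (\<integral>\<^sup>+s. ennreal ((norm (H s \<omega>))\<^sup>2) \<partial>lborel) \<partial>M)"
    if A: "A \<in> sets (F t)"
  proof -
    have AM[measurable]: "A \<in> sets M" using sets_F_M[OF A] .
    define c where "c = (\<lambda>\<delta>::real. ennreal (1 + 1 / \<delta>))"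
    let ?a = "\<integral>\<^sup>+\<omega>\<in>A. ennreal ((I \<omega>)\<^sup>2) \<partial>M"
    let ?b = "\<integral>\<^sup>+\<omega>\<in>A. (\<integral>\<^sup>+s. ennreal ((norm (H s \<omega>))\<^sup>2) \<partial>lborel) \<partial>M"
    let ?u = "\<lambda>k. \<integral>\<^sup>+\<omega>\<in>A. ennreal ((I2 k \<omega>)\<^sup>2) \<partial>M"
    let ?w = "\<lambda>k. \<integral>\<^sup>+\<omega>\<in>A. (\<integral>\<^sup>+s\<in>{t<..}. ennreal ((norm (Hn k s \<omega>))\<^sup>2) \<partial>lborel) \<partial>M"
    \<comment> \<open>Young's inequality for a perturbation, here for random variables and in
      \<open>gen2\<close> for energies. Using each in both directions squeezes the two sides of the
      isometry together.\<close>
    have gen: "(sqn A X) \<le> ennreal (1 + \<delta>) * (sqn A X') + c \<delta> * R"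
      if "\<delta> > 0" and [measurable]: "X \<in> borel_measurable M" "X' \<in> borel_measurable M"
        and R: "(\<integral>\<^sup>+\<omega>. ennreal ((X \<omega> - X' \<omega>)\<^sup>2) \<partial>M) \<le> R" for \<delta> X X' R
    proof -
      have "(sqn A X)
        \<le> (\<integral>\<^sup>+\<omega>. ennreal (1 + \<delta>) * (ennreal ((X' \<omega>)\<^sup>2) * indicator A \<omega>) + c \<delta> * ennreal ((X \<omega> - X' \<omega>)\<^sup>2) \<partial>M)"
      proof (rule nn_integral_mono)
        fix \<omega>
        have "(X \<omega>)\<^sup>2 \<le> (1 + \<delta>) * (X' \<omega>)\<^sup>2 + (1 + 1 / \<delta>) * (X \<omega> - X' \<omega>)\<^sup>2"
          using norm_sq_add_le[OF that(1), of "X' \<omega>" "X \<omega> - X' \<omega>"] by simp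
        then have "ennreal ((X \<omega>)\<^sup>2) \<le> ennreal ((1 + \<delta>) * (X' \<omega>)\<^sup>2 + (1 + 1 / \<delta>) * (X \<omega> - X' \<omega>)\<^sup>2)"
          by (rule ennreal_leI)
        also have "\<dots> = ennreal (1 + \<delta>) * ennreal ((X' \<omega>)\<^sup>2) + c \<delta> * ennreal ((X \<omega> - X' \<omega>)\<^sup>2)"
          unfolding c_def using that(1) by (intro ennreal_lincomb) auto
        finally show "ennreal ((X \<omega>)\<^sup>2) * indicator A \<omega>
          \<le> ennreal (1 + \<delta>) * (ennreal ((X' \<omega>)\<^sup>2) * indicator A \<omega>) + c \<delta> * ennreal ((X \<omega> - X' \<omega>)\<^sup>2)"
          by (auto split: split_indicator)
      qed
      also have "\<dots> = ennreal (1 + \<delta>) * (sqn A X') + c \<delta> * (\<integral>\<^sup>+\<omega>. ennreal ((X \<omega> - X' \<omega>)\<^sup>2) \<partial>M)"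
        by (subst nn_integral_add) (auto simp: nn_integral_cmult)
      also have "\<dots> \<le> ennreal (1 + \<delta>) * (sqn A X') + c \<delta> * R"
        by (intro add_left_mono mult_left_mono R) auto
      finally show ?thesis .
    qed
    have gen2: "(\<integral>\<^sup>+\<omega>\<in>A. (\<integral>\<^sup>+s\<in>{t<..}. ennreal ((norm (K s \<omega>))\<^sup>2) \<partial>lborel) \<partial>M)
       \<le> ennreal (1 + \<delta>) * (\<integral>\<^sup>+\<omega>\<in>A. (\<integral>\<^sup>+s\<in>{t<..}. ennreal ((norm (K' s \<omega>))\<^sup>2) \<partial>lborel) \<partial>M) + c \<delta> * R"
      if "\<delta> > 0" and Km[measurable]: "(\<lambda>(\<omega>, s). K s \<omega>) \<in> borel_measurable (M \<Otimes>\<^sub>M lborel)"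
        and Km'[measurable]: "(\<lambda>(\<omega>, s). K' s \<omega>) \<in> borel_measurable (M \<Otimes>\<^sub>M lborel)"
        and R: "(\<integral>\<^sup>+\<omega>. (\<integral>\<^sup>+s\<in>{0..}. ennreal ((norm (K s \<omega> - K' s \<omega>))\<^sup>2) \<partial>lborel) \<partial>M) \<le> R"
      for \<delta> R and K K' :: "real \<Rightarrow> 'a \<Rightarrow> real^'d"
    proof -
      have pt: "(\<integral>\<^sup>+s\<in>{t<..}. ennreal ((norm (K s \<omega>))\<^sup>2) \<partial>lborel)
        \<le> ennreal (1 + \<delta>) * (\<integral>\<^sup>+s\<in>{t<..}. ennreal ((norm (K' s \<omega>))\<^sup>2) \<partial>lborel)
          + c \<delta> * (\<integral>\<^sup>+s\<in>{0..}. ennreal ((norm (K s \<omega> - K' s \<omega>))\<^sup>2) \<partial>lborel)" if \<omega>: "\<omega> \<in> space M" for \<omega>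
      proof -
        have [measurable]: "(\<lambda>s. K s \<omega>) \<in> borel_measurable lborel" "(\<lambda>s. K' s \<omega>) \<in> borel_measurable lborel"
          using measurable_compose[OF measurable_Pair1'[OF \<omega>] Km] measurable_compose[OF measurable_Pair1'[OF \<omega>] Km'] by simp_all
        have "(\<integral>\<^sup>+s\<in>{t<..}. ennreal ((norm (K s \<omega>))\<^sup>2) \<partial>lborel)
          \<le> (\<integral>\<^sup>+s. ennreal (1 + \<delta>) * (ennreal ((norm (K' s \<omega>))\<^sup>2) * indicator {t<..} s)
             + c \<delta> * (ennreal ((norm (K s \<omega> - K' s \<omega>))\<^sup>2) * indicator {0..} s) \<partial>lborel)"
        proof (rule nn_integral_mono)
          fix s
          have "(norm (K s \<omega>))\<^sup>2 \<le> (1 + \<delta>) * (norm (K' s \<omega>))\<^sup>2 + (1 + 1 / \<delta>) * (norm (K s \<omega> - K' s \<omega>))\<^sup>2"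
            using norm_sq_add_le[OF \<open>\<delta> > 0\<close>, of "K' s \<omega>" "K s \<omega> - K' s \<omega>"] by simp
          then have "ennreal ((norm (K s \<omega>))\<^sup>2) \<le> ennreal ((1 + \<delta>) * (norm (K' s \<omega>))\<^sup>2 + (1 + 1 / \<delta>) * (norm (K s \<omega> - K' s \<omega>))\<^sup>2)"
            by (rule ennreal_leI)
          also have "\<dots> = ennreal (1 + \<delta>) * ennreal ((norm (K' s \<omega>))\<^sup>2) + c \<delta> * ennreal ((norm (K s \<omega> - K' s \<omega>))\<^sup>2)"
            unfolding c_def using \<open>\<delta> > 0\<close> by (intro ennreal_lincomb) auto
          finally show "ennreal ((norm (K s \<omega>))\<^sup>2) * indicator {t<..} s
            \<le> ennreal (1 + \<delta>) * (ennreal ((norm (K' s \<omega>))\<^sup>2) * indicator {t<..} s)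
             + c \<delta> * (ennreal ((norm (K s \<omega> - K' s \<omega>))\<^sup>2) * indicator {0..} s)"
            using t by (auto split: split_indicator)
        qed
        also have "\<dots> = ennreal (1 + \<delta>) * (\<integral>\<^sup>+s\<in>{t<..}. ennreal ((norm (K' s \<omega>))\<^sup>2) \<partial>lborel)
          + c \<delta> * (\<integral>\<^sup>+s\<in>{0..}. ennreal ((norm (K s \<omega> - K' s \<omega>))\<^sup>2) \<partial>lborel)"
          by (subst nn_integral_add) (auto simp: nn_integral_cmult)
        finally show ?thesis .
      qed
      have "(\<integral>\<^sup>+\<omega>\<in>A. (\<integral>\<^sup>+s\<in>{t<..}. ennreal ((norm (K s \<omega>))\<^sup>2) \<partial>lborel) \<partial>M)
        \<le> (\<integral>\<^sup>+\<omega>. ennreal (1 + \<delta>) * ((\<integral>\<^sup>+s\<in>{t<..}. ennreal ((norm (K' s \<omega>))\<^sup>2) \<partial>lborel) * indicator A \<omega>)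
          + c \<delta> * (\<integral>\<^sup>+s\<in>{0..}. ennreal ((norm (K s \<omega> - K' s \<omega>))\<^sup>2) \<partial>lborel) \<partial>M)"
        by (rule nn_integral_mono) (use pt in \<open>auto split: split_indicator\<close>)
      also have "\<dots> = ennreal (1 + \<delta>) * (\<integral>\<^sup>+\<omega>\<in>A. (\<integral>\<^sup>+s\<in>{t<..}. ennreal ((norm (K' s \<omega>))\<^sup>2) \<partial>lborel) \<partial>M)
        + c \<delta> * (\<integral>\<^sup>+\<omega>. (\<integral>\<^sup>+s\<in>{0..}. ennreal ((norm (K s \<omega> - K' s \<omega>))\<^sup>2) \<partial>lborel) \<partial>M)"
        by (subst nn_integral_add) (auto simp: nn_integral_cmult)
      also have "\<dots> \<le> ennreal (1 + \<delta>) * (\<integral>\<^sup>+\<omega>\<in>A. (\<integral>\<^sup>+s\<in>{t<..}. ennreal ((norm (K' s \<omega>))\<^sup>2) \<partial>lborel) \<partial>M) + c \<delta> * R"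
        by (intro add_left_mono mult_left_mono R) auto
      finally show ?thesis .
    qed
    have b_eq: "?b = (\<integral>\<^sup>+\<omega>\<in>A. (\<integral>\<^sup>+s\<in>{t<..}. ennreal ((norm (H s \<omega>))\<^sup>2) \<partial>lborel) \<partial>M)"
      using H0 by (intro nn_integral_cong arg_cong2[where f="(*)"] refl) (auto split: split_indicator simp: not_less)
    have ec: "(\<integral>\<^sup>+\<omega>. (\<integral>\<^sup>+s\<in>{0..}. ennreal ((norm (Hn k s \<omega> - H s \<omega>))\<^sup>2) \<partial>lborel) \<partial>M) \<le> r k"
      "(\<integral>\<^sup>+\<omega>. (\<integral>\<^sup>+s\<in>{0..}. ennreal ((norm (H s \<omega> - Hn k s \<omega>))\<^sup>2) \<partial>lborel) \<partial>M) \<le> r k" for k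
      using er[of k] unfolding e_def by (auto simp: norm_minus_commute)
    have II2': "(\<integral>\<^sup>+\<omega>. ennreal ((I2 k \<omega> - I \<omega>)\<^sup>2) \<partial>M) \<le> r k" for k
      using II2[of k] by (simp add: power2_commute)
    have cfin: "c \<delta> < \<infinity>" for \<delta> unfolding c_def by simp
    show "?a = ?b"
    proof (rule antisym)
      show "?a \<le> ?b"
      proof (rule ennreal_limit_le[OF _ _ r0 cfin])
        show "?a \<le> ennreal (1 + \<delta>) * ?u k + c \<delta> * r k" if "\<delta> > 0" for \<delta> k
          by (rule gen[OF that _ _ II2]) measurable
        show "?u k \<le> ennreal (1 + \<delta>) * ?b + c \<delta> * r k" if "\<delta> > 0" for \<delta> k
          unfolding iso2[OF A] b_eq by (rule gen2[OF that _ _ ec(1)]) measurable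
      qed
      show "?b \<le> ?a"
      proof (rule ennreal_limit_le[OF _ _ r0 cfin])
        show "?b \<le> ennreal (1 + \<delta>) * ?u k + c \<delta> * r k" if "\<delta> > 0" for \<delta> k
          unfolding iso2[OF A] b_eq by (rule gen2[OF that _ _ ec(2)]) measurable
        show "?u k \<le> ennreal (1 + \<delta>) * ?a + c \<delta> * r k" if "\<delta> > 0" for \<delta> k
          by (rule gen[OF that _ _ II2']) measurable
      qed
    qed
  qed
qed

section \<open>Progressive processes and stopping\<close>

lemma measurable_into_F: "g \<in> N \<rightarrow>\<^sub>M M \<Longrightarrow> g \<in> N \<rightarrow>\<^sub>M F t"
  by (rule measurableI) (auto dest: measurable_space measurable_sets sets_F_M)

text \<open>Joint measurability on [0, n] is progressive measurability at time n, and n tends to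
  infinity. Progressive measurability says nothing about negative times, whence the value 0
  there.\<close>

lemma progressive_joint:
  fixes X :: "real \<Rightarrow> 'a \<Rightarrow> 'b::{second_countable_topology, real_normed_vector}"
  assumes X: "progressive F X"
  shows "(\<lambda>(\<omega>, s). if 0 \<le> s then X s \<omega> else 0) \<in> borel_measurable (M \<Otimes>\<^sub>M lborel)"
proof (rule borel_measurable_LIMSEQ_metric)
  fix n :: nat
  let ?S = "space M \<times> {0..real n}"
  have S: "?S \<inter> space (M \<Otimes>\<^sub>M lborel) \<in> sets (M \<Otimes>\<^sub>M lborel)" by auto
  have 1: "(\<lambda>(s, \<omega>). X s \<omega>) \<in> borel_measurable (restrict_space lborel {0..real n} \<Otimes>\<^sub>M F (real n))"
    using X unfolding progressive_def by simp
  have 2: "(\<lambda>(\<omega>, s). (s, \<omega>)) \<in> restrict_space (M \<Otimes>\<^sub>M lborel) ?S \<rightarrow>\<^sub>M restrict_space lborel {0..real n} \<Otimes>\<^sub>M F (real n)"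
    unfolding split_beta'
  proof (rule measurable_Pair)
    show "snd \<in> restrict_space (M \<Otimes>\<^sub>M lborel) ?S \<rightarrow>\<^sub>M restrict_space lborel {0..real n}"
      by (rule measurable_restrict_space2) (auto simp: space_restrict_space intro!: measurable_restrict_space1)
    show "fst \<in> restrict_space (M \<Otimes>\<^sub>M lborel) ?S \<rightarrow>\<^sub>M F (real n)"
      by (rule measurable_into_F) (auto intro!: measurable_restrict_space1)
  qed
  from measurable_compose[OF 2 1]
  have "(\<lambda>(\<omega>, s). X s \<omega>) \<in> borel_measurable (restrict_space (M \<Otimes>\<^sub>M lborel) ?S)"
    by (simp add: split_beta')
  from this[unfolded borel_measurable_restrict_space_iff[OF S]]
  show "(\<lambda>p. indicator ?S p *\<^sub>R (case p of (\<omega>, s) \<Rightarrow> X s \<omega>)) \<in> borel_measurable (M \<Otimes>\<^sub>M lborel)" .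
next
  fix p assume p: "p \<in> space (M \<Otimes>\<^sub>M (lborel :: real measure))"
  obtain \<omega> s where ps: "p = (\<omega>, s)" by (cases p)
  have \<omega>: "\<omega> \<in> space M" using p ps by (simp add: space_pair_measure)
  obtain N where N: "s \<le> real N" using real_arch_simple by blast
  have "\<forall>\<^sub>F n in sequentially. indicator (space M \<times> {0..real n}) p *\<^sub>R (case p of (\<omega>, s) \<Rightarrow> X s \<omega>)
     = (case p of (\<omega>, s) \<Rightarrow> if 0 \<le> s then X s \<omega> else 0)"
    using eventually_ge_at_top[of N]
  proof eventually_elim
    case (elim n)
    then have "s \<le> real n" using N by (meson of_nat_le_iff order_trans)
    then show ?case unfolding ps using \<omega> by (auto simp: indicator_def)
  qed
  then show "(\<lambda>n. indicator (space M \<times> {0..real n}) p *\<^sub>R (case p of (\<omega>, s) \<Rightarrow> X s \<omega>))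
     \<longlonglongrightarrow> (case p of (\<omega>, s) \<Rightarrow> if 0 \<le> s then X s \<omega> else 0)"
    by (rule tendsto_eventually)
qed

lemma progressive_adapted:
  assumes X: "progressive F X" and t: "0 \<le> t"
  shows "X t \<in> borel_measurable (F t)"
proof -
  have "(\<lambda>(s, \<omega>). X s \<omega>) \<in> borel_measurable (restrict_space lborel {0..t} \<Otimes>\<^sub>M F t)"
    using X t unfolding progressive_def by simp
  moreover have "(\<lambda>\<omega>. (t, \<omega>)) \<in> F t \<rightarrow>\<^sub>M restrict_space lborel {0..t} \<Otimes>\<^sub>M F t"
    by (rule measurable_Pair1') (use t in \<open>auto simp: space_restrict_space\<close>)
  ultimately have "(\<lambda>\<omega>. case (t, \<omega>) of (s, \<omega>) \<Rightarrow> X s \<omega>) \<in> borel_measurable (F t)"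
    by (rule measurable_compose[rotated])
  then show ?thesis by simp
qed

text \<open>Integrating against Lebesgue measure restricted to [0, t] retains measurability with
  respect to F t, which joint measurability over M would not give. The conditional orthogonality of
  increments rests on this.\<close>

lemma progressive_integral:
  fixes X :: "real \<Rightarrow> 'a \<Rightarrow> real"
  assumes X: "progressive F X" and t: "0 \<le> t" and A: "A \<in> sets borel" "A \<subseteq> {0..t}"
  shows "(\<lambda>\<omega>. \<integral>s. indicator A s * X s \<omega> \<partial>lborel) \<in> borel_measurable (F t)"
proof -
  let ?N = "restrict_space (lborel :: real measure) {0..t}"
  interpret N: sigma_finite_measure ?N
    by (rule sigma_finite_measure_restrict_space) (auto intro: sigma_finite_lborel)
  have "(\<lambda>(s, \<omega>). X s \<omega>) \<in> borel_measurable (?N \<Otimes>\<^sub>M F t)"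
    using X t unfolding progressive_def by simp
  then have Xm: "(\<lambda>(\<omega>, s). X s \<omega>) \<in> borel_measurable (F t \<Otimes>\<^sub>M ?N)"
    using measurable_pair_swap_iff[of "\<lambda>(s, \<omega>). X s \<omega>" ?N "F t" borel] by simp
  have i: "indicator A \<in> borel_measurable ?N"
    using A by (intro measurable_restrict_space1) auto
  have "(\<lambda>(\<omega>, s). indicator A s * X s \<omega>) \<in> borel_measurable (F t \<Otimes>\<^sub>M ?N)"
    using borel_measurable_times[OF measurable_compose[OF measurable_snd i] Xm]
    by (simp add: split_beta')
  then have 1: "(\<lambda>\<omega>. \<integral>s. indicator A s * X s \<omega> \<partial>?N) \<in> borel_measurable (F t)"
    by (rule N.borel_measurable_lebesgue_integral)
  have "(\<integral>s. indicator A s * X s \<omega> \<partial>?N) = (\<integral>s. indicator A s * X s \<omega> \<partial>lborel)" for \<omega>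
    using A by (subst integral_restrict_space) (auto intro!: Bochner_Integration.integral_cong simp: indicator_def)
  with 1 show ?thesis by simp
qed

lemma stopping_le: "stopping_time F \<sigma> \<Longrightarrow> s \<le> t \<Longrightarrow> {\<omega>\<in>space M. \<sigma> \<omega> \<le> s} \<in> sets (F t)"
  using filtration.stopping_time_le_const[OF filt, of \<sigma> s t] by (simp add: pred_def)

lemma stopping_gt: "stopping_time F \<sigma> \<Longrightarrow> s \<le> t \<Longrightarrow> {\<omega>\<in>space M. s < \<sigma> \<omega>} \<in> sets (F t)"
  using sets.compl_sets[OF stopping_le[of \<sigma> s t]]
  by (rule back_subst[of "\<lambda>A. A \<in> sets (F t)"]) (auto simp: not_le)

lemma stopping_M: "stopping_time F \<sigma> \<Longrightarrow> \<sigma> \<in> borel_measurable M"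
  by (rule measurable_stopping_time[where F = F]) (simp_all add: sets_F_subset)

text \<open>The stopping time is finite, so an event of the stopped sigma-algebra is the union over
  n of its traces on {S \<le> n}.\<close>

lemma measurable_pre_sigma_M:
  fixes X :: "'a \<Rightarrow> real"
  assumes S: "stopping_time F S" and X: "X \<in> borel_measurable (filtration.pre_sigma (space M) F S)"
  shows "X \<in> borel_measurable M"
proof (rule measurableI)
  interpret filt: filtration "space M" F by (rule filt)
  fix E :: "real set" assume E: "E \<in> sets borel"
  have A: "X -` E \<inter> space M \<in> sets (filt.pre_sigma S)"
    using measurable_sets[OF X E] by (simp add: filt.space_pre_sigma)
  have "X -` E \<inter> space M = (\<Union>n::nat. {\<omega>\<in>X -` E \<inter> space M. S \<omega> \<le> real n})"
    using real_arch_simple by auto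
  also have "\<dots> \<in> sets M" using filt.sets_pre_sigmaD[OF S A] sets_F_M by blast
  finally show "X -` E \<inter> space M \<in> sets M" .
qed simp

text \<open>The obstacle is that \<sigma> itself need not be F t-measurable, only its minimum with t
  is; the event that \<sigma> has been reached by time s must be expressed through that
  minimum.\<close>

lemma progressive_stopped:
  fixes X :: "real \<Rightarrow> 'a \<Rightarrow> real"
  assumes X: "progressive F X" and \<sigma>: "stopping_time F \<sigma>"
  shows "progressive F (\<lambda>s \<omega>. if 0 \<le> s \<and> s < \<sigma> \<omega> then X s \<omega> else 0)"
  unfolding progressive_def
proof safe
  fix t :: real assume t: "0 \<le> t"
  let ?N = "restrict_space (lborel :: real measure) {0..t} \<Otimes>\<^sub>M F t"
  have Xm: "(\<lambda>(s, \<omega>). X s \<omega>) \<in> borel_measurable ?N"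
    using X t unfolding progressive_def by simp
  have Xm': "(\<lambda>p. X (fst p) (snd p)) \<in> borel_measurable ?N" using Xm by (simp add: split_beta')
  have m: "(\<lambda>\<omega>. min (\<sigma> \<omega>) t) \<in> borel_measurable (F t)"
  proof (rule borel_measurableI_le)
    fix y
    show "{\<omega> \<in> space (F t). min (\<sigma> \<omega>) t \<le> y} \<in> sets (F t)"
    proof (cases "t \<le> y")
      case True
      then have "{\<omega> \<in> space (F t). min (\<sigma> \<omega>) t \<le> y} = space (F t)" by (auto simp: min_le_iff_disj)
      then show ?thesis by (metis sets.top)
    next
      case False
      then have "{\<omega> \<in> space (F t). min (\<sigma> \<omega>) t \<le> y} = {\<omega> \<in> space M. \<sigma> \<omega> \<le> y}" by (auto simp: min_le_iff_disj)
      then show ?thesis using stopping_le[OF \<sigma>, of y t] False by simp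
    qed
  qed
  have s[measurable]: "(\<lambda>p. fst p) \<in> borel_measurable ?N"
    by (rule measurable_compose[OF measurable_fst]) (rule measurable_restrict_space1, simp)
  have lt: "Measurable.pred ?N (\<lambda>p. \<sigma> (snd p) \<le> fst p)"
  proof -
    have [measurable]: "(\<lambda>p. min (\<sigma> (snd p)) t) \<in> borel_measurable ?N"
      by (rule measurable_compose[OF measurable_snd m])
    \<comment> \<open>For times s up to t the minimum decides the event, except when it equals s =
      t; in that case the event {\<sigma> \<le> t} decides.\<close>
    have "{p \<in> space ?N. \<sigma> (snd p) \<le> fst p} = {p \<in> space ?N. min (\<sigma> (snd p)) t < fst p} \<union> {p \<in> space ?N. min (\<sigma> (snd p)) t = fst p} \<inter> {p \<in> space ?N. \<sigma> (snd p) \<le> t}"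
      by (auto simp: space_pair_measure space_restrict_space min_def)
    also have "{p \<in> space ?N. \<sigma> (snd p) \<le> t} = space ?N \<inter> snd -` {\<omega>\<in>space M. \<sigma> \<omega> \<le> t}"
      by (auto simp: space_pair_measure)
    also have "{p \<in> space ?N. min (\<sigma> (snd p)) t < fst p} \<union> {p \<in> space ?N. min (\<sigma> (snd p)) t = fst p} \<inter> (space ?N \<inter> snd -` {\<omega>\<in>space M. \<sigma> \<omega> \<le> t}) \<in> sets ?N"
    proof -
      have "space ?N \<inter> snd -` {\<omega>\<in>space M. \<sigma> \<omega> \<le> t} \<in> sets ?N"
        using measurable_sets[OF measurable_snd[of "restrict_space lborel {0..t}" "F t"] stopping_le[OF \<sigma> order_refl]]
        by (simp add: Int_commute)
      then show ?thesis by measurable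
    qed
    finally show ?thesis by (simp add: pred_def)
  qed
  have "(\<lambda>p. if 0 \<le> fst p \<and> \<not> \<sigma> (snd p) \<le> fst p then X (fst p) (snd p) else 0) \<in> borel_measurable ?N"
    using lt Xm' by measurable
  then show "(\<lambda>(s, \<omega>). if 0 \<le> s \<and> s < \<sigma> \<omega> then X s \<omega> else 0) \<in> borel_measurable ?N"
    by (simp add: split_beta' not_le)
qed

section \<open>Conditional orthogonality and the BSDE\<close>

lemma sigma_finite_subalg: "sigma_finite_subalgebra M (F t)"
  by (rule finite_measure_subalgebra_is_sigma_finite) (unfold_locales, rule subalg)

text \<open>Zero mean on all events of F t amounts to zero conditional expectation, and an F
  t-measurable factor can be pulled out.\<close>

lemma orthogonal:
  assumes V: "integrable M V" and mean: "\<And>A. A \<in> sets (F t) \<Longrightarrow> (\<integral>\<omega>. indicator A \<omega> * V \<omega> \<partial>M) = 0"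
    and X: "X \<in> borel_measurable (F t)" and XV: "integrable M (\<lambda>\<omega>. X \<omega> * V \<omega> :: real)"
  shows "(\<integral>\<omega>. X \<omega> * V \<omega> \<partial>M) = 0"
proof -
  interpret S: sigma_finite_subalgebra M "F t" by (rule sigma_finite_subalg)
  have 0: "AE \<omega> in M. real_cond_exp M (F t) V \<omega> = 0"
    by (rule S.real_cond_exp_charact) (use V mean in \<open>auto simp: set_lebesgue_integral_def\<close>)
  have "(\<integral>\<omega>. X \<omega> * V \<omega> \<partial>M) = (\<integral>\<omega>. X \<omega> * real_cond_exp M (F t) V \<omega> \<partial>M)"
    by (rule S.real_cond_exp_intg(2)[symmetric]) (use XV X V in auto)
  also have "\<dots> = (\<integral>\<omega>. 0 \<partial>M)"
    by (rule integral_cong_AE) (use 0 meas_F_M[OF X] in \<open>auto elim: AE_mp\<close>)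
  finally show ?thesis by simp
qed

lemma square_prod_integrable:
  fixes X V :: "'a \<Rightarrow> real"
  assumes "X \<in> borel_measurable M" "V \<in> borel_measurable M"
    "integrable M (\<lambda>\<omega>. (X \<omega>)\<^sup>2)" "integrable M (\<lambda>\<omega>. (V \<omega>)\<^sup>2)"
  shows "integrable M (\<lambda>\<omega>. X \<omega> * V \<omega>)"
proof (rule Bochner_Integration.integrable_bound)
  show "integrable M (\<lambda>\<omega>. (X \<omega>)\<^sup>2 + (V \<omega>)\<^sup>2)" using assms by auto
  have "\<bar>X \<omega> * V \<omega>\<bar> \<le> \<bar>(X \<omega>)\<^sup>2 + (V \<omega>)\<^sup>2\<bar>" for \<omega>
  proof -
    have "0 \<le> (\<bar>X \<omega>\<bar> - \<bar>V \<omega>\<bar>)\<^sup>2" by simp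
    then have "2 * (\<bar>X \<omega>\<bar> * \<bar>V \<omega>\<bar>) \<le> (X \<omega>)\<^sup>2 + (V \<omega>)\<^sup>2" by (simp add: power2_diff)
    moreover have "0 \<le> \<bar>X \<omega>\<bar> * \<bar>V \<omega>\<bar>" by simp
    ultimately show ?thesis unfolding abs_mult by linarith
  qed
  then show "AE \<omega> in M. norm (X \<omega> * V \<omega>) \<le> norm ((X \<omega>)\<^sup>2 + (V \<omega>)\<^sup>2)" by auto
qed (use assms in measurable)

lemma square_integrable_add:
  fixes X V :: "'a \<Rightarrow> real"
  assumes "X \<in> borel_measurable M" "V \<in> borel_measurable M"
    "integrable M (\<lambda>\<omega>. (X \<omega>)\<^sup>2)" "integrable M (\<lambda>\<omega>. (V \<omega>)\<^sup>2)"
  shows "integrable M (\<lambda>\<omega>. (X \<omega> + V \<omega>)\<^sup>2)"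
  using square_prod_integrable[OF assms] assms(3,4) unfolding power2_sum
  by (simp add: mult.assoc)

lemma square_integrable_diff:
  fixes X V :: "'a \<Rightarrow> real"
  assumes "X \<in> borel_measurable M" "V \<in> borel_measurable M"
    "integrable M (\<lambda>\<omega>. (X \<omega>)\<^sup>2)" "integrable M (\<lambda>\<omega>. (V \<omega>)\<^sup>2)"
  shows "integrable M (\<lambda>\<omega>. (X \<omega> - V \<omega>)\<^sup>2)"
  using square_prod_integrable[OF assms] assms(3,4) unfolding power2_diff
  by (simp add: mult.assoc)

lemma square_integrable_indicator:
  fixes X :: "'a \<Rightarrow> real"
  assumes "A \<in> sets M" "integrable M (\<lambda>\<omega>. (X \<omega>)\<^sup>2)"
  shows "integrable M (\<lambda>\<omega>. (indicator A \<omega> * X \<omega>)\<^sup>2)"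
proof -
  have "(indicator A \<omega> * X \<omega>)\<^sup>2 = indicator A \<omega> * (X \<omega>)\<^sup>2" for \<omega>
    by (simp split: split_indicator)
  then show ?thesis using integrable_indicator_mult[OF assms] by simp
qed

text \<open>P is the conditional expectation of X, described only through its integrals over events
  of F t. Then X - P is orthogonal to P, and Pythagoras gives the bound.\<close>

lemma L2_contraction:
  fixes P X :: "'a \<Rightarrow> real"
  assumes P: "P \<in> borel_measurable (F t)" "integrable M (\<lambda>\<omega>. (P \<omega>)\<^sup>2)"
    and X: "X \<in> borel_measurable M" "integrable M (\<lambda>\<omega>. (X \<omega>)\<^sup>2)"
    and eq: "\<And>A. A \<in> sets (F t) \<Longrightarrow> (\<integral>\<omega>. indicator A \<omega> * P \<omega> \<partial>M) = (\<integral>\<omega>. indicator A \<omega> * X \<omega> \<partial>M)"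
  shows "(\<integral>\<^sup>+\<omega>. ennreal ((P \<omega>)\<^sup>2) \<partial>M) \<le> (\<integral>\<^sup>+\<omega>. ennreal ((X \<omega>)\<^sup>2) \<partial>M)"
proof -
  have PM: "P \<in> borel_measurable M" by (rule meas_F_M[OF P(1)])
  have i: "integrable M P" "integrable M X"
    using square_integrable_imp_integrable PM P X by auto
  have PX: "integrable M (\<lambda>\<omega>. P \<omega> * X \<omega>)" by (rule square_prod_integrable) (use PM P X in auto)
  have PP: "integrable M (\<lambda>\<omega>. P \<omega> * P \<omega>)" using P(2) by (simp add: power2_eq_square)
  have "(\<integral>\<omega>. P \<omega> * (X \<omega> - P \<omega>) \<partial>M) = 0"
  proof (rule orthogonal)
    show "(\<integral>\<omega>. indicator A \<omega> * (X \<omega> - P \<omega>) \<partial>M) = 0" if A: "A \<in> sets (F t)" for A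
      using eq[OF A] integrable_indicator_mult[OF sets_F_M[OF A]] i
      by (simp add: right_diff_distrib Bochner_Integration.integral_diff)
    show "integrable M (\<lambda>\<omega>. P \<omega> * (X \<omega> - P \<omega>))" unfolding right_diff_distrib using PX PP by auto
  qed (use i P in auto)
  then have e: "(\<integral>\<omega>. P \<omega> * X \<omega> \<partial>M) = (\<integral>\<omega>. (P \<omega>)\<^sup>2 \<partial>M)"
    unfolding right_diff_distrib using PX PP by (simp add: power2_eq_square)
  have "0 \<le> (\<integral>\<omega>. (X \<omega> - P \<omega>)\<^sup>2 \<partial>M)" by (rule integral_nonneg_AE) auto
  also have "(\<lambda>\<omega>. (X \<omega> - P \<omega>)\<^sup>2) = (\<lambda>\<omega>. (X \<omega>)\<^sup>2 - 2 * (P \<omega> * X \<omega>) + (P \<omega>)\<^sup>2)"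
    by (auto simp: power2_eq_square algebra_simps)
  also have "(\<integral>\<omega>. (X \<omega>)\<^sup>2 - 2 * (P \<omega> * X \<omega>) + (P \<omega>)\<^sup>2 \<partial>M) = (\<integral>\<omega>. (X \<omega>)\<^sup>2 \<partial>M) - (\<integral>\<omega>. (P \<omega>)\<^sup>2 \<partial>M)"
    using PX P X e by simp
  finally have "(\<integral>\<omega>. (P \<omega>)\<^sup>2 \<partial>M) \<le> (\<integral>\<omega>. (X \<omega>)\<^sup>2 \<partial>M)" by simp
  then show ?thesis using P X by (simp add: nn_integral_eq_integral ennreal_leI)
qed

end

section \<open>The BSDE: isometry for its integrals, increments of the solution, behaviour after
  \<tau>\<close>

locale bsde = brownian M W for M :: "'a measure" and W :: "real \<Rightarrow> 'a \<Rightarrow> real^'d::finite" +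
  fixes \<tau> \<xi> :: "'a \<Rightarrow> real" and f :: "real \<Rightarrow> 'a \<Rightarrow> real \<Rightarrow> real" and L :: real
    and Y :: "real \<Rightarrow> 'a \<Rightarrow> real" and Z :: "real \<Rightarrow> 'a \<Rightarrow> real^'d"
  assumes tau_stop: "stopping_time F \<tau>" and tau_nonneg: "\<And>\<omega>. \<omega> \<in> space M \<Longrightarrow> 0 \<le> \<tau> \<omega>"
    and xi_M: "\<xi> \<in> borel_measurable M"
    and f_lip: "\<And>s \<omega> y y'. \<bar>f s \<omega> y - f s \<omega> y'\<bar> \<le> L * \<bar>y - y'\<bar>"
    and f_prog: "\<And>y. progressive F (\<lambda>s \<omega>. f s \<omega> y)"
    and sol: "bsde_solution M W \<tau> \<xi> f Y Z"
begin

text \<open>The driver along the solution. It is cut off on a half-open interval, as in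
  \<open>progressive_stopped\<close>; the endpoint \<tau> is Lebesgue-null.\<close>

definition Phi :: "'a \<Rightarrow> real \<Rightarrow> real" where
  "Phi \<omega> s = (if 0 \<le> s \<and> s < \<tau> \<omega> then f s \<omega> (Y s \<omega>) else 0)"

text \<open>The energy density of Z, closed at \<tau> because the stochastic integrands are
  supported in \<open>{min t (\<tau> \<omega>)<..\<tau> \<omega>}\<close>.\<close>

definition zeta :: "'a \<Rightarrow> real \<Rightarrow> real" where
  "zeta \<omega> s = (if 0 \<le> s \<and> s \<le> \<tau> \<omega> then (norm (Z s \<omega>))\<^sup>2 else 0)"

text \<open>Negative times are outside the reach of progressive measurability; the value 0 there
  makes the process jointly measurable on the whole line.\<close>

definition Y0 :: "'a \<Rightarrow> real \<Rightarrow> real" where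
  "Y0 \<omega> s = (if 0 \<le> s then Y s \<omega> else 0)"

lemma zeta_nonneg [simp]: "0 \<le> zeta \<omega> s" by (simp add: zeta_def)

lemma Y_prog: "progressive F Y" and Z_prog: "progressive F Z"
  using sol unfolding bsde_solution_def by auto

lemma tau_M [measurable]: "\<tau> \<in> borel_measurable M" by (rule stopping_M[OF tau_stop])

lemma Y0_joint [measurable]: "(\<lambda>(\<omega>, s). Y0 \<omega> s) \<in> borel_measurable (M \<Otimes>\<^sub>M lborel)"
  unfolding Y0_def by (rule progressive_joint[OF Y_prog])

text \<open>The driver is progressive for each frozen y; its Lipschitz property allows Y to be
  inserted for y.\<close>

lemma Phi_prog: "progressive F (\<lambda>s \<omega>. Phi \<omega> s)"
proof -
  have "progressive F (\<lambda>s \<omega>. f s \<omega> (Y s \<omega>))"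
    unfolding progressive_def
  proof safe
    fix t :: real assume t: "0 \<le> t"
    have "(\<lambda>p. f (fst p) (snd p) (Y (fst p) (snd p))) \<in> borel_measurable (restrict_space lborel {0..t} \<Otimes>\<^sub>M F t)"
      by (rule measurable_lipschitz_compose[where L = L and \<phi> = "\<lambda>p. f (fst p) (snd p)" and X = "\<lambda>p. Y (fst p) (snd p)"])
         (use f_lip f_prog Y_prog t in \<open>auto simp: progressive_def split_beta'\<close>)
    then show "(\<lambda>(s, \<omega>). f s \<omega> (Y s \<omega>)) \<in> borel_measurable (restrict_space lborel {0..t} \<Otimes>\<^sub>M F t)"
      by (simp add: split_beta')
  qed
  from progressive_stopped[OF this tau_stop] show ?thesis unfolding Phi_def .
qed

lemma Phi_joint [measurable]: "(\<lambda>(\<omega>, s). Phi \<omega> s) \<in> borel_measurable (M \<Otimes>\<^sub>M lborel)"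
proof -
  have "(\<lambda>(\<omega>, s). if 0 \<le> s then Phi \<omega> s else 0) = (\<lambda>(\<omega>, s). Phi \<omega> s)"
    by (auto simp: Phi_def fun_eq_iff)
  then show ?thesis using progressive_joint[OF Phi_prog] by simp
qed

lemma Z_joint [measurable]: "(\<lambda>(\<omega>, s). if 0 \<le> s then Z s \<omega> else 0) \<in> borel_measurable (M \<Otimes>\<^sub>M lborel)"
  by (rule progressive_joint[OF Z_prog])

lemma zeta_joint [measurable]: "(\<lambda>(\<omega>, s). zeta \<omega> s) \<in> borel_measurable (M \<Otimes>\<^sub>M lborel)"
proof -
  have "(\<lambda>(\<omega>, s). zeta \<omega> s) = (\<lambda>p. if snd p \<le> \<tau> (fst p) then (norm (case p of (\<omega>, s) \<Rightarrow> if 0 \<le> s then Z s \<omega> else 0))\<^sup>2 else 0)"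
    by (auto simp: zeta_def fun_eq_iff)
  also have "\<dots> \<in> borel_measurable (M \<Otimes>\<^sub>M lborel)" by measurable
  finally show ?thesis .
qed

lemma Phi_section [measurable]: "\<omega> \<in> space M \<Longrightarrow> Phi \<omega> \<in> borel_measurable lborel"
  using measurable_compose[OF measurable_Pair1' Phi_joint, of \<omega>] by simp

lemma zeta_section [measurable]: "\<omega> \<in> space M \<Longrightarrow> zeta \<omega> \<in> borel_measurable lborel"
  using measurable_compose[OF measurable_Pair1' zeta_joint, of \<omega>] by simp

lemma Y0_section [measurable]: "\<omega> \<in> space M \<Longrightarrow> Y0 \<omega> \<in> borel_measurable lborel"
  using measurable_compose[OF measurable_Pair1' Y0_joint, of \<omega>] by simp

lemma Y_F: "0 \<le> t \<Longrightarrow> Y t \<in> borel_measurable (F t)"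
  by (rule progressive_adapted[OF Y_prog])

lemma Y_M: "0 \<le> t \<Longrightarrow> Y t \<in> borel_measurable M"
  by (rule meas_F_M[OF Y_F])

text \<open>A solution provides a stochastic integral for each t separately, and one is fixed by
  choice. Nothing relates the choices at different times a priori; the equation itself does so in
  \<open>It_increment\<close>.\<close>

definition It :: "real \<Rightarrow> 'a \<Rightarrow> real" where
  "It t = (SOME I. ito_integral M W (\<lambda>s \<omega>. indicator {min t (\<tau> \<omega>)<..\<tau> \<omega>} s *\<^sub>R Z s \<omega>) I \<and>
        (AE \<omega> in M. set_integrable lborel {min t (\<tau> \<omega>)..\<tau> \<omega>} (\<lambda>s. f s \<omega> (Y s \<omega>)) \<and>
           Y t \<omega> = \<xi> \<omega> + set_lebesgue_integral lborel {min t (\<tau> \<omega>)..\<tau> \<omega>} (\<lambda>s. f s \<omega> (Y s \<omega>))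
                    - I \<omega>))"

lemma It:
  assumes "0 \<le> t"
  shows "ito_integral M W (\<lambda>s \<omega>. indicator {min t (\<tau> \<omega>)<..\<tau> \<omega>} s *\<^sub>R Z s \<omega>) (It t)"
    and "AE \<omega> in M. set_integrable lborel {min t (\<tau> \<omega>)..\<tau> \<omega>} (\<lambda>s. f s \<omega> (Y s \<omega>)) \<and>
           Y t \<omega> = \<xi> \<omega> + set_lebesgue_integral lborel {min t (\<tau> \<omega>)..\<tau> \<omega>} (\<lambda>s. f s \<omega> (Y s \<omega>))
                    - It t \<omega>"
proof -
  let ?P = "\<lambda>I. ito_integral M W (\<lambda>s \<omega>. indicator {min t (\<tau> \<omega>)<..\<tau> \<omega>} s *\<^sub>R Z s \<omega>) I \<and>
        (AE \<omega> in M. set_integrable lborel {min t (\<tau> \<omega>)..\<tau> \<omega>} (\<lambda>s. f s \<omega> (Y s \<omega>)) \<and>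
           Y t \<omega> = \<xi> \<omega> + set_lebesgue_integral lborel {min t (\<tau> \<omega>)..\<tau> \<omega>} (\<lambda>s. f s \<omega> (Y s \<omega>))
                    - I \<omega>)"
  have "\<exists>I. ?P I" using sol assms unfolding bsde_solution_def by blast
  then have "?P (It t)" unfolding It_def by (rule someI_ex)
  then show "ito_integral M W (\<lambda>s \<omega>. indicator {min t (\<tau> \<omega>)<..\<tau> \<omega>} s *\<^sub>R Z s \<omega>) (It t)"
    and "AE \<omega> in M. set_integrable lborel {min t (\<tau> \<omega>)..\<tau> \<omega>} (\<lambda>s. f s \<omega> (Y s \<omega>)) \<and>
           Y t \<omega> = \<xi> \<omega> + set_lebesgue_integral lborel {min t (\<tau> \<omega>)..\<tau> \<omega>} (\<lambda>s. f s \<omega> (Y s \<omega>))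
                    - It t \<omega>" by auto
qed

lemma It_isometry:
  assumes t: "0 \<le> t"
  shows "It t \<in> borel_measurable M" "integrable M (\<lambda>\<omega>. (It t \<omega>)\<^sup>2)" "integrable M (It t)"
    and "A \<in> sets (F t) \<Longrightarrow> (\<integral>\<omega>. indicator A \<omega> * It t \<omega> \<partial>M) = 0"
    and "A \<in> sets (F t) \<Longrightarrow> (sqn A (It t))
      = (\<integral>\<^sup>+\<omega>\<in>A. (\<integral>\<^sup>+s\<in>{t<..}. ennreal (zeta \<omega> s) \<partial>lborel) \<partial>M)"
proof -
  let ?H = "\<lambda>s \<omega>. indicator {min t (\<tau> \<omega>)<..\<tau> \<omega>} s *\<^sub>R Z s \<omega>"
  have H0: "?H s \<omega> = 0" if "s \<le> t" for s \<omega> using that by (auto simp: indicator_def)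
  \<comment> \<open>The support lies in nonnegative times, so Z may be replaced by its jointly
    measurable version.\<close>
  have Hm: "(\<lambda>(\<omega>, s). ?H s \<omega>) \<in> borel_measurable (M \<Otimes>\<^sub>M lborel)"
  proof -
    have "(\<lambda>p. if min t (\<tau> (fst p)) < snd p \<and> snd p \<le> \<tau> (fst p) then (case p of (\<omega>, s) \<Rightarrow> if 0 \<le> s then Z s \<omega> else 0) else 0)
      \<in> borel_measurable (M \<Otimes>\<^sub>M lborel)" by measurable
    moreover have "(case p of (\<omega>, s) \<Rightarrow> ?H s \<omega>) = (if min t (\<tau> (fst p)) < snd p \<and> snd p \<le> \<tau> (fst p) then (case p of (\<omega>, s) \<Rightarrow> if 0 \<le> s then Z s \<omega> else 0) else 0)"
      if "p \<in> space (M \<Otimes>\<^sub>M lborel)" for p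
      using that tau_nonneg[of "fst p"] t by (auto simp: space_pair_measure indicator_def)
    ultimately show ?thesis by (subst measurable_cong) auto
  qed
  show m: "It t \<in> borel_measurable M" using It(1)[OF t] unfolding ito_integral_def by auto
  show i2: "integrable M (\<lambda>\<omega>. (It t \<omega>)\<^sup>2)" by (rule ito_isometry(1)[OF It(1)[OF t] t _ Hm]) (rule H0)
  show "integrable M (It t)" by (rule square_integrable_imp_integrable[OF m i2])
  show "A \<in> sets (F t) \<Longrightarrow> (\<integral>\<omega>. indicator A \<omega> * It t \<omega> \<partial>M) = 0" by (rule ito_isometry(2)[OF It(1)[OF t] t _ Hm]) (rule H0)
  assume A: "A \<in> sets (F t)"
  have iso3: "(sqn A (It t)) = (\<integral>\<^sup>+\<omega>\<in>A. (\<integral>\<^sup>+s. ennreal ((norm (?H s \<omega>))\<^sup>2) \<partial>lborel) \<partial>M)"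
    by (rule ito_isometry(3)[OF It(1)[OF t] t _ Hm A]) (rule H0)
  show "(sqn A (It t)) = (\<integral>\<^sup>+\<omega>\<in>A. (\<integral>\<^sup>+s\<in>{t<..}. ennreal (zeta \<omega> s) \<partial>lborel) \<partial>M)"
    unfolding iso3
  proof (intro nn_integral_cong arg_cong2[where f = "(*)"] refl)
    fix \<omega> s assume "\<omega> \<in> space M"
    then show "ennreal ((norm (?H s \<omega>))\<^sup>2) = ennreal (zeta \<omega> s) * indicator {t<..} s"
      using tau_nonneg[of \<omega>] t by (auto simp: indicator_def zeta_def)
  qed
qed

lemma Phi_integrable: "AE \<omega> in M. integrable lborel (Phi \<omega>)"
  using It(2)[OF order_refl] AE_space
proof eventually_elim
  case (elim \<omega>)
  then have "set_integrable lborel {0..\<tau> \<omega>} (\<lambda>s. f s \<omega> (Y s \<omega>))"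
    using tau_nonneg[of \<omega>] by (simp add: min_absorb1)
  then have "set_integrable lborel {0..<\<tau> \<omega>} (\<lambda>s. f s \<omega> (Y s \<omega>))"
    by (rule set_integrable_subset) auto
  moreover have "(\<lambda>s. indicator {0..<\<tau> \<omega>} s *\<^sub>R f s \<omega> (Y s \<omega>)) = Phi \<omega>"
    by (auto simp: Phi_def indicator_def fun_eq_iff)
  ultimately show ?case unfolding set_integrable_def by simp
qed

lemma Y_eq:
  assumes t: "0 \<le> t"
  shows "AE \<omega> in M. Y t \<omega> = \<xi> \<omega> + (\<integral>s. indicator {t..} s * Phi \<omega> s \<partial>lborel) - It t \<omega>"
  using It(2)[OF t] AE_space
proof eventually_elim
  case (elim \<omega>)
  note [measurable] = Phi_section[OF elim(2)]
  have "set_lebesgue_integral lborel {min t (\<tau> \<omega>)..\<tau> \<omega>} (\<lambda>s. f s \<omega> (Y s \<omega>)) = (\<integral>s. indicator {t..} s * Phi \<omega> s \<partial>lborel)"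
    unfolding set_lebesgue_integral_def
  proof (rule integral_cong_AE)
    show "(\<lambda>s. indicator {min t (\<tau> \<omega>)..\<tau> \<omega>} s *\<^sub>R f s \<omega> (Y s \<omega>)) \<in> borel_measurable lborel"
      using elim(1) unfolding set_integrable_def by (intro borel_measurable_integrable) auto
    show "(\<lambda>s. indicator {t..} s * Phi \<omega> s) \<in> borel_measurable lborel" by measurable
    \<comment> \<open>The two integrands can differ only at the point \<tau>.\<close>
    show "AE s in lborel. indicator {min t (\<tau> \<omega>)..\<tau> \<omega>} s *\<^sub>R f s \<omega> (Y s \<omega>) = indicator {t..} s * Phi \<omega> s"
      using AE_lborel_singleton[of "\<tau> \<omega>"]
      by eventually_elim (use t tau_nonneg[OF elim(2)] in \<open>auto simp: indicator_def Phi_def\<close>)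
  qed
  then show ?case using elim by simp
qed

lemma Y_increment:
  assumes ts: "0 \<le> t" "t \<le> s"
  shows "AE \<omega> in M. Y t \<omega> = Y s \<omega> + (\<integral>u. indicator {t..<s} u * Phi \<omega> u \<partial>lborel) - (It t \<omega> - It s \<omega>)"
proof -
  have s: "0 \<le> s" using ts by simp
  show ?thesis
    using Y_eq[OF ts(1)] Y_eq[OF s] Phi_integrable
  proof eventually_elim
    case (elim \<omega>)
    have i: "integrable lborel (\<lambda>u. indicator A u * Phi \<omega> u)" if "A \<in> sets borel" for A
      using integrable_mult_indicator[OF _ elim(3), of A] that by simp
    have "(\<integral>u. indicator {t..} u * Phi \<omega> u \<partial>lborel)
      = (\<integral>u. indicator {t..<s} u * Phi \<omega> u + indicator {s..} u * Phi \<omega> u \<partial>lborel)"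
      using ts by (intro Bochner_Integration.integral_cong refl) (auto simp: indicator_def)
    also have "\<dots> = (\<integral>u. indicator {t..<s} u * Phi \<omega> u \<partial>lborel) + (\<integral>u. indicator {s..} u * Phi \<omega> u \<partial>lborel)"
      by (intro Bochner_Integration.integral_add i) auto
    finally show ?case using elim by simp
  qed
qed

lemma Y_L2:
  assumes "0 \<le> t"
  shows "integrable M (\<lambda>\<omega>. (Y t \<omega>)^4)" "integrable M (\<lambda>\<omega>. (Y t \<omega>)\<^sup>2)" "integrable M (Y t)"
proof -
  have "(\<integral>\<^sup>+\<omega>. ennreal (\<bar>Y t \<omega>\<bar>^4) \<partial>M) \<le> (\<integral>\<^sup>+\<omega>. (SUP s\<in>{0..}. ennreal (\<bar>Y s \<omega>\<bar> ^ 4)) \<partial>M)"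
    using assms by (intro nn_integral_mono SUP_upper) auto
  also have "\<dots> < \<infinity>" using sol unfolding bsde_solution_def by auto
  finally show 4: "integrable M (\<lambda>\<omega>. (Y t \<omega>)^4)"
    using Y_M[OF assms] by (intro integrableI_bounded) (auto simp: power_abs)
  have "integrable M (\<lambda>\<omega>. ((Y t \<omega>)\<^sup>2)\<^sup>2)" using 4 by simp
  moreover have "(\<lambda>\<omega>. (Y t \<omega>)\<^sup>2) \<in> borel_measurable M" using Y_M[OF assms] by measurable
  ultimately show 2: "integrable M (\<lambda>\<omega>. (Y t \<omega>)\<^sup>2)"
    by (rule square_integrable_imp_integrable[rotated])
  show "integrable M (Y t)" by (rule square_integrable_imp_integrable[OF Y_M[OF assms] 2])
qed

text \<open>The difference is not given as an integral over the interval from t to s. By the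
  equation it equals an F s-measurable variable, hence is orthogonal to \<open>It s\<close>; by
  Pythagoras the energy beyond s can be subtracted from the energy beyond t.\<close>

lemma It_increment:
  assumes ts: "0 \<le> t" "t \<le> s" and A: "A \<in> sets (F t)"
  shows "(\<integral>\<^sup>+\<omega>\<in>A. ennreal ((It t \<omega> - It s \<omega>)\<^sup>2) \<partial>M)
      \<le> (\<integral>\<^sup>+\<omega>\<in>A. (\<integral>\<^sup>+u\<in>{t<..s}. ennreal (zeta \<omega> u) \<partial>lborel) \<partial>M)"
proof -
  have s: "0 \<le> s" using ts by simp
  note [measurable] = It_isometry(1)[OF ts(1)] It_isometry(1)[OF s]
  have AM[measurable]: "A \<in> sets M" by (rule sets_F_M[OF A])
  have As: "A \<in> sets (F s)" using A F_mono[OF ts(2)] by auto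
  \<comment> \<open>The difference of the two integrals as the equation expresses it, visibly F
    s-measurable.\<close>
  define X where "X = (\<lambda>\<omega>. Y s \<omega> + (\<integral>u. indicator {t..<s} u * Phi \<omega> u \<partial>lborel) - Y t \<omega>)"
  have sub: "{t..<s} \<subseteq> {0..s}" using ts by (intro subsetI) simp
  have XF: "X \<in> borel_measurable (F s)"
    unfolding X_def
    by (intro borel_measurable_diff borel_measurable_add Y_F[OF s] meas_F_mono[OF Y_F[OF ts(1)] ts(2)]
      progressive_integral[OF Phi_prog s _ sub]) simp
  have XM[measurable]: "X \<in> borel_measurable M" by (rule meas_F_M[OF XF])
  have AE: "AE \<omega> in M. It t \<omega> - It s \<omega> = X \<omega>"
    using Y_increment[OF ts] unfolding X_def by eventually_elim simp
  have J2: "integrable M (\<lambda>\<omega>. (It t \<omega> - It s \<omega>)\<^sup>2)"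
    by (rule square_integrable_diff) (use It_isometry(2) ts s in auto)
  have X2: "integrable M (\<lambda>\<omega>. (X \<omega>)\<^sup>2)"
  proof -
    have "AE \<omega> in M. (It t \<omega> - It s \<omega>)\<^sup>2 = (X \<omega>)\<^sup>2" using AE by eventually_elim simp
    then show ?thesis using integrable_cong_AE[of "\<lambda>\<omega>. (It t \<omega> - It s \<omega>)\<^sup>2" M "\<lambda>\<omega>. (X \<omega>)\<^sup>2"] J2 by auto
  qed
  have AX2: "integrable M (\<lambda>\<omega>. (indicator A \<omega> * X \<omega>)\<^sup>2)"
    by (rule square_integrable_indicator[OF AM X2])
  have AXI: "integrable M (\<lambda>\<omega>. (indicator A \<omega> * X \<omega>) * It s \<omega>)"
    by (rule square_prod_integrable) (use AX2 It_isometry(2)[OF s] in auto)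
  have cross: "(\<integral>\<omega>. (indicator A \<omega> * X \<omega>) * It s \<omega> \<partial>M) = 0"
    by (rule orthogonal[OF It_isometry(3)[OF s] It_isometry(4)[OF s]]) (use XF As AXI in auto)
  have AI: "integrable M (\<lambda>\<omega>. indicator A \<omega> * (It t \<omega>)\<^sup>2)" "integrable M (\<lambda>\<omega>. indicator A \<omega> * (It s \<omega>)\<^sup>2)"
    "integrable M (\<lambda>\<omega>. indicator A \<omega> * (X \<omega>)\<^sup>2)"
    using integrable_indicator_mult[OF AM] It_isometry(2) ts s X2 by auto
  have "(\<integral>\<omega>. indicator A \<omega> * (It t \<omega>)\<^sup>2 \<partial>M)
    = (\<integral>\<omega>. indicator A \<omega> * (X \<omega>)\<^sup>2 + 2 * ((indicator A \<omega> * X \<omega>) * It s \<omega>) + indicator A \<omega> * (It s \<omega>)\<^sup>2 \<partial>M)"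
  proof (rule integral_cong_AE)
    show "AE \<omega> in M. indicator A \<omega> * (It t \<omega>)\<^sup>2
      = indicator A \<omega> * (X \<omega>)\<^sup>2 + 2 * ((indicator A \<omega> * X \<omega>) * It s \<omega>) + indicator A \<omega> * (It s \<omega>)\<^sup>2"
      using AE
    proof eventually_elim
      case (elim \<omega>)
      have "It t \<omega> = X \<omega> + It s \<omega>" using elim by simp
      then show ?case by (simp add: power2_eq_square algebra_simps)
    qed
  qed measurable
  also have "\<dots> = (\<integral>\<omega>. indicator A \<omega> * (X \<omega>)\<^sup>2 \<partial>M) + (\<integral>\<omega>. indicator A \<omega> * (It s \<omega>)\<^sup>2 \<partial>M)"
    using AI AXI cross by simp
  finally have r: "(\<integral>\<omega>. indicator A \<omega> * (It t \<omega>)\<^sup>2 \<partial>M)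
     = (\<integral>\<omega>. indicator A \<omega> * (X \<omega>)\<^sup>2 \<partial>M) + (\<integral>\<omega>. indicator A \<omega> * (It s \<omega>)\<^sup>2 \<partial>M)" .
  have nn: "(sqn A V) = ennreal (\<integral>\<omega>. indicator A \<omega> * (V \<omega>)\<^sup>2 \<partial>M)"
    if "integrable M (\<lambda>\<omega>. indicator A \<omega> * (V \<omega>)\<^sup>2)" for V :: "'a \<Rightarrow> real"
    by (subst nn_integral_eq_integral[OF that, symmetric])
       (auto intro!: nn_integral_cong simp: indicator_def)
  have sum1: "(sqn A (It t)) = (sqn A X) + (sqn A (It s))"
    unfolding nn[OF AI(1)] nn[OF AI(2)] nn[OF AI(3)] r by (intro ennreal_plus integral_nonneg_AE) auto
  have sum2: "(sqn A (It t))
    = (\<integral>\<^sup>+\<omega>\<in>A. (\<integral>\<^sup>+u\<in>{t<..s}. ennreal (zeta \<omega> u) \<partial>lborel) \<partial>M) + (sqn A (It s))"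
  proof -
    have "(\<integral>\<^sup>+u\<in>{t<..}. ennreal (zeta \<omega> u) \<partial>lborel)
      = (\<integral>\<^sup>+u\<in>{t<..s}. ennreal (zeta \<omega> u) \<partial>lborel) + (\<integral>\<^sup>+u\<in>{s<..}. ennreal (zeta \<omega> u) \<partial>lborel)" if "\<omega> \<in> space M" for \<omega>
    proof -
      note [measurable] = zeta_section[OF that]
      show ?thesis using ts
        by (subst nn_integral_add[symmetric]) (auto intro!: nn_integral_cong simp: indicator_def)
    qed
    then have "(\<integral>\<^sup>+\<omega>\<in>A. (\<integral>\<^sup>+u\<in>{t<..}. ennreal (zeta \<omega> u) \<partial>lborel) \<partial>M)
      = (\<integral>\<^sup>+\<omega>. (\<integral>\<^sup>+u\<in>{t<..s}. ennreal (zeta \<omega> u) \<partial>lborel) * indicator A \<omega> + (\<integral>\<^sup>+u\<in>{s<..}. ennreal (zeta \<omega> u) \<partial>lborel) * indicator A \<omega> \<partial>M)"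
      by (intro nn_integral_cong) (simp add: distrib_right)
    also have "\<dots> = (\<integral>\<^sup>+\<omega>\<in>A. (\<integral>\<^sup>+u\<in>{t<..s}. ennreal (zeta \<omega> u) \<partial>lborel) \<partial>M) + (\<integral>\<^sup>+\<omega>\<in>A. (\<integral>\<^sup>+u\<in>{s<..}. ennreal (zeta \<omega> u) \<partial>lborel) \<partial>M)"
      by (rule nn_integral_add) measurable
    finally show ?thesis unfolding It_isometry(5)[OF ts(1) A] It_isometry(5)[OF s As] .
  qed
  \<comment> \<open>Cancellation in \<open>ennreal\<close> requires the common summand to be
    finite.\<close>
  have fin: "(sqn A (It s)) \<noteq> \<infinity>" unfolding nn[OF AI(2)] by simp
  have "(sqn A X) = (\<integral>\<^sup>+\<omega>\<in>A. (\<integral>\<^sup>+u\<in>{t<..s}. ennreal (zeta \<omega> u) \<partial>lborel) \<partial>M)"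
    using sum1 sum2 fin by simp
  moreover have "(\<integral>\<^sup>+\<omega>\<in>A. ennreal ((It t \<omega> - It s \<omega>)\<^sup>2) \<partial>M) = (sqn A X)"
    by (rule nn_integral_cong_AE) (use AE in \<open>eventually_elim, simp\<close>)
  ultimately show ?thesis by simp
qed

text \<open>The event {\<tau> \<le> t} belongs to F t, and on it the integrand vanishes after t. The
  localised isometry forces \<open>It t\<close> to vanish there, and so does the driver.\<close>

lemma Y_after:
  assumes t: "0 \<le> t"
  shows "AE \<omega> in M. \<tau> \<omega> \<le> t \<longrightarrow> Y t \<omega> = \<xi> \<omega>"
proof -
  define A where "A = {\<omega>\<in>space M. \<tau> \<omega> \<le> t}"
  have A: "A \<in> sets (F t)" unfolding A_def by (rule stopping_le[OF tau_stop order_refl])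
  have AM[measurable]: "A \<in> sets M" by (rule sets_F_M[OF A])
  note [measurable] = It_isometry(1)[OF t]
  have "(\<integral>\<^sup>+s\<in>{t<..}. ennreal (zeta \<omega> s) \<partial>lborel) * indicator A \<omega> = 0" for \<omega>
  proof (cases "\<omega> \<in> A")
    case True
    then have "(\<integral>\<^sup>+s\<in>{t<..}. ennreal (zeta \<omega> s) \<partial>lborel) = (\<integral>\<^sup>+s. 0 \<partial>(lborel :: real measure))"
      by (intro nn_integral_cong) (auto simp: A_def zeta_def indicator_def)
    then show ?thesis by simp
  qed simp
  note z = this
  have "(sqn A (It t)) = 0"
    unfolding It_isometry(5)[OF t A] z by simp
  then have "AE \<omega> in M. ennreal ((It t \<omega>)\<^sup>2) * indicator A \<omega> = 0"
    by (subst (asm) nn_integral_0_iff_AE) auto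
  with Y_eq[OF t] AE_space show ?thesis
  proof eventually_elim
    case (elim \<omega>)
    show ?case
    proof
      assume "\<tau> \<omega> \<le> t"
      then have "It t \<omega> = 0" using elim by (auto simp: A_def indicator_def ennreal_eq_0_iff)
      moreover have "(\<lambda>s. indicator {t..} s * Phi \<omega> s) = (\<lambda>_. 0)"
        using \<open>\<tau> \<omega> \<le> t\<close> by (auto simp: Phi_def indicator_def fun_eq_iff)
      ultimately show "Y t \<omega> = \<xi> \<omega>" using elim(1) by simp
    qed
  qed
qed

end

section \<open>The error of the scheme\<close>

text \<open>\<open>K\<close> dominates \<open>Y\<close> and \<open>f\<^sub>h(\<cdot>, 0)\<close> almost surely at each fixed time only; the
  exceptional set may depend on the time. \<open>T\<close>, \<open>B\<close> and \<open>g\<close> stand for \<open>\<tau>\<^sub>h\<close>, the discrete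
  terminal value and \<open>f\<^sub>h\<close>.\<close>

locale scheme = bsde M W \<tau> \<xi> f L Y Z
  for M :: "'a measure" and W :: "real \<Rightarrow> 'a \<Rightarrow> real^'d::finite"
    and \<tau> \<xi> :: "'a \<Rightarrow> real" and f :: "real \<Rightarrow> 'a \<Rightarrow> real \<Rightarrow> real" and L :: real
    and Y :: "real \<Rightarrow> 'a \<Rightarrow> real" and Z :: "real \<Rightarrow> 'a \<Rightarrow> real^'d" +
  fixes h :: real and T B :: "'a \<Rightarrow> real" and g :: "real \<Rightarrow> 'a \<Rightarrow> real \<Rightarrow> real"
    and K :: "'a \<Rightarrow> real" and R :: "real \<Rightarrow> 'a \<Rightarrow> real"
  assumes L_pos: "0 < L" and h_pos: "0 < h" and Lh: "L * h \<le> 1 / 12"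
    and T_stop: "stopping_time F T" and T_grid: "\<And>\<omega>. \<omega> \<in> space M \<Longrightarrow> T \<omega> \<in> grid h"
    and g_lip: "\<And>t \<omega> y y'. t \<in> grid h \<Longrightarrow> \<bar>g t \<omega> y - g t \<omega> y'\<bar> \<le> L * \<bar>y - y'\<bar>"
    and g_adapt: "\<And>t A. t \<in> grid h \<Longrightarrow> A \<in> borel_measurable (F t) \<Longrightarrow> (\<lambda>\<omega>. g t \<omega> (A \<omega>)) \<in> borel_measurable (F t)"
    and B_pre: "B \<in> borel_measurable (filtration.pre_sigma (space M) F T)"
    and B_L2: "integrable M (\<lambda>\<omega>. (B \<omega>)\<^sup>2)"
    and K_M: "K \<in> borel_measurable M" and K_nonneg: "\<And>\<omega>. 0 \<le> K \<omega>"
    and K_L2: "integrable M (\<lambda>\<omega>. (K \<omega>)\<^sup>2)"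
    and K_Y: "\<And>s. 0 \<le> s \<Longrightarrow> AE \<omega> in M. \<bar>Y s \<omega>\<bar> \<le> K \<omega>"
    and K_g: "\<And>t. t \<in> grid h \<Longrightarrow> AE \<omega> in M. t \<le> max (\<tau> \<omega>) (T \<omega>) \<longrightarrow> \<bar>g t \<omega> 0\<bar> \<le> K \<omega>"
    and R_space: "scheme_space M F L h T R"
    and R_fix: "\<And>t. t \<in> grid h \<Longrightarrow> AE \<omega> in M. R t \<omega> = scheme_op M F h T B g R t \<omega>"
begin

text \<open>By the Lipschitz property, \<open>g\<close> is bounded by K + L * K at arguments bounded
  by K wherever its value at 0 is.\<close>

definition \<kappa> :: "'a \<Rightarrow> real" where "\<kappa> \<omega> = (1 + L) * K \<omega>"

definition Yb :: "real \<Rightarrow> 'a \<Rightarrow> real" where "Yb t \<omega> = (if T \<omega> \<le> t then B \<omega> else R t \<omega>)"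

definition D :: "real \<Rightarrow> 'a \<Rightarrow> real" where "D t \<omega> = Y t \<omega> - Yb t \<omega>"

text \<open>The local error of one step: the exact driver integral minus the increment of the scheme
  with the exact value Y t inserted. From T on the scheme is frozen and the driver integral alone
  remains.\<close>

definition G :: "real \<Rightarrow> 'a \<Rightarrow> real" where
  "G t \<omega> = (\<integral>u. indicator {t..<t+h} u * Phi \<omega> u \<partial>lborel) - indicator {\<omega>. t < T \<omega>} \<omega> * (h * g t \<omega> (Y t \<omega>))"

lemma grid_nonneg: "t \<in> grid h \<Longrightarrow> 0 \<le> t"
  using h_pos by (auto simp: grid_def)

lemma grid_step: "t \<in> grid h \<Longrightarrow> t + h \<in> grid h"
proof -
  assume "t \<in> grid h"
  then obtain n :: nat where "t = real n * h" by (auto simp: grid_def)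
  then have "t + h = real (Suc n) * h" by (simp add: algebra_simps)
  then show ?thesis unfolding grid_def by blast
qed

lemma T_step: "\<omega> \<in> space M \<Longrightarrow> t \<in> grid h \<Longrightarrow> t < T \<omega> \<Longrightarrow> t + h \<le> T \<omega>"
proof -
  assume "\<omega> \<in> space M" "t \<in> grid h" "t < T \<omega>"
  then obtain m n :: nat where t: "t = real m * h" and T: "T \<omega> = real n * h"
    using T_grid[of \<omega>] by (auto simp: grid_def)
  then have "real m < real n" using \<open>t < T \<omega>\<close> h_pos by simp
  then have "real (Suc m) \<le> real n" by simp
  then have "real (Suc m) * h \<le> real n * h" using h_pos by (intro mult_right_mono) auto
  then show "t + h \<le> T \<omega>" using t T by (simp add: algebra_simps)
qed

lemma T_nonneg: "\<omega> \<in> space M \<Longrightarrow> 0 \<le> T \<omega>"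
  using T_grid grid_nonneg by blast

lemma T_M [measurable]: "T \<in> borel_measurable M" by (rule stopping_M[OF T_stop])

lemma K_M' [measurable]: "K \<in> borel_measurable M" by (rule K_M)

lemma kappa_M [measurable]: "\<kappa> \<in> borel_measurable M" unfolding \<kappa>_def[abs_def] by measurable

lemma kappa_nonneg: "0 \<le> \<kappa> \<omega>" unfolding \<kappa>_def using K_nonneg L_pos by simp

lemma R_F: "t \<in> grid h \<Longrightarrow> R t \<in> borel_measurable (F t)"
  and R_L2: "t \<in> grid h \<Longrightarrow> integrable M (\<lambda>\<omega>. (R t \<omega>)\<^sup>2)"
  using R_space unfolding scheme_space_def by auto

lemma B_preD: "S \<in> sets borel \<Longrightarrow> {\<omega>\<in>space M. B \<omega> \<in> S \<and> T \<omega> \<le> t} \<in> sets (F t)"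
proof -
  assume S: "S \<in> sets borel"
  interpret filt: filtration "space M" F by (rule filt)
  have "B -` S \<inter> space M \<in> sets (filt.pre_sigma T)"
    using measurable_sets[OF B_pre S] by (simp add: filt.space_pre_sigma)
  from filt.sets_pre_sigmaD[OF T_stop this, of t]
  show ?thesis by (rule back_subst[of "\<lambda>A. A \<in> sets (F t)"]) auto
qed

lemma B_M [measurable]: "B \<in> borel_measurable M"
  by (rule measurable_pre_sigma_M[OF T_stop B_pre])

lemma Yb_F: "t \<in> grid h \<Longrightarrow> Yb t \<in> borel_measurable (F t)"
proof (rule measurableI)
  fix S :: "real set" assume t: "t \<in> grid h" and S: "S \<in> sets borel"
  have "Yb t -` S \<inter> space (F t) = {\<omega>\<in>space M. B \<omega> \<in> S \<and> T \<omega> \<le> t} \<union> ({\<omega>\<in>space M. t < T \<omega>} \<inter> (R t -` S \<inter> space (F t)))"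
    by (auto simp: Yb_def not_le split: if_splits)
  also have "\<dots> \<in> sets (F t)"
    by (intro sets.Un sets.Int B_preD[OF S] stopping_gt[OF T_stop order_refl] measurable_sets[OF R_F[OF t] S])
  finally show "Yb t -` S \<inter> space (F t) \<in> sets (F t)" .
qed simp

lemma Yb_M: "t \<in> grid h \<Longrightarrow> Yb t \<in> borel_measurable M"
  by (rule meas_F_M[OF Yb_F])

lemma Yb_L2: assumes t: "t \<in> grid h" shows "integrable M (\<lambda>\<omega>. (Yb t \<omega>)\<^sup>2)"
proof (rule Bochner_Integration.integrable_bound)
  show "integrable M (\<lambda>\<omega>. (B \<omega>)\<^sup>2 + (R t \<omega>)\<^sup>2)" using B_L2 R_L2[OF t] by auto
  show "(\<lambda>\<omega>. (Yb t \<omega>)\<^sup>2) \<in> borel_measurable M" using Yb_M[OF t] by measurable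
qed (auto simp: Yb_def)

lemma D_F: "t \<in> grid h \<Longrightarrow> D t \<in> borel_measurable (F t)"
  unfolding D_def[abs_def] using Y_F[OF grid_nonneg] Yb_F by (intro borel_measurable_diff) auto

lemma D_M: "t \<in> grid h \<Longrightarrow> D t \<in> borel_measurable M"
  by (rule meas_F_M[OF D_F])

lemma D_L2: "t \<in> grid h \<Longrightarrow> integrable M (\<lambda>\<omega>. (D t \<omega>)\<^sup>2)"
  unfolding D_def using Y_M[OF grid_nonneg] Yb_M Y_L2(2)[OF grid_nonneg] Yb_L2
  by (intro square_integrable_diff) auto

section \<open>One step in conditional mean and the resulting L2 contraction\<close>

lemma g_bound:
  assumes t: "t \<in> grid h"
  shows "AE \<omega> in M. t \<le> max (\<tau> \<omega>) (T \<omega>) \<longrightarrow> (\<forall>y. \<bar>g t \<omega> y\<bar> \<le> K \<omega> + L * \<bar>y\<bar>)"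
  using K_g[OF t]
proof eventually_elim
  case (elim \<omega>)
  have "\<bar>g t \<omega> y\<bar> \<le> \<bar>g t \<omega> 0\<bar> + L * \<bar>y\<bar>" for y
    using g_lip[OF t, of \<omega> y 0] by simp
  then show ?case using elim by (meson add_right_mono order_trans)
qed

lemma g_L2:
  assumes t: "t \<in> grid h" and X: "X \<in> borel_measurable (F t)" "integrable M (\<lambda>\<omega>. (X \<omega>)\<^sup>2)"
  shows "(\<lambda>\<omega>. indicator {\<omega>. t < T \<omega>} \<omega> * (h * g t \<omega> (X \<omega>))) \<in> borel_measurable (F t)"
    and "integrable M (\<lambda>\<omega>. (indicator {\<omega>. t < T \<omega>} \<omega> * (h * g t \<omega> (X \<omega>)))\<^sup>2)"
proof -
  have U: "{\<omega>\<in>space M. t < T \<omega>} \<in> sets (F t)" by (rule stopping_gt[OF T_stop order_refl])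
  have "(\<lambda>\<omega>. indicator {\<omega>\<in>space M. t < T \<omega>} \<omega> * (h * g t \<omega> (X \<omega>))) \<in> borel_measurable (F t)"
    using U g_adapt[OF t X(1)] by measurable
  moreover have "indicator {\<omega>\<in>space M. t < T \<omega>} \<omega> * (h * g t \<omega> (X \<omega>)) = indicator {\<omega>. t < T \<omega>} \<omega> * (h * g t \<omega> (X \<omega>))"
    if "\<omega> \<in> space (F t)" for \<omega> using that by (auto simp: indicator_def)
  ultimately show m: "(\<lambda>\<omega>. indicator {\<omega>. t < T \<omega>} \<omega> * (h * g t \<omega> (X \<omega>))) \<in> borel_measurable (F t)"
    by (subst measurable_cong[symmetric]) auto
  show "integrable M (\<lambda>\<omega>. (indicator {\<omega>. t < T \<omega>} \<omega> * (h * g t \<omega> (X \<omega>)))\<^sup>2)"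
  proof (rule Bochner_Integration.integrable_bound)
    have [measurable]: "X \<in> borel_measurable M" by (rule meas_F_M[OF X(1)])
    have "integrable M (\<lambda>\<omega>. (K \<omega> + L * X \<omega>)\<^sup>2 + (K \<omega> - L * X \<omega>)\<^sup>2)"
      using X K_L2 by (intro Bochner_Integration.integrable_add square_integrable_add square_integrable_diff)
        (auto simp: power_mult_distrib)
    then show "integrable M (\<lambda>\<omega>. h\<^sup>2 * ((K \<omega> + L * X \<omega>)\<^sup>2 + (K \<omega> - L * X \<omega>)\<^sup>2))" by simp
    show "(\<lambda>\<omega>. (indicator {\<omega>. t < T \<omega>} \<omega> * (h * g t \<omega> (X \<omega>)))\<^sup>2) \<in> borel_measurable M"
      using meas_F_M[OF m] by measurable
    show "AE \<omega> in M. norm ((indicator {\<omega>. t < T \<omega>} \<omega> * (h * g t \<omega> (X \<omega>)))\<^sup>2)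
       \<le> norm (h\<^sup>2 * ((K \<omega> + L * X \<omega>)\<^sup>2 + (K \<omega> - L * X \<omega>)\<^sup>2))"
      using g_bound[OF t]
    proof eventually_elim
      case (elim \<omega>)
      show ?case
      proof (cases "t < T \<omega>")
        case True
        have "\<bar>g t \<omega> (X \<omega>)\<bar> \<le> K \<omega> + L * \<bar>X \<omega>\<bar>" using elim True by auto
        then have "(g t \<omega> (X \<omega>))\<^sup>2 \<le> (K \<omega> + L * \<bar>X \<omega>\<bar>)\<^sup>2" by (intro power2_le_iff_abs_le[THEN iffD2]) auto
        \<comment> \<open>According to the sign of X one of the two squares is the required one;
          keeping both avoids an absolute value in the majorant.\<close>
        also have "\<dots> \<le> (K \<omega> + L * X \<omega>)\<^sup>2 + (K \<omega> - L * X \<omega>)\<^sup>2" by (cases "0 \<le> X \<omega>") auto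
        finally have "h\<^sup>2 * (g t \<omega> (X \<omega>))\<^sup>2 \<le> h\<^sup>2 * ((K \<omega> + L * X \<omega>)\<^sup>2 + (K \<omega> - L * X \<omega>)\<^sup>2)"
          by (intro mult_left_mono) auto
        then show ?thesis using True by (simp add: power_mult_distrib)
      qed simp
    qed
  qed
qed

lemma R_at_T: "t \<in> grid h \<Longrightarrow> AE \<omega> in M. t = T \<omega> \<longrightarrow> R t \<omega> = B \<omega>"
  using R_fix[of t] by (auto simp: scheme_op_def elim: eventually_mono)

lemma Yb_mean:
  assumes t: "t \<in> grid h" and A: "A \<in> sets (F t)"
  shows "(\<integral>\<omega>. indicator A \<omega> * (Yb t \<omega> - indicator {\<omega>. t < T \<omega>} \<omega> * (h * g t \<omega> (Yb t \<omega>))) \<partial>M)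
    = (\<integral>\<omega>. indicator A \<omega> * Yb (t + h) \<omega> \<partial>M)"
proof -
  interpret S: sigma_finite_subalgebra M "F t" by (rule sigma_finite_subalg)
  have t': "t + h \<in> grid h" by (rule grid_step[OF t])
  define AU where "AU = A \<inter> {\<omega>\<in>space M. t < T \<omega>}"
  define AV where "AV = A \<inter> {\<omega>\<in>space M. T \<omega> \<le> t}"
  have AU: "AU \<in> sets (F t)" unfolding AU_def by (intro sets.Int A stopping_gt[OF T_stop order_refl])
  have AV: "AV \<in> sets (F t)" unfolding AV_def by (intro sets.Int A stopping_le[OF T_stop order_refl])
  note [measurable] = sets_F_M[OF A] sets_F_M[OF AU] sets_F_M[OF AV] Yb_M[OF t] Yb_M[OF t'] meas_F_M[OF R_F[OF t']]
    meas_F_M[OF g_L2(1)[OF t Yb_F[OF t] Yb_L2[OF t]]]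
  have iR: "integrable M (R (t + h))" by (rule square_integrable_imp_integrable[OF meas_F_M[OF R_F[OF t']] R_L2[OF t']])
  have iB: "integrable M B" by (rule square_integrable_imp_integrable[OF B_M B_L2])
  have iAR: "integrable M (\<lambda>\<omega>. indicator AU \<omega> * R (t + h) \<omega>)"
    by (rule integrable_indicator_mult[OF _ iR]) measurable
  have iAB: "integrable M (\<lambda>\<omega>. indicator AV \<omega> * B \<omega>)"
    by (rule integrable_indicator_mult[OF _ iB]) measurable
  have c: "integrable M (\<lambda>\<omega>. indicator AU \<omega> * real_cond_exp M (F t) (R (t + h)) \<omega>)"
    "(\<integral>\<omega>. indicator AU \<omega> * real_cond_exp M (F t) (R (t + h)) \<omega> \<partial>M) = (\<integral>\<omega>. indicator AU \<omega> * R (t + h) \<omega> \<partial>M)"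
    using S.real_cond_exp_intg[OF iAR] AU by auto
  have "(\<integral>\<omega>. indicator A \<omega> * (Yb t \<omega> - indicator {\<omega>. t < T \<omega>} \<omega> * (h * g t \<omega> (Yb t \<omega>))) \<partial>M)
    = (\<integral>\<omega>. indicator AU \<omega> * real_cond_exp M (F t) (R (t + h)) \<omega> + indicator AV \<omega> * B \<omega> \<partial>M)"
  proof (rule integral_cong_AE)
    show "AE \<omega> in M. indicator A \<omega> * (Yb t \<omega> - indicator {\<omega>. t < T \<omega>} \<omega> * (h * g t \<omega> (Yb t \<omega>)))
      = indicator AU \<omega> * real_cond_exp M (F t) (R (t + h)) \<omega> + indicator AV \<omega> * B \<omega>"
      using R_fix[OF t] AE_space
    proof eventually_elim
      case (elim \<omega>)
      then show ?case by (auto simp: AU_def AV_def Yb_def scheme_op_def indicator_def)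
    qed
  qed measurable
  also have "\<dots> = (\<integral>\<omega>. indicator AU \<omega> * R (t + h) \<omega> \<partial>M) + (\<integral>\<omega>. indicator AV \<omega> * B \<omega> \<partial>M)"
    using c iAB by simp
  also have "\<dots> = (\<integral>\<omega>. indicator AU \<omega> * R (t + h) \<omega> + indicator AV \<omega> * B \<omega> \<partial>M)"
    using iAR iAB by simp
  also have "\<dots> = (\<integral>\<omega>. indicator A \<omega> * Yb (t + h) \<omega> \<partial>M)"
  proof (rule integral_cong_AE)
    show "AE \<omega> in M. indicator AU \<omega> * R (t + h) \<omega> + indicator AV \<omega> * B \<omega> = indicator A \<omega> * Yb (t + h) \<omega>"
      using R_at_T[OF t'] AE_space
    proof eventually_elim
      case (elim \<omega>)
      \<comment> \<open>After one step the path is either still before T or exactly at T, where the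
        fixed-point equation gives R = B; so Yb may replace R at t + h.\<close>
      have "t < T \<omega> \<Longrightarrow> T \<omega> = t + h \<or> t + h < T \<omega>" using T_step[OF elim(2) t] by auto
      then show ?case using elim h_pos by (auto simp: AU_def AV_def Yb_def indicator_def)
    qed
  qed measurable
  finally show ?thesis .
qed

lemma Phi_int_M: "0 \<le> t \<Longrightarrow> t \<le> s \<Longrightarrow> (\<lambda>\<omega>. \<integral>u. indicator {t..<s} u * Phi \<omega> u \<partial>lborel) \<in> borel_measurable M"
  by (rule meas_F_M[of _ s], rule progressive_integral[OF Phi_prog]) auto

lemma Phi_int_L2:
  assumes t: "0 \<le> t" "t \<le> s"
  shows "integrable M (\<lambda>\<omega>. (\<integral>u. indicator {t..<s} u * Phi \<omega> u \<partial>lborel)\<^sup>2)"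
proof -
  have s: "0 \<le> s" using t by simp
  note [measurable] = Y_M[OF t(1)] Y_M[OF s] It_isometry(1)[OF t(1)] It_isometry(1)[OF s] Phi_int_M[OF t]
  have "integrable M (\<lambda>\<omega>. ((Y t \<omega> - Y s \<omega>) + (It t \<omega> - It s \<omega>))\<^sup>2)"
    by (intro square_integrable_add square_integrable_diff) (use Y_L2(2) It_isometry(2) t s in auto)
  moreover have "AE \<omega> in M. ((Y t \<omega> - Y s \<omega>) + (It t \<omega> - It s \<omega>))\<^sup>2 = (\<integral>u. indicator {t..<s} u * Phi \<omega> u \<partial>lborel)\<^sup>2"
    using Y_increment[OF t] by eventually_elim simp
  ultimately show ?thesis
    using integrable_cong_AE[of "\<lambda>\<omega>. ((Y t \<omega> - Y s \<omega>) + (It t \<omega> - It s \<omega>))\<^sup>2" M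
      "\<lambda>\<omega>. (\<integral>u. indicator {t..<s} u * Phi \<omega> u \<partial>lborel)\<^sup>2"] by auto
qed

text \<open>Both stochastic integrals are centred on A, the one from s because A also belongs to F
  s.\<close>

lemma Y_mean:
  assumes t: "0 \<le> t" "t \<le> s" and A: "A \<in> sets (F t)"
  shows "(\<integral>\<omega>. indicator A \<omega> * Y t \<omega> \<partial>M)
    = (\<integral>\<omega>. indicator A \<omega> * (Y s \<omega> + (\<integral>u. indicator {t..<s} u * Phi \<omega> u \<partial>lborel)) \<partial>M)"
proof -
  have s: "0 \<le> s" using t by simp
  have As: "A \<in> sets (F s)" using A F_mono[OF t(2)] by auto
  note [measurable] = Y_M[OF t(1)] Y_M[OF s] It_isometry(1)[OF t(1)] It_isometry(1)[OF s] Phi_int_M[OF t] sets_F_M[OF A]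
  have i: "integrable M (\<lambda>\<omega>. indicator A \<omega> * Y t \<omega>)" "integrable M (\<lambda>\<omega>. indicator A \<omega> * It t \<omega>)"
    "integrable M (\<lambda>\<omega>. indicator A \<omega> * It s \<omega>)"
    using integrable_indicator_mult[OF sets_F_M[OF A]] Y_L2(3)[OF t(1)] It_isometry(3)[OF t(1)] It_isometry(3)[OF s] by auto
  have "(\<integral>\<omega>. indicator A \<omega> * (Y s \<omega> + (\<integral>u. indicator {t..<s} u * Phi \<omega> u \<partial>lborel)) \<partial>M)
    = (\<integral>\<omega>. indicator A \<omega> * Y t \<omega> + (indicator A \<omega> * It t \<omega> - indicator A \<omega> * It s \<omega>) \<partial>M)"
  proof (rule integral_cong_AE)
    show "AE \<omega> in M. indicator A \<omega> * (Y s \<omega> + (\<integral>u. indicator {t..<s} u * Phi \<omega> u \<partial>lborel))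
       = indicator A \<omega> * Y t \<omega> + (indicator A \<omega> * It t \<omega> - indicator A \<omega> * It s \<omega>)"
      using Y_increment[OF t] by eventually_elim (simp split: split_indicator)
  qed measurable
  also have "\<dots> = (\<integral>\<omega>. indicator A \<omega> * Y t \<omega> \<partial>M)"
    using i It_isometry(4)[OF t(1) A] It_isometry(4)[OF s As] by simp
  finally show ?thesis by simp
qed

text \<open>Subtracting the mean identities of Y and Yb shows that the variable on the left is the
  conditional expectation of \<open>D (t + h) + G t\<close>. The event A lets steps before and after
  T be estimated with different constants.\<close>

lemma contraction:
  assumes t: "t \<in> grid h" and A: "A \<in> sets (F t)"
  shows "(\<integral>\<^sup>+\<omega>\<in>A. ennreal ((D t \<omega> - indicator {\<omega>. t < T \<omega>} \<omega> * (h * (g t \<omega> (Y t \<omega>) - g t \<omega> (Yb t \<omega>))))\<^sup>2) \<partial>M)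
    \<le> (\<integral>\<^sup>+\<omega>\<in>A. ennreal ((D (t + h) \<omega> + G t \<omega>)\<^sup>2) \<partial>M)"
proof -
  let ?u = "indicator {\<omega>. t < T \<omega>} :: 'a \<Rightarrow> real"
  have t0: "0 \<le> t" "t \<le> t + h" "0 \<le> t + h" and t': "t + h \<in> grid h"
    using grid_nonneg[OF t] h_pos grid_step[OF t] by auto
  have AM[measurable]: "A \<in> sets M" by (rule sets_F_M[OF A])
  note gY = g_L2[OF t Y_F[OF t0(1)] Y_L2(2)[OF t0(1)]]
  note gYb = g_L2[OF t Yb_F[OF t] Yb_L2[OF t]]
  note [measurable] = meas_F_M[OF gY(1)] meas_F_M[OF gYb(1)] D_M[OF t] D_M[OF t'] Phi_int_M[OF t0(1,2)]
    Y_M[OF t0(1)] Y_M[OF t0(3)] Yb_M[OF t] Yb_M[OF t']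
  define p where "p = (\<lambda>\<omega>. (D t \<omega> - ?u \<omega> * (h * g t \<omega> (Y t \<omega>))) + ?u \<omega> * (h * g t \<omega> (Yb t \<omega>)))"
  define x where "x = (\<lambda>\<omega>. D (t + h) \<omega> + G t \<omega>)"
  have pF: "p \<in> borel_measurable (F t)"
    unfolding p_def by (intro borel_measurable_add borel_measurable_diff D_F[OF t] gY(1) gYb(1))
  have pM[measurable]: "p \<in> borel_measurable M" by (rule meas_F_M[OF pF])
  have GM[measurable]: "G t \<in> borel_measurable M" unfolding G_def[abs_def] by measurable
  have p2: "integrable M (\<lambda>\<omega>. (p \<omega>)\<^sup>2)"
    unfolding p_def by (intro square_integrable_add square_integrable_diff D_L2[OF t] gY(2) gYb(2)) measurable
  have G2: "integrable M (\<lambda>\<omega>. (G t \<omega>)\<^sup>2)"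
    unfolding G_def by (intro square_integrable_diff gY(2) Phi_int_L2[OF t0(1,2)]) measurable
  have xM[measurable]: "x \<in> borel_measurable M" unfolding x_def by measurable
  have x2: "integrable M (\<lambda>\<omega>. (x \<omega>)\<^sup>2)"
    unfolding x_def by (intro square_integrable_add D_L2[OF t'] G2) measurable
  have eq: "(\<integral>\<omega>. indicator C \<omega> * p \<omega> \<partial>M) = (\<integral>\<omega>. indicator C \<omega> * x \<omega> \<partial>M)" if C: "C \<in> sets (F t)" for C
  proof -
    have CM: "C \<in> sets M" by (rule sets_F_M[OF C])
    have iY: "integrable M (\<lambda>\<omega>. indicator C \<omega> * Y t \<omega>)"
      by (rule integrable_indicator_mult[OF CM Y_L2(3)[OF t0(1)]])
    have iYg: "integrable M (\<lambda>\<omega>. indicator C \<omega> * (?u \<omega> * (h * g t \<omega> (Y t \<omega>))))"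
      by (rule integrable_indicator_mult[OF CM], rule square_integrable_imp_integrable[OF _ gY(2)]) measurable
    have iYb: "integrable M (\<lambda>\<omega>. indicator C \<omega> * (Yb t \<omega> - ?u \<omega> * (h * g t \<omega> (Yb t \<omega>))))"
      by (rule integrable_indicator_mult[OF CM], rule square_integrable_imp_integrable,
          measurable, rule square_integrable_diff[OF _ _ Yb_L2[OF t] gYb(2)]) measurable
    have iY': "integrable M (\<lambda>\<omega>. indicator C \<omega> * (Y (t + h) \<omega> + (\<integral>u. indicator {t..<t+h} u * Phi \<omega> u \<partial>lborel)))"
      by (rule integrable_indicator_mult[OF CM], rule square_integrable_imp_integrable,
          measurable, rule square_integrable_add[OF _ _ Y_L2(2)[OF t0(3)] Phi_int_L2[OF t0(1,2)]]) measurable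
    have iYb': "integrable M (\<lambda>\<omega>. indicator C \<omega> * Yb (t + h) \<omega>)"
      by (rule integrable_indicator_mult[OF CM], rule square_integrable_imp_integrable[OF _ Yb_L2[OF t']]) measurable
    have "(\<integral>\<omega>. indicator C \<omega> * p \<omega> \<partial>M) = (\<integral>\<omega>. indicator C \<omega> * Y t \<omega>
        - indicator C \<omega> * (Yb t \<omega> - ?u \<omega> * (h * g t \<omega> (Yb t \<omega>))) - indicator C \<omega> * (?u \<omega> * (h * g t \<omega> (Y t \<omega>))) \<partial>M)"
      unfolding p_def D_def by (intro Bochner_Integration.integral_cong refl) (simp add: algebra_simps)
    also have "\<dots> = (\<integral>\<omega>. indicator C \<omega> * (Y (t + h) \<omega> + (\<integral>u. indicator {t..<t+h} u * Phi \<omega> u \<partial>lborel)) \<partial>M)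
       - (\<integral>\<omega>. indicator C \<omega> * Yb (t + h) \<omega> \<partial>M) - (\<integral>\<omega>. indicator C \<omega> * (?u \<omega> * (h * g t \<omega> (Y t \<omega>))) \<partial>M)"
      using iY iYb iYg Yb_mean[OF t C] Y_mean[OF t0(1,2) C] by simp
    also have "\<dots> = (\<integral>\<omega>. indicator C \<omega> * (Y (t + h) \<omega> + (\<integral>u. indicator {t..<t+h} u * Phi \<omega> u \<partial>lborel))
       - indicator C \<omega> * Yb (t + h) \<omega> - indicator C \<omega> * (?u \<omega> * (h * g t \<omega> (Y t \<omega>))) \<partial>M)"
      using iY' iYb' iYg by simp
    also have "\<dots> = (\<integral>\<omega>. indicator C \<omega> * x \<omega> \<partial>M)"
      unfolding x_def D_def G_def by (intro Bochner_Integration.integral_cong refl) (simp add: algebra_simps)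
    finally show ?thesis .
  qed
  have "(\<integral>\<^sup>+\<omega>. ennreal ((indicator A \<omega> * p \<omega>)\<^sup>2) \<partial>M) \<le> (\<integral>\<^sup>+\<omega>. ennreal ((indicator A \<omega> * x \<omega>)\<^sup>2) \<partial>M)"
  proof (rule L2_contraction)
    show "(\<lambda>\<omega>. indicator A \<omega> * p \<omega>) \<in> borel_measurable (F t)" using A pF by measurable
    show "(\<integral>\<omega>. indicator C \<omega> * (indicator A \<omega> * p \<omega>) \<partial>M) = (\<integral>\<omega>. indicator C \<omega> * (indicator A \<omega> * x \<omega>) \<partial>M)"
      if C: "C \<in> sets (F t)" for C
      using eq[OF sets.Int[OF C A]] by (simp add: indicator_inter_arith mult.assoc)
  qed (use square_integrable_indicator[OF AM] p2 x2 in auto)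
  moreover have "(\<integral>\<^sup>+\<omega>. ennreal ((indicator A \<omega> * p \<omega>)\<^sup>2) \<partial>M)
    = (\<integral>\<^sup>+\<omega>\<in>A. ennreal ((D t \<omega> - ?u \<omega> * (h * (g t \<omega> (Y t \<omega>) - g t \<omega> (Yb t \<omega>))))\<^sup>2) \<partial>M)"
    unfolding p_def by (intro nn_integral_cong) (auto simp: algebra_simps split: split_indicator)
  moreover have "(\<integral>\<^sup>+\<omega>. ennreal ((indicator A \<omega> * x \<omega>)\<^sup>2) \<partial>M) = (\<integral>\<^sup>+\<omega>\<in>A. ennreal ((x \<omega>)\<^sup>2) \<partial>M)"
    by (intro nn_integral_cong) (auto split: split_indicator)
  ultimately show ?thesis unfolding x_def by simp
qed

lemma G_M: assumes t: "t \<in> grid h" shows "G t \<in> borel_measurable M"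
proof -
  have t0: "0 \<le> t" "t \<le> t + h" using grid_nonneg[OF t] h_pos by auto
  note [measurable] = meas_F_M[OF g_L2(1)[OF t Y_F[OF t0(1)] Y_L2(2)[OF t0(1)]]] Phi_int_M[OF t0]
  show ?thesis unfolding G_def[abs_def] by measurable
qed

end

section \<open>Elementary inequalities for the constants of a step\<close>

lemma exp_times_square_ge:
  fixes x :: real
  assumes "0 < x" "x \<le> 1 / 12"
  shows "1 + 9 / 10 * x \<le> exp (3 * x) * (1 - x)\<^sup>2"
proof -
  have x2: "x\<^sup>2 \<le> x / 12" using assms by (simp add: power2_eq_square)
  have x3: "x ^ 3 \<le> x / 144"
  proof -
    have "x ^ 3 = x * x\<^sup>2" by (simp add: power3_eq_cube power2_eq_square)
    also have "\<dots> \<le> (1 / 12) * (x / 12)" using assms x2 by (intro mult_mono) auto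
    finally show ?thesis by simp
  qed
  \<comment> \<open>For x \<le> 1/12 the quadratic and the cubic loss are at most x / 24 each, so
    more than 9/10 of the linear gain x survives.\<close>
  have "(1 + 3 * x + 9 / 2 * x\<^sup>2) * (1 - x)\<^sup>2 = 1 + x - x\<^sup>2 / 2 - 6 * x ^ 3 + 9 / 2 * x ^ 4"
    by (simp add: power2_eq_square power3_eq_cube power4_eq_xxxx field_simps)
  moreover have "0 \<le> x ^ 4" by simp
  ultimately have "1 + 9 / 10 * x \<le> (1 + 3 * x + 9 / 2 * x\<^sup>2) * (1 - x)\<^sup>2" using x2 x3 assms by linarith
  also have "\<dots> \<le> exp (3 * x) * (1 - x)\<^sup>2"
    using exp_lower_Taylor_quadratic[of "3 * x"] assms by (intro mult_right_mono) (auto simp: power2_eq_square)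
  finally show ?thesis .
qed

lemma exp_le_four_thirds:
  fixes x :: real
  assumes "0 \<le> x" "x \<le> 1 / 12"
  shows "exp (3 * x) \<le> 4 / 3"
proof -
  have "exp (3 * x) \<le> exp (1 / 4 :: real)" using assms by simp
  also have "\<dots> \<le> 1 + 1 / 4 + (1 / 4)\<^sup>2" by (rule exp_bound) auto
  finally show ?thesis by (simp add: power2_eq_square)
qed

lemma real_sq_add_le: "(0::real) < \<delta> \<Longrightarrow> (x + y)\<^sup>2 \<le> (1 + \<delta>) * x\<^sup>2 + (1 + 1 / \<delta>) * y\<^sup>2"
  using norm_sq_add_le[of \<delta> x y] by simp

lemma ennreal_distrib_mult:
  assumes "0 \<le> a" "0 \<le> b" "0 \<le> c" "0 \<le> d"
  shows "ennreal a * (ennreal b * z + ennreal c * ennreal d) = ennreal (a * b) * z + ennreal (a * (c * d))"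
  using assms by (simp add: distrib_left ennreal_mult mult.assoc)

section \<open>The local error and its majorant \<open>Q\<close>\<close>

context scheme
begin

definition dF :: "'a \<Rightarrow> real \<Rightarrow> real" where
  "dF \<omega> s = (if 0 \<le> s \<and> s < \<tau> \<omega> then f s \<omega> (Y s \<omega>) - g (phi h s) \<omega> (Y s \<omega>) else 0)"

text \<open>With \<open>x = L h\<close>, Young's inequality costs a factor \<open>1 / \<epsilon> \<le> 10 / (9 x)\<close>. The coefficient of the
  squared driver error then becomes \<open>(10 / 9) (6 / 5 + (75 / 8) x\<^sup>2) / L\<close>, which is below \<open>3 / (2 L)\<close>
  because \<open>x \<le> 1 / 12\<close>; the constant \<open>50\<close> is not sharp.\<close>

definition Q :: "'a \<Rightarrow> real \<Rightarrow> ennreal" where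
  "Q \<omega> s = ennreal (3 / (2 * L)) * ennreal ((dF \<omega> s)\<^sup>2)
    + ennreal (10 / (9 * L) * (\<kappa> \<omega>)\<^sup>2) * indicator {min (\<tau> \<omega>) (T \<omega>)..<max (\<tau> \<omega>) (T \<omega>)} s
    + ennreal (50 * L * h) * (ennreal (h * (\<kappa> \<omega>)\<^sup>2) * indicator {0..<T \<omega>} s + ennreal (zeta \<omega> s))"

abbreviation Qi :: "real \<Rightarrow> 'a \<Rightarrow> ennreal" where
  "Qi t \<omega> \<equiv> \<integral>\<^sup>+s\<in>{t..<t+h}. Q \<omega> s \<partial>lborel"

lemma phi_grid: assumes "t \<in> grid h" "s \<in> {t..<t+h}" shows "phi h s = t"
proof -
  obtain n :: nat where n: "t = real n * h" using assms by (auto simp: grid_def)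
  have "real n \<le> s / h" "s / h < real n + 1"
    using assms(2) n h_pos by (auto simp: field_simps)
  then have "\<lfloor>s / h\<rfloor> = int n" by (intro floor_unique) auto
  then show ?thesis using n by (simp add: phi_def mult.commute)
qed

lemma phi_nonneg_grid: assumes "0 \<le> s" shows "phi h s = real (nat \<lfloor>s / h\<rfloor>) * h" "phi h s \<in> grid h"
proof -
  have "0 \<le> \<lfloor>s / h\<rfloor>" using assms h_pos by simp
  then show "phi h s = real (nat \<lfloor>s / h\<rfloor>) * h" by (simp add: phi_def)
  then show "phi h s \<in> grid h" unfolding grid_def by blast
qed

text \<open>The discrete driver is only known to be measurable at each grid time. Since
  \<open>phi\<close> takes countably many values on nonnegative times, the pieces can be glued, and
  the Lipschitz property takes care of the argument Y.\<close>

lemma dF_joint [measurable]: "(\<lambda>(\<omega>, s). dF \<omega> s) \<in> borel_measurable (M \<Otimes>\<^sub>M lborel)"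
proof -
  let ?N = "M \<Otimes>\<^sub>M (lborel :: real measure)"
  have 1: "(\<lambda>p. g (real n * h) (fst p) (Y0 (fst p) (snd p))) \<in> borel_measurable ?N" for n :: nat
  proof -
    have n: "real n * h \<in> grid h" unfolding grid_def by (rule rangeI)
    show ?thesis
    proof (rule measurable_lipschitz_compose[where L = L and \<phi> = "\<lambda>p. g (real n * h) (fst p)"])
      show "(\<lambda>p. g (real n * h) (fst p) y) \<in> borel_measurable ?N" for y
        by (rule measurable_compose[OF measurable_fst meas_F_M[OF g_adapt[OF n]]]) simp
      show "(\<lambda>p. Y0 (fst p) (snd p)) \<in> borel_measurable ?N" using Y0_joint by (simp add: split_beta')
    qed (rule g_lip[OF n])
  qed
  have 2: "(\<lambda>p. g (real (nat \<lfloor>snd p / h\<rfloor>) * h) (fst p) (Y0 (fst p) (snd p))) \<in> borel_measurable ?N"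
    by (rule measurable_compose_countable[OF 1]) measurable
  have 3: "(\<lambda>p. Phi (fst p) (snd p)) \<in> borel_measurable ?N" using Phi_joint by (simp add: split_beta')
  have "(\<lambda>p. Phi (fst p) (snd p) - (if 0 \<le> snd p \<and> snd p < \<tau> (fst p) then g (real (nat \<lfloor>snd p / h\<rfloor>) * h) (fst p) (Y0 (fst p) (snd p)) else 0))
    \<in> borel_measurable ?N" using 2 3 by measurable
  also have "(\<lambda>p. Phi (fst p) (snd p) - (if 0 \<le> snd p \<and> snd p < \<tau> (fst p) then g (real (nat \<lfloor>snd p / h\<rfloor>) * h) (fst p) (Y0 (fst p) (snd p)) else 0))
    = (\<lambda>(\<omega>, s). dF \<omega> s)"
    by (auto simp: fun_eq_iff dF_def Phi_def Y0_def phi_nonneg_grid(1))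
  finally show ?thesis .
qed

lemma dF_section [measurable]: "\<omega> \<in> space M \<Longrightarrow> dF \<omega> \<in> borel_measurable lborel"
  using measurable_compose[OF measurable_Pair1' dF_joint, of \<omega>] by simp

lemma Q_joint [measurable]: "(\<lambda>(\<omega>, s). Q \<omega> s) \<in> borel_measurable (M \<Otimes>\<^sub>M lborel)"
proof -
  have m: "(\<lambda>p. dF (fst p) (snd p)) \<in> borel_measurable (M \<Otimes>\<^sub>M lborel)" "(\<lambda>p. zeta (fst p) (snd p)) \<in> borel_measurable (M \<Otimes>\<^sub>M lborel)"
    using dF_joint zeta_joint by (simp_all add: split_beta')
  show ?thesis unfolding Q_def indicator_def split_beta' atLeastLessThan_iff of_bool_def using m by measurable
qed

definition DF :: "real \<Rightarrow> 'a \<Rightarrow> ennreal" where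
  "DF t \<omega> = (\<integral>\<^sup>+s\<in>{t..<t+h}. ennreal ((dF \<omega> s)\<^sup>2) \<partial>lborel)"

definition ZZ :: "real \<Rightarrow> 'a \<Rightarrow> ennreal" where
  "ZZ t \<omega> = (\<integral>\<^sup>+s\<in>{t..<t+h}. ennreal (zeta \<omega> s) \<partial>lborel)"

lemma DF_M [measurable]: "DF t \<in> borel_measurable M" and ZZ_M [measurable]: "ZZ t \<in> borel_measurable M"
  unfolding DF_def[abs_def] ZZ_def[abs_def] by measurable

text \<open>K bounds Y s off a null set depending on s. Fubini exchanges the order: almost every
  path obeys the bound at almost every time, which is enough under time integrals.\<close>

lemma K_Y_AE: "AE \<omega> in M. AE s in lborel. 0 \<le> s \<longrightarrow> \<bar>Y s \<omega>\<bar> \<le> K \<omega>"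
proof -
  interpret P: pair_sigma_finite M "lborel :: real measure" ..
  have m: "(\<lambda>p. Y0 (fst p) (snd p)) \<in> borel_measurable (M \<Otimes>\<^sub>M lborel)" using Y0_joint by (simp add: split_beta')
  have "AE s in lborel. AE \<omega> in M. \<bar>Y0 \<omega> s\<bar> \<le> K \<omega>"
  proof (rule AE_I2)
    fix s :: real
    show "AE \<omega> in M. \<bar>Y0 \<omega> s\<bar> \<le> K \<omega>"
      using K_Y[of s] K_nonneg by (cases "0 \<le> s") (auto simp: Y0_def)
  qed
  moreover have "{p \<in> space (M \<Otimes>\<^sub>M lborel). \<bar>Y0 (fst p) (snd p)\<bar> \<le> K (fst p)} \<in> sets (M \<Otimes>\<^sub>M lborel)"
    using m by measurable
  ultimately have "AE \<omega> in M. AE s in lborel. \<bar>Y0 \<omega> s\<bar> \<le> K \<omega>" by (subst P.AE_commute)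
  then show ?thesis by (elim eventually_mono) (auto simp: Y0_def)
qed

text \<open>Before \<tau> the driver is dF plus the discrete driver at the exact Y, and the latter
  is at most \<kappa>. The parameter of Young's inequality stays free: 1/4 serves for the increments
  of Y, 1 for the steps after T.\<close>

lemma Phi_sq_le:
  assumes t: "t \<in> grid h"
  shows "AE \<omega> in M. t \<le> max (\<tau> \<omega>) (T \<omega>) \<longrightarrow> (AE s in lborel. s \<in> {t..<t+h} \<longrightarrow>
    (\<forall>\<delta>>0. (Phi \<omega> s)\<^sup>2 \<le> (1 + \<delta>) * (dF \<omega> s)\<^sup>2 + (1 + 1 / \<delta>) * ((\<kappa> \<omega>)\<^sup>2 * indicator {..<\<tau> \<omega>} s)))"
  using g_bound[OF t] K_Y_AE
proof eventually_elim
  case (elim \<omega>)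
  show ?case
  proof
    assume tm: "t \<le> max (\<tau> \<omega>) (T \<omega>)"
    show "AE s in lborel. s \<in> {t..<t+h} \<longrightarrow>
      (\<forall>\<delta>>0. (Phi \<omega> s)\<^sup>2 \<le> (1 + \<delta>) * (dF \<omega> s)\<^sup>2 + (1 + 1 / \<delta>) * ((\<kappa> \<omega>)\<^sup>2 * indicator {..<\<tau> \<omega>} s))"
      using elim(2)
    proof eventually_elim
      case (elim s)
      show ?case
      proof safe
        fix \<delta> :: real assume s: "s \<in> {t..<t+h}" and \<delta>: "0 < \<delta>"
        have s0: "0 \<le> s" using s grid_nonneg[OF t] by auto
        show "(Phi \<omega> s)\<^sup>2 \<le> (1 + \<delta>) * (dF \<omega> s)\<^sup>2 + (1 + 1 / \<delta>) * ((\<kappa> \<omega>)\<^sup>2 * indicator {..<\<tau> \<omega>} s)"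
        proof (cases "s < \<tau> \<omega>")
          case True
          have "\<bar>g t \<omega> (Y s \<omega>)\<bar> \<le> K \<omega> + L * \<bar>Y s \<omega>\<bar>" using \<open>t \<le> max _ _ \<longrightarrow> _\<close> tm by auto
          also have "\<dots> \<le> K \<omega> + L * K \<omega>" using elim s0 L_pos by auto
          finally have "(g t \<omega> (Y s \<omega>))\<^sup>2 \<le> (\<kappa> \<omega>)\<^sup>2"
            using kappa_nonneg[of \<omega>] unfolding \<kappa>_def by (intro power2_le_iff_abs_le[THEN iffD2]) (auto simp: algebra_simps)
          then have "(1 + 1 / \<delta>) * (g t \<omega> (Y s \<omega>))\<^sup>2 \<le> (1 + 1 / \<delta>) * (\<kappa> \<omega>)\<^sup>2"
            using \<delta> by (intro mult_left_mono) auto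
          moreover have "Phi \<omega> s = dF \<omega> s + g t \<omega> (Y s \<omega>)"
            using True s0 phi_grid[OF t s] by (simp add: Phi_def dF_def)
          ultimately show ?thesis using real_sq_add_le[OF \<delta>, of "dF \<omega> s" "g t \<omega> (Y s \<omega>)"] True by simp
        next
          case False
          then show ?thesis by (simp add: Phi_def dF_def)
        qed
      qed
    qed
  qed
qed

lemma Phi_nn_le:
  assumes t: "t \<in> grid h" and \<delta>: "0 < \<delta>"
  shows "AE \<omega> in M. t \<le> max (\<tau> \<omega>) (T \<omega>) \<longrightarrow>
    (\<integral>\<^sup>+s\<in>{t..<t+h}. ennreal ((Phi \<omega> s)\<^sup>2) \<partial>lborel)
     \<le> ennreal (1 + \<delta>) * DF t \<omega> + ennreal ((1 + 1 / \<delta>) * (\<kappa> \<omega>)\<^sup>2) * (\<integral>\<^sup>+s\<in>{t..<t+h}. indicator {..<\<tau> \<omega>} s \<partial>lborel)"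
  using Phi_sq_le[OF t] AE_space
proof eventually_elim
  case (elim \<omega>)
  note [measurable] = dF_section[OF elim(2)]
  show ?case
  proof
    assume "t \<le> max (\<tau> \<omega>) (T \<omega>)"
    with elim(1) have ae: "AE s in lborel. s \<in> {t..<t+h} \<longrightarrow>
      (Phi \<omega> s)\<^sup>2 \<le> (1 + \<delta>) * (dF \<omega> s)\<^sup>2 + (1 + 1 / \<delta>) * ((\<kappa> \<omega>)\<^sup>2 * indicator {..<\<tau> \<omega>} s)"
      using \<delta> by (auto elim!: eventually_mono)
    have "(\<integral>\<^sup>+s\<in>{t..<t+h}. ennreal ((Phi \<omega> s)\<^sup>2) \<partial>lborel)
      \<le> (\<integral>\<^sup>+s. ennreal (1 + \<delta>) * (ennreal ((dF \<omega> s)\<^sup>2) * indicator {t..<t+h} s)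
        + ennreal ((1 + 1 / \<delta>) * (\<kappa> \<omega>)\<^sup>2) * (indicator {..<\<tau> \<omega>} s * indicator {t..<t+h} s) \<partial>lborel)"
    proof (rule nn_integral_mono_AE, use ae in eventually_elim)
      case (elim s)
      show ?case
      proof (cases "s \<in> {t..<t+h}")
        case True
        then have "ennreal ((Phi \<omega> s)\<^sup>2) \<le> ennreal ((1 + \<delta>) * (dF \<omega> s)\<^sup>2 + (1 + 1 / \<delta>) * (\<kappa> \<omega>)\<^sup>2 * indicator {..<\<tau> \<omega>} s)"
          using elim by (intro ennreal_leI) (simp add: mult.assoc)
        also have "\<dots> = ennreal (1 + \<delta>) * ennreal ((dF \<omega> s)\<^sup>2) + ennreal ((1 + 1 / \<delta>) * (\<kappa> \<omega>)\<^sup>2) * ennreal (indicator {..<\<tau> \<omega>} s)"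
          using \<delta> by (intro ennreal_lincomb) auto
        finally show ?thesis using True by (simp add: ennreal_indicator)
      qed simp
    qed
    also have "\<dots> = ennreal (1 + \<delta>) * DF t \<omega> + ennreal ((1 + 1 / \<delta>) * (\<kappa> \<omega>)\<^sup>2) * (\<integral>\<^sup>+s\<in>{t..<t+h}. indicator {..<\<tau> \<omega>} s \<partial>lborel)"
      unfolding DF_def by (subst nn_integral_add) (auto simp: nn_integral_cmult)
    finally show "(\<integral>\<^sup>+s\<in>{t..<t+h}. ennreal ((Phi \<omega> s)\<^sup>2) \<partial>lborel)
     \<le> ennreal (1 + \<delta>) * DF t \<omega> + ennreal ((1 + 1 / \<delta>) * (\<kappa> \<omega>)\<^sup>2) * (\<integral>\<^sup>+s\<in>{t..<t+h}. indicator {..<\<tau> \<omega>} s \<partial>lborel)" .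
  qed
qed

lemma emeasure_step: "emeasure lborel {t..<t+h} = ennreal h"
  using h_pos by simp

text \<open>Within a step Y changes by a driver integral and a difference of stochastic integrals.
  Young's inequality with parameter 1/4 is used twice, giving 25/16 and 25/4 for the driver part and
  5 for the stochastic part.\<close>

lemma Y_diff_sq:
  assumes t: "t \<in> grid h" and s: "s \<in> {t..<t+h}" and A: "A \<in> sets (F t)" and AT: "\<And>\<omega>. \<omega> \<in> A \<Longrightarrow> t \<le> max (\<tau> \<omega>) (T \<omega>)"
  shows "(\<integral>\<^sup>+\<omega>\<in>A. ennreal ((Y s \<omega> - Y t \<omega>)\<^sup>2) \<partial>M)
    \<le> (\<integral>\<^sup>+\<omega>\<in>A. (ennreal (25 / 16 * h) * DF t \<omega> + ennreal (25 / 4 * h\<^sup>2 * (\<kappa> \<omega>)\<^sup>2) + 5 * ZZ t \<omega>) \<partial>M)"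
proof -
  have t0: "0 \<le> t" "t \<le> s" "0 \<le> s" using grid_nonneg[OF t] s by auto
  note [measurable] = sets_F_M[OF A] It_isometry(1)[OF t0(1)] It_isometry(1)[OF t0(3)] Phi_int_M[OF t0(1,2)]
  have d: "(0::real) < 1 / 4" by simp
  have "AE \<omega> in M. ennreal ((Y s \<omega> - Y t \<omega>)\<^sup>2) * indicator A \<omega>
    \<le> (ennreal (25 / 16 * h) * DF t \<omega> + ennreal (25 / 4 * h\<^sup>2 * (\<kappa> \<omega>)\<^sup>2)) * indicator A \<omega> + 5 * (ennreal ((It t \<omega> - It s \<omega>)\<^sup>2) * indicator A \<omega>)"
    using Y_increment[OF t0(1,2)] Phi_nn_le[OF t d] AE_space
  proof eventually_elim
    case (elim \<omega>)
    note [measurable] = Phi_section[OF elim(3)]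
    show ?case
    proof (cases "\<omega> \<in> A")
      case True
      define P where "P = (\<integral>u. indicator {t..<s} u * Phi \<omega> u \<partial>lborel)"
      have "Y s \<omega> - Y t \<omega> = - P + (It t \<omega> - It s \<omega>)" using elim(1) unfolding P_def by simp
      then have "(Y s \<omega> - Y t \<omega>)\<^sup>2 \<le> 5 / 4 * P\<^sup>2 + 5 * (It t \<omega> - It s \<omega>)\<^sup>2"
        using real_sq_add_le[of "1 / 4" "- P" "It t \<omega> - It s \<omega>"] by simp
      then have 1: "ennreal ((Y s \<omega> - Y t \<omega>)\<^sup>2) \<le> ennreal (5 / 4) * ennreal (P\<^sup>2) + 5 * ennreal ((It t \<omega> - It s \<omega>)\<^sup>2)"
      proof -
        assume "(Y s \<omega> - Y t \<omega>)\<^sup>2 \<le> 5 / 4 * P\<^sup>2 + 5 * (It t \<omega> - It s \<omega>)\<^sup>2"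
        then have "ennreal ((Y s \<omega> - Y t \<omega>)\<^sup>2) \<le> ennreal (5 / 4 * P\<^sup>2 + 5 * (It t \<omega> - It s \<omega>)\<^sup>2)"
          by (rule ennreal_leI)
        also have "\<dots> = ennreal (5 / 4) * ennreal (P\<^sup>2) + ennreal 5 * ennreal ((It t \<omega> - It s \<omega>)\<^sup>2)"
          by (rule ennreal_lincomb) auto
        finally show ?thesis by simp
      qed
      \<comment> \<open>Cauchy-Schwarz in time supplies the additional factor h of the driver
        part.\<close>
      have "ennreal (P\<^sup>2) \<le> emeasure lborel {t..<s} * (\<integral>\<^sup>+u\<in>{t..<s}. ennreal ((Phi \<omega> u)\<^sup>2) \<partial>lborel)"
        unfolding P_def by (rule sq_integral_le_nn_integral) auto
      also have "\<dots> \<le> ennreal h * (\<integral>\<^sup>+u\<in>{t..<t+h}. ennreal ((Phi \<omega> u)\<^sup>2) \<partial>lborel)"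
        using s by (intro mult_mono nn_integral_mono) (auto intro!: ennreal_leI split: split_indicator)
      also have "\<dots> \<le> ennreal h * (ennreal (5 / 4) * DF t \<omega> + ennreal (5 * (\<kappa> \<omega>)\<^sup>2) * ennreal h)"
      proof (rule mult_left_mono)
        have "(\<integral>\<^sup>+u\<in>{t..<t+h}. ennreal ((Phi \<omega> u)\<^sup>2) \<partial>lborel)
          \<le> ennreal (5 / 4) * DF t \<omega> + ennreal (5 * (\<kappa> \<omega>)\<^sup>2) * (\<integral>\<^sup>+s\<in>{t..<t+h}. indicator {..<\<tau> \<omega>} s \<partial>lborel)"
          using elim(2) AT[OF True] by simp
        also have "\<dots> \<le> ennreal (5 / 4) * DF t \<omega> + ennreal (5 * (\<kappa> \<omega>)\<^sup>2) * (\<integral>\<^sup>+s. indicator {t..<t+h} s \<partial>lborel)"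
          by (intro add_left_mono mult_left_mono nn_integral_mono) (auto split: split_indicator)
        finally show "(\<integral>\<^sup>+u\<in>{t..<t+h}. ennreal ((Phi \<omega> u)\<^sup>2) \<partial>lborel)
          \<le> ennreal (5 / 4) * DF t \<omega> + ennreal (5 * (\<kappa> \<omega>)\<^sup>2) * ennreal h" using emeasure_step by simp
      qed simp
      also have "\<dots> = ennreal (5 / 4 * h) * DF t \<omega> + ennreal (5 * h\<^sup>2 * (\<kappa> \<omega>)\<^sup>2)"
      proof -
        have "ennreal h * (ennreal (5 / 4) * DF t \<omega> + ennreal (5 * (\<kappa> \<omega>)\<^sup>2) * ennreal h)
          = ennreal (h * (5 / 4)) * DF t \<omega> + ennreal (h * (5 * (\<kappa> \<omega>)\<^sup>2 * h))"
          by (rule ennreal_distrib_mult) (use h_pos in auto)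
        also have "h * (5 / 4) = 5 / 4 * h" by simp
        also have "h * (5 * (\<kappa> \<omega>)\<^sup>2 * h) = 5 * h\<^sup>2 * (\<kappa> \<omega>)\<^sup>2" by (simp add: power2_eq_square)
        finally show ?thesis .
      qed
      finally have "ennreal (5 / 4) * ennreal (P\<^sup>2) \<le> ennreal (5 / 4) * (ennreal (5 / 4 * h) * DF t \<omega> + ennreal (5 * h\<^sup>2 * (\<kappa> \<omega>)\<^sup>2))"
        by (rule mult_left_mono) simp
      also have "\<dots> = ennreal (25 / 16 * h) * DF t \<omega> + ennreal (25 / 4 * h\<^sup>2 * (\<kappa> \<omega>)\<^sup>2)"
      proof -
        have "ennreal (5 / 4) * (ennreal (5 / 4 * h) * DF t \<omega> + ennreal (5 * h\<^sup>2 * (\<kappa> \<omega>)\<^sup>2) * ennreal 1)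
          = ennreal (5 / 4 * (5 / 4 * h)) * DF t \<omega> + ennreal (5 / 4 * (5 * h\<^sup>2 * (\<kappa> \<omega>)\<^sup>2 * 1))"
          by (rule ennreal_distrib_mult) (use h_pos in auto)
        then show ?thesis by (simp add: mult.assoc)
      qed
      finally have "ennreal ((Y s \<omega> - Y t \<omega>)\<^sup>2) \<le> ennreal (25 / 16 * h) * DF t \<omega> + ennreal (25 / 4 * h\<^sup>2 * (\<kappa> \<omega>)\<^sup>2) + 5 * ennreal ((It t \<omega> - It s \<omega>)\<^sup>2)"
        using 1 by (meson add_right_mono order_trans)
      then show ?thesis using True by simp
    qed simp
  qed
  then have "(\<integral>\<^sup>+\<omega>\<in>A. ennreal ((Y s \<omega> - Y t \<omega>)\<^sup>2) \<partial>M)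
    \<le> (\<integral>\<^sup>+\<omega>. (ennreal (25 / 16 * h) * DF t \<omega> + ennreal (25 / 4 * h\<^sup>2 * (\<kappa> \<omega>)\<^sup>2)) * indicator A \<omega> + 5 * (ennreal ((It t \<omega> - It s \<omega>)\<^sup>2) * indicator A \<omega>) \<partial>M)"
    by (rule nn_integral_mono_AE)
  also have "\<dots> = (\<integral>\<^sup>+\<omega>\<in>A. (ennreal (25 / 16 * h) * DF t \<omega> + ennreal (25 / 4 * h\<^sup>2 * (\<kappa> \<omega>)\<^sup>2)) \<partial>M) + 5 * (\<integral>\<^sup>+\<omega>\<in>A. ennreal ((It t \<omega> - It s \<omega>)\<^sup>2) \<partial>M)"
    by (subst nn_integral_add) (auto simp: nn_integral_cmult)
  also have "\<dots> \<le> (\<integral>\<^sup>+\<omega>\<in>A. (ennreal (25 / 16 * h) * DF t \<omega> + ennreal (25 / 4 * h\<^sup>2 * (\<kappa> \<omega>)\<^sup>2)) \<partial>M) + 5 * (\<integral>\<^sup>+\<omega>\<in>A. ZZ t \<omega> \<partial>M)"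
  proof (intro add_left_mono mult_left_mono order_trans[OF It_increment[OF t0(1,2) A]] nn_integral_mono)
    fix \<omega> assume "\<omega> \<in> space M"
    show "(\<integral>\<^sup>+u\<in>{t<..s}. ennreal (zeta \<omega> u) \<partial>lborel) * indicator A \<omega> \<le> ZZ t \<omega> * indicator A \<omega>"
      unfolding ZZ_def using s by (intro mult_right_mono nn_integral_mono) (auto split: split_indicator)
  qed auto
  also have "\<dots> = (\<integral>\<^sup>+\<omega>\<in>A. (ennreal (25 / 16 * h) * DF t \<omega> + ennreal (25 / 4 * h\<^sup>2 * (\<kappa> \<omega>)\<^sup>2) + 5 * ZZ t \<omega>) \<partial>M)"
  proof -
    have "(\<integral>\<^sup>+\<omega>\<in>A. (ennreal (25 / 16 * h) * DF t \<omega> + ennreal (25 / 4 * h\<^sup>2 * (\<kappa> \<omega>)\<^sup>2) + 5 * ZZ t \<omega>) \<partial>M)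
      = (\<integral>\<^sup>+\<omega>. (ennreal (25 / 16 * h) * DF t \<omega> + ennreal (25 / 4 * h\<^sup>2 * (\<kappa> \<omega>)\<^sup>2)) * indicator A \<omega> + 5 * (ZZ t \<omega> * indicator A \<omega>) \<partial>M)"
      by (rule nn_integral_cong) (simp only: distrib_right mult.assoc)
    also have "\<dots> = (\<integral>\<^sup>+\<omega>\<in>A. (ennreal (25 / 16 * h) * DF t \<omega> + ennreal (25 / 4 * h\<^sup>2 * (\<kappa> \<omega>)\<^sup>2)) \<partial>M) + (\<integral>\<^sup>+\<omega>. 5 * (ZZ t \<omega> * indicator A \<omega>) \<partial>M)"
      by (rule nn_integral_add) measurable
    also have "(\<integral>\<^sup>+\<omega>. 5 * (ZZ t \<omega> * indicator A \<omega>) \<partial>M) = 5 * (\<integral>\<^sup>+\<omega>\<in>A. ZZ t \<omega> \<partial>M)"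
      by (rule nn_integral_cmult) measurable
    finally show ?thesis ..
  qed
  finally show ?thesis .
qed

end

lemma ennreal_scale2:
  assumes "0 \<le> c" "0 \<le> a" "0 \<le> b"
  shows "ennreal c * (ennreal a * X + ennreal b * E) = ennreal (c * a) * X + ennreal (c * b) * E"
  using assms by (simp add: distrib_left ennreal_mult mult.assoc)

lemma ennreal_expand:
  assumes "0 \<le> a" "0 \<le> h" "0 \<le> p" "0 \<le> q" "0 \<le> u" "0 \<le> v" "0 \<le> w" "0 \<le> k"
  shows "ennreal a * (ennreal h * (ennreal p * X + ennreal q * (ennreal h * (ennreal u * X + ennreal v + ennreal w * Z)) + ennreal k * E))
    = ennreal (a * h * p + a * h * q * h * u) * X + ennreal (a * h * k) * E + (ennreal (a * h * q * h * v) + ennreal (a * h * q * h * w) * Z)"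
  using assms by (simp add: distrib_left distrib_right ennreal_mult mult.assoc add_ac)

context scheme
begin

text \<open>Before T the local error is the time integral of the driver minus the constant
  \<open>g t \<omega> (Y t \<omega>)\<close>. Before \<tau> the integrand is dF plus a Lipschitz
  increment, and Young's parameter 1/5 keeps the factor of dF^2 at 6/5; from \<tau> on only the
  constant remains, bounded by \<kappa>.\<close>

lemma G_sq_before:
  assumes t: "t \<in> grid h"
  shows "AE \<omega> in M. t < T \<omega> \<longrightarrow> ennreal ((G t \<omega>)\<^sup>2)
    \<le> ennreal h * (ennreal (6 / 5) * DF t \<omega>
      + ennreal (6 * L\<^sup>2) * (\<integral>\<^sup>+s\<in>{t..<t+h}. ennreal ((Y0 \<omega> s - Y t \<omega>)\<^sup>2) \<partial>lborel)
      + ennreal ((\<kappa> \<omega>)\<^sup>2) * (\<integral>\<^sup>+s\<in>{t..<t+h}. indicator {\<tau> \<omega>..} s \<partial>lborel))"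
  using g_bound[OF t] K_Y[OF grid_nonneg[OF t]] Phi_integrable AE_space
proof eventually_elim
  case (elim \<omega>)
  note [measurable] = Phi_section[OF elim(4)] dF_section[OF elim(4)] Y0_section[OF elim(4)]
  show ?case
  proof
    assume tT: "t < T \<omega>"
    define c where "c = g t \<omega> (Y t \<omega>)"
    have t0: "0 \<le> t" by (rule grid_nonneg[OF t])
    have "\<bar>c\<bar> \<le> K \<omega> + L * \<bar>Y t \<omega>\<bar>" unfolding c_def using elim(1) tT by auto
    also have "\<dots> \<le> \<kappa> \<omega>" using elim(2) L_pos unfolding \<kappa>_def by (simp add: algebra_simps)
    finally have c2: "c\<^sup>2 \<le> (\<kappa> \<omega>)\<^sup>2"
      using kappa_nonneg[of \<omega>] by (intro power2_le_iff_abs_le[THEN iffD2]) auto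
    have "G t \<omega> = (\<integral>u. indicator {t..<t+h} u * (Phi \<omega> u - c) \<partial>lborel)"
    proof -
      have i1: "integrable lborel (\<lambda>u. indicator {t..<t+h} u * Phi \<omega> u)"
        using integrable_mult_indicator[OF _ elim(3), of "{t..<t+h}"] by simp
      have i2: "integrable lborel (\<lambda>u. indicator {t..<t+h} u * c)"
        using h_pos by (intro integrable_mult_left) (simp add: integrable_indicator_iff)
      have "(\<integral>u. indicator {t..<t+h} u * (Phi \<omega> u - c) \<partial>lborel)
        = (\<integral>u. indicator {t..<t+h} u * Phi \<omega> u \<partial>lborel) - (\<integral>u. indicator {t..<t+h} u * c \<partial>lborel)"
        unfolding right_diff_distrib by (rule Bochner_Integration.integral_diff[OF i1 i2])
      then show ?thesis unfolding G_def c_def using tT h_pos by simp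
    qed
    then have "ennreal ((G t \<omega>)\<^sup>2) \<le> emeasure lborel {t..<t+h} * (\<integral>\<^sup>+u\<in>{t..<t+h}. ennreal ((Phi \<omega> u - c)\<^sup>2) \<partial>lborel)"
      using sq_integral_le_nn_integral[of "\<lambda>u. Phi \<omega> u - c" lborel "{t..<t+h}"] by simp
    also have "\<dots> \<le> ennreal h * (\<integral>\<^sup>+s. ennreal (6 / 5) * (ennreal ((dF \<omega> s)\<^sup>2) * indicator {t..<t+h} s)
      + ennreal (6 * L\<^sup>2) * (ennreal ((Y0 \<omega> s - Y t \<omega>)\<^sup>2) * indicator {t..<t+h} s)
      + ennreal ((\<kappa> \<omega>)\<^sup>2) * (indicator {\<tau> \<omega>..} s * indicator {t..<t+h} s) \<partial>lborel)"
      unfolding emeasure_step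
    proof (intro mult_left_mono nn_integral_mono)
      fix s
      show "ennreal ((Phi \<omega> s - c)\<^sup>2) * indicator {t..<t+h} s
        \<le> ennreal (6 / 5) * (ennreal ((dF \<omega> s)\<^sup>2) * indicator {t..<t+h} s)
          + ennreal (6 * L\<^sup>2) * (ennreal ((Y0 \<omega> s - Y t \<omega>)\<^sup>2) * indicator {t..<t+h} s)
          + ennreal ((\<kappa> \<omega>)\<^sup>2) * (indicator {\<tau> \<omega>..} s * indicator {t..<t+h} s)"
      proof (cases "s \<in> {t..<t+h}")
        case s: True
        have s0: "0 \<le> s" using s t0 by auto
        show ?thesis
        proof (cases "s < \<tau> \<omega>")
          case True
          have "Phi \<omega> s - c = dF \<omega> s + (g t \<omega> (Y s \<omega>) - g t \<omega> (Y t \<omega>))"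
            using True s0 phi_grid[OF t s] by (simp add: Phi_def dF_def c_def)
          then have "(Phi \<omega> s - c)\<^sup>2 \<le> 6 / 5 * (dF \<omega> s)\<^sup>2 + 6 * (g t \<omega> (Y s \<omega>) - g t \<omega> (Y t \<omega>))\<^sup>2"
            using real_sq_add_le[of "1 / 5" "dF \<omega> s" "g t \<omega> (Y s \<omega>) - g t \<omega> (Y t \<omega>)"] by simp
          also have "(g t \<omega> (Y s \<omega>) - g t \<omega> (Y t \<omega>))\<^sup>2 \<le> (L * \<bar>Y s \<omega> - Y t \<omega>\<bar>)\<^sup>2"
            using g_lip[OF t] L_pos by (intro power2_le_iff_abs_le[THEN iffD2]) auto
          finally have "(Phi \<omega> s - c)\<^sup>2 \<le> 6 / 5 * (dF \<omega> s)\<^sup>2 + 6 * L\<^sup>2 * (Y0 \<omega> s - Y t \<omega>)\<^sup>2"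
            using s0 by (simp add: power_mult_distrib Y0_def)
          then have "ennreal ((Phi \<omega> s - c)\<^sup>2) \<le> ennreal (6 / 5 * (dF \<omega> s)\<^sup>2 + 6 * L\<^sup>2 * (Y0 \<omega> s - Y t \<omega>)\<^sup>2)"
            by (rule ennreal_leI)
          also have "\<dots> = ennreal (6 / 5) * ennreal ((dF \<omega> s)\<^sup>2) + ennreal (6 * L\<^sup>2) * ennreal ((Y0 \<omega> s - Y t \<omega>)\<^sup>2)"
            by (rule ennreal_lincomb) auto
          finally show ?thesis using s by (simp add: add_increasing2)
        next
          case False
          then have "Phi \<omega> s - c = - c" by (simp add: Phi_def)
          then have "ennreal ((Phi \<omega> s - c)\<^sup>2) \<le> ennreal ((\<kappa> \<omega>)\<^sup>2)" using c2 by (simp add: ennreal_leI)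
          then show ?thesis using s False by (simp add: add_increasing)
        qed
      qed simp
    qed simp
    also have "(\<integral>\<^sup>+s. ennreal (6 / 5) * (ennreal ((dF \<omega> s)\<^sup>2) * indicator {t..<t+h} s)
      + ennreal (6 * L\<^sup>2) * (ennreal ((Y0 \<omega> s - Y t \<omega>)\<^sup>2) * indicator {t..<t+h} s)
      + ennreal ((\<kappa> \<omega>)\<^sup>2) * (indicator {\<tau> \<omega>..} s * indicator {t..<t+h} s) \<partial>lborel)
      = ennreal (6 / 5) * DF t \<omega>
      + ennreal (6 * L\<^sup>2) * (\<integral>\<^sup>+s\<in>{t..<t+h}. ennreal ((Y0 \<omega> s - Y t \<omega>)\<^sup>2) \<partial>lborel)
      + ennreal ((\<kappa> \<omega>)\<^sup>2) * (\<integral>\<^sup>+s\<in>{t..<t+h}. indicator {\<tau> \<omega>..} s \<partial>lborel)"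
      unfolding DF_def by (simp add: nn_integral_add nn_integral_cmult)
    finally show "ennreal ((G t \<omega>)\<^sup>2)
      \<le> ennreal h * (ennreal (6 / 5) * DF t \<omega>
        + ennreal (6 * L\<^sup>2) * (\<integral>\<^sup>+s\<in>{t..<t+h}. ennreal ((Y0 \<omega> s - Y t \<omega>)\<^sup>2) \<partial>lborel)
        + ennreal ((\<kappa> \<omega>)\<^sup>2) * (\<integral>\<^sup>+s\<in>{t..<t+h}. indicator {\<tau> \<omega>..} s \<partial>lborel))" .
  qed
qed

text \<open>Fubini reduces the claim to a fixed time s, where the bound does not depend on s;
  integrating over the step gives the factor h.\<close>

lemma Y_diff_sq_integral:
  assumes t: "t \<in> grid h" and A: "A \<in> sets (F t)" and AT: "\<And>\<omega>. \<omega> \<in> A \<Longrightarrow> t \<le> max (\<tau> \<omega>) (T \<omega>)"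
  shows "(\<integral>\<^sup>+\<omega>\<in>A. (\<integral>\<^sup>+s\<in>{t..<t+h}. ennreal ((Y0 \<omega> s - Y t \<omega>)\<^sup>2) \<partial>lborel) \<partial>M)
    \<le> ennreal h * (\<integral>\<^sup>+\<omega>\<in>A. (ennreal (25 / 16 * h) * DF t \<omega> + ennreal (25 / 4 * h\<^sup>2 * (\<kappa> \<omega>)\<^sup>2) + 5 * ZZ t \<omega>) \<partial>M)"
    (is "_ \<le> ennreal h * ?C")
proof -
  interpret P: pair_sigma_finite M "lborel :: real measure" ..
  have t0: "0 \<le> t" by (rule grid_nonneg[OF t])
  note [measurable] = sets_F_M[OF A] Y_M[OF t0]
  have "(\<integral>\<^sup>+\<omega>\<in>A. (\<integral>\<^sup>+s\<in>{t..<t+h}. ennreal ((Y0 \<omega> s - Y t \<omega>)\<^sup>2) \<partial>lborel) \<partial>M)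
    = (\<integral>\<^sup>+\<omega>. (\<integral>\<^sup>+s. ennreal ((Y0 \<omega> s - Y t \<omega>)\<^sup>2) * indicator {t..<t+h} s * indicator A \<omega> \<partial>lborel) \<partial>M)"
    by (intro nn_integral_cong nn_integral_multc[symmetric]) measurable
  also have "\<dots> = (\<integral>\<^sup>+s. (\<integral>\<^sup>+\<omega>. ennreal ((Y0 \<omega> s - Y t \<omega>)\<^sup>2) * indicator {t..<t+h} s * indicator A \<omega> \<partial>M) \<partial>lborel)"
    by (rule P.Fubini'[symmetric]) measurable
  also have "\<dots> \<le> (\<integral>\<^sup>+s. ?C * indicator {t..<t+h} s \<partial>lborel)"
  proof (rule nn_integral_mono)
    fix s :: real
    show "(\<integral>\<^sup>+\<omega>. ennreal ((Y0 \<omega> s - Y t \<omega>)\<^sup>2) * indicator {t..<t+h} s * indicator A \<omega> \<partial>M) \<le> ?C * indicator {t..<t+h} s"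
    proof (cases "s \<in> {t..<t+h}")
      case True
      then have "0 \<le> s" using t0 by auto
      then show ?thesis using Y_diff_sq[OF t True A AT] True by (simp add: Y0_def)
    qed simp
  qed
  also have "\<dots> = ennreal h * ?C"
    by (subst nn_integral_cmult_indicator) (auto simp: emeasure_step[simplified] mult.commute)
  finally show ?thesis .
qed

lemma Q_integral:
  assumes "\<omega> \<in> space M"
  shows "(Qi t \<omega>) = ennreal (3 / (2 * L)) * DF t \<omega>
    + ennreal (10 / (9 * L) * (\<kappa> \<omega>)\<^sup>2) * (\<integral>\<^sup>+s\<in>{t..<t+h}. indicator {min (\<tau> \<omega>) (T \<omega>)..<max (\<tau> \<omega>) (T \<omega>)} s \<partial>lborel)
    + ennreal (50 * L * h) * (ennreal (h * (\<kappa> \<omega>)\<^sup>2) * (\<integral>\<^sup>+s\<in>{t..<t+h}. indicator {0..<T \<omega>} s \<partial>lborel) + ZZ t \<omega>)"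
proof -
  note [measurable] = dF_section[OF assms] zeta_section[OF assms]
  have "(Qi t \<omega>) = (\<integral>\<^sup>+s. ennreal (3 / (2 * L)) * (ennreal ((dF \<omega> s)\<^sup>2) * indicator {t..<t+h} s)
    + ennreal (10 / (9 * L) * (\<kappa> \<omega>)\<^sup>2) * (indicator {min (\<tau> \<omega>) (T \<omega>)..<max (\<tau> \<omega>) (T \<omega>)} s * indicator {t..<t+h} s)
    + ennreal (50 * L * h) * (ennreal (h * (\<kappa> \<omega>)\<^sup>2) * (indicator {0..<T \<omega>} s * indicator {t..<t+h} s) + ennreal (zeta \<omega> s) * indicator {t..<t+h} s) \<partial>lborel)"
    unfolding Q_def by (rule nn_integral_cong) (simp only: distrib_right mult.assoc)
  also have "\<dots> = ennreal (3 / (2 * L)) * DF t \<omega>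
    + ennreal (10 / (9 * L) * (\<kappa> \<omega>)\<^sup>2) * (\<integral>\<^sup>+s\<in>{t..<t+h}. indicator {min (\<tau> \<omega>) (T \<omega>)..<max (\<tau> \<omega>) (T \<omega>)} s \<partial>lborel)
    + ennreal (50 * L * h) * (ennreal (h * (\<kappa> \<omega>)\<^sup>2) * (\<integral>\<^sup>+s\<in>{t..<t+h}. indicator {0..<T \<omega>} s \<partial>lborel) + ZZ t \<omega>)"
    unfolding DF_def ZZ_def by (simp add: nn_integral_add nn_integral_cmult)
  finally show ?thesis .
qed

text \<open>The prefactor is the bound on the reciprocal Young parameter of the recursion before T;
  the point is that the local error multiplied by it still fits into Q.\<close>

lemma G_sq_before_Q:
  assumes t: "t \<in> grid h" and A: "A \<in> sets (F t)" and AT: "\<And>\<omega>. \<omega> \<in> A \<Longrightarrow> t < T \<omega>"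
  shows "ennreal (10 / (9 * (L * h))) * (sqn A (G t))
    \<le> (\<integral>\<^sup>+\<omega>\<in>A. (Qi t \<omega>) \<partial>M)"
proof -
  have t0: "0 \<le> t" by (rule grid_nonneg[OF t])
  note [measurable] = sets_F_M[OF A] Y_M[OF t0] G_M[OF t]
  have AT': "\<And>\<omega>. \<omega> \<in> A \<Longrightarrow> t \<le> max (\<tau> \<omega>) (T \<omega>)" using AT by force
  define E where "E = (\<lambda>\<omega>. \<integral>\<^sup>+s\<in>{t..<t+h}. indicator {\<tau> \<omega>..} s \<partial>lborel)"
  define DY where "DY = (\<lambda>\<omega>. \<integral>\<^sup>+s\<in>{t..<t+h}. ennreal ((Y0 \<omega> s - Y t \<omega>)\<^sup>2) \<partial>lborel)"
  define C where "C = (\<lambda>\<omega>. ennreal (25 / 16 * h) * DF t \<omega> + ennreal (25 / 4 * h\<^sup>2 * (\<kappa> \<omega>)\<^sup>2) + 5 * ZZ t \<omega>)"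
  have [measurable]: "E \<in> borel_measurable M" "DY \<in> borel_measurable M" "C \<in> borel_measurable M"
  proof -
    have "(\<lambda>(\<omega>, s). indicator {\<tau> \<omega>..} s * indicator {t..<t+h} s :: ennreal) \<in> borel_measurable (M \<Otimes>\<^sub>M lborel)"
      unfolding indicator_def split_beta' atLeast_iff of_bool_def by measurable
    then show "E \<in> borel_measurable M" unfolding E_def by (rule lborel.borel_measurable_nn_integral)
    show "DY \<in> borel_measurable M" unfolding DY_def by measurable
    show "C \<in> borel_measurable M" unfolding C_def by measurable
  qed
  let ?c = "10 / (9 * (L * h))"
  have "(sqn A (G t))
    \<le> (\<integral>\<^sup>+\<omega>. ennreal h * (ennreal (6 / 5) * (DF t \<omega> * indicator A \<omega>) + ennreal (6 * L\<^sup>2) * (DY \<omega> * indicator A \<omega>)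
       + ennreal ((\<kappa> \<omega>)\<^sup>2) * (E \<omega> * indicator A \<omega>)) \<partial>M)"
  proof (rule nn_integral_mono_AE, use G_sq_before[OF t] in eventually_elim)
    case (elim \<omega>)
    then show ?case using AT[of \<omega>] by (cases "\<omega> \<in> A") (simp_all add: DY_def E_def)
  qed
  also have "\<dots> = ennreal h * (ennreal (6 / 5) * (\<integral>\<^sup>+\<omega>\<in>A. DF t \<omega> \<partial>M) + ennreal (6 * L\<^sup>2) * (\<integral>\<^sup>+\<omega>\<in>A. DY \<omega> \<partial>M)
       + (\<integral>\<^sup>+\<omega>. ennreal ((\<kappa> \<omega>)\<^sup>2) * (E \<omega> * indicator A \<omega>) \<partial>M))"
    by (simp add: nn_integral_add nn_integral_cmult)
  also have "\<dots> \<le> ennreal h * (ennreal (6 / 5) * (\<integral>\<^sup>+\<omega>\<in>A. DF t \<omega> \<partial>M) + ennreal (6 * L\<^sup>2) * (ennreal h * (\<integral>\<^sup>+\<omega>\<in>A. C \<omega> \<partial>M))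
       + (\<integral>\<^sup>+\<omega>. ennreal ((\<kappa> \<omega>)\<^sup>2) * (E \<omega> * indicator A \<omega>) \<partial>M))"
    using Y_diff_sq_integral[OF t A AT'] unfolding DY_def C_def
    by (intro mult_left_mono add_mono order_refl) auto
  also have "\<dots> = (\<integral>\<^sup>+\<omega>. ennreal h * (ennreal (6 / 5) * (DF t \<omega> * indicator A \<omega>) + ennreal (6 * L\<^sup>2) * (ennreal h * (C \<omega> * indicator A \<omega>))
       + ennreal ((\<kappa> \<omega>)\<^sup>2) * (E \<omega> * indicator A \<omega>)) \<partial>M)"
    by (simp add: nn_integral_add nn_integral_cmult)
  finally have "ennreal ?c * (sqn A (G t))
    \<le> ennreal ?c * (\<integral>\<^sup>+\<omega>. ennreal h * (ennreal (6 / 5) * (DF t \<omega> * indicator A \<omega>) + ennreal (6 * L\<^sup>2) * (ennreal h * (C \<omega> * indicator A \<omega>))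
       + ennreal ((\<kappa> \<omega>)\<^sup>2) * (E \<omega> * indicator A \<omega>)) \<partial>M)"
    by (rule mult_left_mono) simp
  also have "\<dots> = (\<integral>\<^sup>+\<omega>. ennreal ?c * (ennreal h * (ennreal (6 / 5) * (DF t \<omega> * indicator A \<omega>) + ennreal (6 * L\<^sup>2) * (ennreal h * (C \<omega> * indicator A \<omega>))
       + ennreal ((\<kappa> \<omega>)\<^sup>2) * (E \<omega> * indicator A \<omega>))) \<partial>M)"
    by (rule nn_integral_cmult[symmetric]) measurable
  also have "\<dots> \<le> (\<integral>\<^sup>+\<omega>\<in>A. (Qi t \<omega>) \<partial>M)"
  proof (rule nn_integral_mono)
    fix \<omega> assume \<omega>: "\<omega> \<in> space M"
    show "ennreal ?c * (ennreal h * (ennreal (6 / 5) * (DF t \<omega> * indicator A \<omega>) + ennreal (6 * L\<^sup>2) * (ennreal h * (C \<omega> * indicator A \<omega>))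
       + ennreal ((\<kappa> \<omega>)\<^sup>2) * (E \<omega> * indicator A \<omega>))) \<le> (Qi t \<omega>) * indicator A \<omega>"
    proof (cases "\<omega> \<in> A")
      case True
      have T': "t + h \<le> T \<omega>" using T_step[OF \<omega> t AT[OF True]] .
      \<comment> \<open>The step ends no later than T, so within it the strip between \<tau> and T
        consists exactly of the times from \<tau> on.\<close>
      have e1: "(\<integral>\<^sup>+s\<in>{t..<t+h}. indicator {min (\<tau> \<omega>) (T \<omega>)..<max (\<tau> \<omega>) (T \<omega>)} s \<partial>lborel) = E \<omega>"
        unfolding E_def using T' by (intro nn_integral_cong) (auto split: split_indicator)
      have e2: "(\<integral>\<^sup>+s\<in>{t..<t+h}. indicator {0..<T \<omega>} s \<partial>lborel) = ennreal h"
      proof -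
        have "(\<integral>\<^sup>+s\<in>{t..<t+h}. indicator {0..<T \<omega>} s \<partial>lborel) = (\<integral>\<^sup>+s. indicator {t..<t+h} s \<partial>lborel)"
          using T' t0 by (intro nn_integral_cong) (auto split: split_indicator)
        then show ?thesis using emeasure_step by simp
      qed
      let ?x = "L * h"
      have x: "0 < ?x" "?x \<le> 1 / 12" using L_pos h_pos Lh by auto
      have x2: "?x\<^sup>2 \<le> 1 / 144" using power_mono[OF x(2), of 2] x by (simp add: power2_eq_square)
      have "ennreal ?c * (ennreal h * (ennreal (6 / 5) * DF t \<omega> + ennreal (6 * L\<^sup>2) * (ennreal h * C \<omega>) + ennreal ((\<kappa> \<omega>)\<^sup>2) * E \<omega>))
        = ennreal (?c * h * (6 / 5) + ?c * h * (6 * L\<^sup>2) * h * (25 / 16 * h)) * DF t \<omega>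
          + ennreal (?c * h * (\<kappa> \<omega>)\<^sup>2) * E \<omega>
          + (ennreal (?c * h * (6 * L\<^sup>2) * h * (25 / 4 * h\<^sup>2 * (\<kappa> \<omega>)\<^sup>2)) + ennreal (?c * h * (6 * L\<^sup>2) * h * 5) * ZZ t \<omega>)"
        unfolding C_def ennreal_numeral[of "num.Bit1 (num.Bit0 num.One)", symmetric]
        by (rule ennreal_expand) (use x h_pos in auto)
      also have "\<dots> \<le> ennreal (3 / (2 * L)) * DF t \<omega> + ennreal (10 / (9 * L) * (\<kappa> \<omega>)\<^sup>2) * E \<omega>
         + (ennreal (50 * L * h) * (ennreal (h * (\<kappa> \<omega>)\<^sup>2) * ennreal h) + ennreal (50 * L * h) * ZZ t \<omega>)"
      proof (intro add_mono mult_right_mono)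
        have "?c * h * (6 / 5) + ?c * h * (6 * L\<^sup>2) * h * (25 / 16 * h) = (4 / 3 + 125 / 12 * ?x\<^sup>2) / L"
          using L_pos h_pos by (simp add: field_simps power2_eq_square)
        also have "\<dots> \<le> (3 / 2) / L" using x2 L_pos by (intro divide_right_mono) auto
        finally show "ennreal (?c * h * (6 / 5) + ?c * h * (6 * L\<^sup>2) * h * (25 / 16 * h)) \<le> ennreal (3 / (2 * L))"
          by (intro ennreal_leI) simp
        show "ennreal (?c * h * (\<kappa> \<omega>)\<^sup>2) \<le> ennreal (10 / (9 * L) * (\<kappa> \<omega>)\<^sup>2)"
          using h_pos by (intro ennreal_leI) (simp add: field_simps)
        \<comment> \<open>The coefficient 125/3 obtained here and the 100/3 of the energy of Z both
          stay below the 50 in Q.\<close>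
        have "?c * h * (6 * L\<^sup>2) * h * (25 / 4 * h\<^sup>2 * (\<kappa> \<omega>)\<^sup>2) = 125 / 3 * (L * h) * (h * (\<kappa> \<omega>)\<^sup>2 * h)"
          using L_pos h_pos by (simp add: field_simps power2_eq_square)
        also have "\<dots> \<le> 50 * L * h * (h * (\<kappa> \<omega>)\<^sup>2 * h)"
          using L_pos h_pos by (intro mult_right_mono) auto
        finally show "ennreal (?c * h * (6 * L\<^sup>2) * h * (25 / 4 * h\<^sup>2 * (\<kappa> \<omega>)\<^sup>2)) \<le> ennreal (50 * L * h) * (ennreal (h * (\<kappa> \<omega>)\<^sup>2) * ennreal h)"
          using L_pos h_pos by (simp add: ennreal_mult[symmetric] ennreal_leI)
        have "?c * h * (6 * L\<^sup>2) * h * 5 = 100 / 3 * (L * h)"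
          using L_pos h_pos by (simp add: field_simps power2_eq_square)
        also have "\<dots> \<le> 50 * L * h" using x by simp
        finally show "ennreal (?c * h * (6 * L\<^sup>2) * h * 5) \<le> ennreal (50 * L * h)" by (rule ennreal_leI)
      qed auto
      also have "\<dots> = (Qi t \<omega>)"
        unfolding Q_integral[OF \<omega>] e1 e2 by (simp add: distrib_left add.assoc)
      finally show ?thesis using True by simp
    qed simp
  qed
  finally show ?thesis .
qed

section \<open>One-step recursions before and after T\<close>

lemma step_before:
  assumes t: "t \<in> grid h" and A: "A \<in> sets (F t)" and AT: "\<And>\<omega>. \<omega> \<in> A \<Longrightarrow> t < T \<omega>"
  shows "(sqn A (D t))
    \<le> ennreal (exp (3 * L * h)) * ((sqn A (D (t + h))) + (\<integral>\<^sup>+\<omega>\<in>A. (Qi t \<omega>) \<partial>M))"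
proof -
  note [measurable] = sets_F_M[OF A] G_M[OF t] D_M[OF t] D_M[OF grid_step[OF t]]
  define x where "x = L * h"
  have x: "0 < x" "x \<le> 1 / 12" using L_pos h_pos Lh unfolding x_def by auto
  define \<epsilon> where "\<epsilon> = exp (3 * x) * (1 - x)\<^sup>2 - 1"
  have eps: "9 / 10 * x \<le> \<epsilon>" using exp_times_square_ge[OF x] unfolding \<epsilon>_def by simp
  have eps0: "0 < \<epsilon>" using eps x by linarith
  let ?d = "\<integral>\<^sup>+\<omega>\<in>A. ennreal ((D t \<omega>)\<^sup>2) \<partial>M"
  let ?d' = "\<integral>\<^sup>+\<omega>\<in>A. ennreal ((D (t + h) \<omega>)\<^sup>2) \<partial>M"
  let ?g = "\<integral>\<^sup>+\<omega>\<in>A. ennreal ((G t \<omega>)\<^sup>2) \<partial>M"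
  have "ennreal ((1 - x)\<^sup>2) * ?d = (\<integral>\<^sup>+\<omega>. ennreal ((1 - x)\<^sup>2) * (ennreal ((D t \<omega>)\<^sup>2) * indicator A \<omega>) \<partial>M)"
    by (rule nn_integral_cmult[symmetric]) measurable
  also have "\<dots> \<le> (\<integral>\<^sup>+\<omega>\<in>A. ennreal ((D t \<omega> - indicator {\<omega>. t < T \<omega>} \<omega> * (h * (g t \<omega> (Y t \<omega>) - g t \<omega> (Yb t \<omega>))))\<^sup>2) \<partial>M)"
  proof (rule nn_integral_mono)
    fix \<omega>
    show "ennreal ((1 - x)\<^sup>2) * (ennreal ((D t \<omega>)\<^sup>2) * indicator A \<omega>)
      \<le> ennreal ((D t \<omega> - indicator {\<omega>. t < T \<omega>} \<omega> * (h * (g t \<omega> (Y t \<omega>) - g t \<omega> (Yb t \<omega>))))\<^sup>2) * indicator A \<omega>"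
    proof (cases "\<omega> \<in> A")
      case True
      define y where "y = h * (g t \<omega> (Y t \<omega>) - g t \<omega> (Yb t \<omega>))"
      have "\<bar>y\<bar> = h * \<bar>g t \<omega> (Y t \<omega>) - g t \<omega> (Yb t \<omega>)\<bar>" unfolding y_def using h_pos by (simp add: abs_mult)
      also have "\<dots> \<le> h * (L * \<bar>D t \<omega>\<bar>)" unfolding D_def using h_pos g_lip[OF t] by (intro mult_left_mono) auto
      finally have "\<bar>y\<bar> \<le> x * \<bar>D t \<omega>\<bar>" unfolding x_def by (simp add: mult_ac)
      \<comment> \<open>The Lipschitz term moves the error by at most x times its size, so the
        fraction 1 - x remains.\<close>
      then have "(1 - x) * \<bar>D t \<omega>\<bar> \<le> \<bar>D t \<omega> - y\<bar>" by (simp add: left_diff_distrib)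
      then have "((1 - x) * \<bar>D t \<omega>\<bar>)\<^sup>2 \<le> \<bar>D t \<omega> - y\<bar>\<^sup>2" using x by (intro power_mono) auto
      then have "ennreal ((1 - x)\<^sup>2 * (D t \<omega>)\<^sup>2) \<le> ennreal ((D t \<omega> - y)\<^sup>2)" by (simp add: power_mult_distrib ennreal_leI)
      then show ?thesis using True AT[OF True] unfolding y_def by (simp add: ennreal_mult)
    qed simp
  qed
  also have "\<dots> \<le> (\<integral>\<^sup>+\<omega>\<in>A. ennreal ((D (t + h) \<omega> + G t \<omega>)\<^sup>2) \<partial>M)" by (rule contraction[OF t A])
  also have "\<dots> \<le> (\<integral>\<^sup>+\<omega>. ennreal (1 + \<epsilon>) * (ennreal ((D (t + h) \<omega>)\<^sup>2) * indicator A \<omega>) + ennreal (1 + 1 / \<epsilon>) * (ennreal ((G t \<omega>)\<^sup>2) * indicator A \<omega>) \<partial>M)"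
  proof (rule nn_integral_mono)
    fix \<omega>
    have "ennreal ((D (t + h) \<omega> + G t \<omega>)\<^sup>2) \<le> ennreal ((1 + \<epsilon>) * (D (t + h) \<omega>)\<^sup>2 + (1 + 1 / \<epsilon>) * (G t \<omega>)\<^sup>2)"
      by (intro ennreal_leI real_sq_add_le eps0)
    also have "\<dots> = ennreal (1 + \<epsilon>) * ennreal ((D (t + h) \<omega>)\<^sup>2) + ennreal (1 + 1 / \<epsilon>) * ennreal ((G t \<omega>)\<^sup>2)"
      using eps0 by (intro ennreal_lincomb) auto
    finally show "ennreal ((D (t + h) \<omega> + G t \<omega>)\<^sup>2) * indicator A \<omega>
      \<le> ennreal (1 + \<epsilon>) * (ennreal ((D (t + h) \<omega>)\<^sup>2) * indicator A \<omega>) + ennreal (1 + 1 / \<epsilon>) * (ennreal ((G t \<omega>)\<^sup>2) * indicator A \<omega>)"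
      by (cases "\<omega> \<in> A") auto
  qed
  also have "\<dots> = ennreal (1 + \<epsilon>) * ?d' + ennreal (1 + 1 / \<epsilon>) * ?g"
    by (simp add: nn_integral_add nn_integral_cmult)
  finally have "ennreal ((1 - x)\<^sup>2) * ?d \<le> ennreal (1 + \<epsilon>) * ?d' + ennreal (1 + 1 / \<epsilon>) * ?g" .
  then have "ennreal (1 / (1 - x)\<^sup>2) * (ennreal ((1 - x)\<^sup>2) * ?d) \<le> ennreal (1 / (1 - x)\<^sup>2) * (ennreal (1 + \<epsilon>) * ?d' + ennreal (1 + 1 / \<epsilon>) * ?g)"
    by (rule mult_left_mono) simp
  also have "ennreal (1 / (1 - x)\<^sup>2) * (ennreal ((1 - x)\<^sup>2) * ?d) = ?d"
    using x by (simp add: mult.assoc[symmetric] ennreal_mult[symmetric])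
  also have "ennreal (1 / (1 - x)\<^sup>2) * (ennreal (1 + \<epsilon>) * ?d' + ennreal (1 + 1 / \<epsilon>) * ?g)
    = ennreal (1 / (1 - x)\<^sup>2 * (1 + \<epsilon>)) * ?d' + ennreal (1 / (1 - x)\<^sup>2 * (1 + 1 / \<epsilon>)) * ?g"
    by (rule ennreal_scale2) (use eps0 in auto)
  also have "1 / (1 - x)\<^sup>2 * (1 + \<epsilon>) = exp (3 * x)" using x unfolding \<epsilon>_def by simp
  \<comment> \<open>Because 1 + 1 / \<epsilon> = (1 + \<epsilon>) / \<epsilon>, the local error
    carries the same growth factor as the next error, divided by \<epsilon>.\<close>
  also have "1 / (1 - x)\<^sup>2 * (1 + 1 / \<epsilon>) = exp (3 * x) * (1 / \<epsilon>)"
  proof -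
    have "1 + 1 / \<epsilon> = (1 + \<epsilon>) / \<epsilon>" using eps0 by (simp add: field_simps)
    then have "1 / (1 - x)\<^sup>2 * (1 + 1 / \<epsilon>) = (1 / (1 - x)\<^sup>2 * (1 + \<epsilon>)) / \<epsilon>" by simp
    then show ?thesis unfolding \<open>1 / (1 - x)\<^sup>2 * (1 + \<epsilon>) = exp (3 * x)\<close> by simp
  qed
  also have "ennreal (exp (3 * x)) * ?d' + ennreal (exp (3 * x) * (1 / \<epsilon>)) * ?g
    = ennreal (exp (3 * x)) * (?d' + ennreal (1 / \<epsilon>) * ?g)"
    using ennreal_scale2[of "exp (3 * x)" 1 "1 / \<epsilon>" ?d' ?g] eps0 by simp
  also have "\<dots> \<le> ennreal (exp (3 * x)) * (?d' + (\<integral>\<^sup>+\<omega>\<in>A. (Qi t \<omega>) \<partial>M))"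
  proof (intro mult_left_mono add_left_mono)
    have "1 / \<epsilon> \<le> 1 / (9 / 10 * x)" using eps x eps0 by (intro divide_left_mono) auto
    then have "ennreal (1 / \<epsilon>) * ?g \<le> ennreal (10 / (9 * (L * h))) * ?g"
      unfolding x_def by (intro mult_right_mono ennreal_leI) auto
    also have "\<dots> \<le> (\<integral>\<^sup>+\<omega>\<in>A. (Qi t \<omega>) \<partial>M)" by (rule G_sq_before_Q[OF t A AT])
    finally show "ennreal (1 / \<epsilon>) * ?g \<le> (\<integral>\<^sup>+\<omega>\<in>A. (Qi t \<omega>) \<partial>M)" .
  qed auto
  finally show ?thesis unfolding x_def by (simp add: mult.assoc)
qed

text \<open>After T there is no implicit term, so \<epsilon> = exp(3 x) - 1 is available and 1 + 1 /
  \<epsilon> = exp(3 x) / \<epsilon> is at most 4 / (9 x). The Q-term must not carry the growth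
  factor: \<tau> need not be a grid point, the step may pass it, and the final weight then dominates
  exp(3 L t) but possibly not exp(3 L (t + h)).\<close>

lemma step_after:
  assumes t: "t \<in> grid h" and A: "A \<in> sets (F t)" and AT: "\<And>\<omega>. \<omega> \<in> A \<Longrightarrow> T \<omega> \<le> t \<and> t < \<tau> \<omega>"
  shows "(sqn A (D t))
    \<le> ennreal (exp (3 * L * h)) * (sqn A (D (t + h))) + (\<integral>\<^sup>+\<omega>\<in>A. (Qi t \<omega>) \<partial>M)"
proof -
  have t0: "0 \<le> t" by (rule grid_nonneg[OF t])
  note [measurable] = sets_F_M[OF A] G_M[OF t] D_M[OF t] D_M[OF grid_step[OF t]]
  define x where "x = L * h"
  have x: "0 < x" "x \<le> 1 / 12" using L_pos h_pos Lh unfolding x_def by auto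
  define \<epsilon> where "\<epsilon> = exp (3 * x) - 1"
  have eps: "3 * x \<le> \<epsilon>" using exp_ge_add_one_self[of "3 * x"] unfolding \<epsilon>_def by linarith
  have eps0: "0 < \<epsilon>" using eps x by linarith
  let ?d' = "\<integral>\<^sup>+\<omega>\<in>A. ennreal ((D (t + h) \<omega>)\<^sup>2) \<partial>M"
  let ?g = "\<integral>\<^sup>+\<omega>\<in>A. ennreal ((G t \<omega>)\<^sup>2) \<partial>M"
  have "(sqn A (D t)) = (\<integral>\<^sup>+\<omega>\<in>A. ennreal ((D t \<omega> - indicator {\<omega>. t < T \<omega>} \<omega> * (h * (g t \<omega> (Y t \<omega>) - g t \<omega> (Yb t \<omega>))))\<^sup>2) \<partial>M)"
  proof (rule nn_integral_cong)
    fix \<omega>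
    show "ennreal ((D t \<omega>)\<^sup>2) * indicator A \<omega>
      = ennreal ((D t \<omega> - indicator {\<omega>. t < T \<omega>} \<omega> * (h * (g t \<omega> (Y t \<omega>) - g t \<omega> (Yb t \<omega>))))\<^sup>2) * indicator A \<omega>"
      by (cases "\<omega> \<in> A") (use AT[of \<omega>] in auto)
  qed
  also have "\<dots> \<le> (\<integral>\<^sup>+\<omega>\<in>A. ennreal ((D (t + h) \<omega> + G t \<omega>)\<^sup>2) \<partial>M)" by (rule contraction[OF t A])
  also have "\<dots> \<le> (\<integral>\<^sup>+\<omega>. ennreal (1 + \<epsilon>) * (ennreal ((D (t + h) \<omega>)\<^sup>2) * indicator A \<omega>) + ennreal (1 + 1 / \<epsilon>) * (ennreal ((G t \<omega>)\<^sup>2) * indicator A \<omega>) \<partial>M)"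
  proof (rule nn_integral_mono)
    fix \<omega>
    have "ennreal ((D (t + h) \<omega> + G t \<omega>)\<^sup>2) \<le> ennreal ((1 + \<epsilon>) * (D (t + h) \<omega>)\<^sup>2 + (1 + 1 / \<epsilon>) * (G t \<omega>)\<^sup>2)"
      by (intro ennreal_leI real_sq_add_le eps0)
    also have "\<dots> = ennreal (1 + \<epsilon>) * ennreal ((D (t + h) \<omega>)\<^sup>2) + ennreal (1 + 1 / \<epsilon>) * ennreal ((G t \<omega>)\<^sup>2)"
      using eps0 by (intro ennreal_lincomb) auto
    finally show "ennreal ((D (t + h) \<omega> + G t \<omega>)\<^sup>2) * indicator A \<omega>
      \<le> ennreal (1 + \<epsilon>) * (ennreal ((D (t + h) \<omega>)\<^sup>2) * indicator A \<omega>) + ennreal (1 + 1 / \<epsilon>) * (ennreal ((G t \<omega>)\<^sup>2) * indicator A \<omega>)"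
      by (cases "\<omega> \<in> A") auto
  qed
  also have "\<dots> = ennreal (1 + \<epsilon>) * ?d' + ennreal (1 + 1 / \<epsilon>) * ?g"
    by (simp add: nn_integral_add nn_integral_cmult)
  also have "\<dots> \<le> ennreal (exp (3 * L * h)) * ?d' + (\<integral>\<^sup>+\<omega>\<in>A. (Qi t \<omega>) \<partial>M)"
  proof (intro add_mono)
    show "ennreal (1 + \<epsilon>) * ?d' \<le> ennreal (exp (3 * L * h)) * ?d'"
      unfolding \<epsilon>_def x_def by (simp add: mult.assoc)
    have "1 + 1 / \<epsilon> = exp (3 * x) / \<epsilon>" using eps0 by (simp add: \<epsilon>_def field_simps)
    also have "\<dots> \<le> (4 / 3) / (3 * x)" using exp_le_four_thirds[of x] x eps by (intro frac_le) auto
    finally have e: "1 + 1 / \<epsilon> \<le> 4 / (9 * (L * h))" unfolding x_def by simp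
    have "ennreal (1 + 1 / \<epsilon>) * ?g \<le> ennreal (4 / (9 * (L * h))) * ?g"
      by (intro mult_right_mono ennreal_leI e) simp
    also have "\<dots> = (\<integral>\<^sup>+\<omega>. ennreal (4 / (9 * (L * h))) * (ennreal ((G t \<omega>)\<^sup>2) * indicator A \<omega>) \<partial>M)"
      by (rule nn_integral_cmult[symmetric]) measurable
    also have "\<dots> \<le> (\<integral>\<^sup>+\<omega>\<in>A. (Qi t \<omega>) \<partial>M)"
    proof (rule nn_integral_mono_AE, use Phi_nn_le[OF t zero_less_one] AE_space in eventually_elim)
      case (elim \<omega>)
      note [measurable] = Phi_section[OF elim(2)]
      show ?case
      proof (cases "\<omega> \<in> A")
        case True
        have tT: "T \<omega> \<le> t" "t < \<tau> \<omega>" using AT[OF True] by auto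
        define E where "E = (\<integral>\<^sup>+s\<in>{t..<t+h}. indicator {..<\<tau> \<omega>} s \<partial>lborel)"
        have E: "(\<integral>\<^sup>+s\<in>{t..<t+h}. indicator {min (\<tau> \<omega>) (T \<omega>)..<max (\<tau> \<omega>) (T \<omega>)} s \<partial>lborel) = E"
          unfolding E_def using tT by (intro nn_integral_cong) (auto split: split_indicator)
        have "G t \<omega> = (\<integral>u. indicator {t..<t+h} u * Phi \<omega> u \<partial>lborel)" using tT by (simp add: G_def)
        then have "ennreal ((G t \<omega>)\<^sup>2) \<le> ennreal h * (\<integral>\<^sup>+u\<in>{t..<t+h}. ennreal ((Phi \<omega> u)\<^sup>2) \<partial>lborel)"
          using sq_integral_le_nn_integral[of "Phi \<omega>" lborel "{t..<t+h}"] emeasure_step by simp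
        also have "\<dots> \<le> ennreal h * (ennreal 2 * DF t \<omega> + ennreal (2 * (\<kappa> \<omega>)\<^sup>2) * E)"
          using elim(1) tT unfolding E_def by (intro mult_left_mono) auto
        finally have "ennreal (4 / (9 * (L * h))) * ennreal ((G t \<omega>)\<^sup>2)
          \<le> ennreal (4 / (9 * (L * h))) * (ennreal h * (ennreal 2 * DF t \<omega> + ennreal (2 * (\<kappa> \<omega>)\<^sup>2) * E))"
          by (rule mult_left_mono) simp
        also have "\<dots> = ennreal (4 / (9 * (L * h)) * h * 2) * DF t \<omega> + ennreal (4 / (9 * (L * h)) * h * (2 * (\<kappa> \<omega>)\<^sup>2)) * E"
          using L_pos h_pos by (subst mult.assoc[symmetric], subst ennreal_mult[symmetric], simp, simp, intro ennreal_scale2) auto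
        \<comment> \<open>With Young's parameter 1 both coefficients are based on 8 / (9 L), which
          is below the two bounds in Q.\<close>
        also have "\<dots> \<le> ennreal (3 / (2 * L)) * DF t \<omega> + ennreal (10 / (9 * L) * (\<kappa> \<omega>)\<^sup>2) * E"
        proof (intro add_mono mult_right_mono ennreal_leI)
          show "4 / (9 * (L * h)) * h * 2 \<le> 3 / (2 * L)" using L_pos h_pos by (simp add: field_simps)
          have "4 / (9 * (L * h)) * h * (2 * (\<kappa> \<omega>)\<^sup>2) = 8 / (9 * L) * (\<kappa> \<omega>)\<^sup>2" using L_pos h_pos by (simp add: field_simps)
          also have "\<dots> \<le> 10 / (9 * L) * (\<kappa> \<omega>)\<^sup>2" using L_pos by (intro mult_right_mono divide_right_mono) auto
          finally show "4 / (9 * (L * h)) * h * (2 * (\<kappa> \<omega>)\<^sup>2) \<le> 10 / (9 * L) * (\<kappa> \<omega>)\<^sup>2" .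
        qed auto
        also have "\<dots> \<le> (Qi t \<omega>)"
          unfolding Q_integral[OF elim(2)] E by (rule add_increasing2[OF zero_le order_refl])
        finally show ?thesis using True by simp
      qed simp
    qed
    finally show "ennreal (1 + 1 / \<epsilon>) * ?g \<le> (\<integral>\<^sup>+\<omega>\<in>A. (Qi t \<omega>) \<partial>M)" .
  qed
  finally show ?thesis .
qed

section \<open>The weighted error and its telescoping along the grid\<close>

definition \<sigma> :: "'a \<Rightarrow> real" where "\<sigma> \<omega> = max (\<tau> \<omega>) (T \<omega>)"

definition w :: "'a \<Rightarrow> real" where "w \<omega> = exp (3 * L * \<sigma> \<omega>)"

text \<open>Off this set the error is almost surely frozen at the terminal error
  \<open>\<xi> \<omega> - B \<omega>\<close>, so only these paths take part in the
  recursion.\<close>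

definition act :: "real \<Rightarrow> 'a set" where "act t = {\<omega>\<in>space M. t < \<sigma> \<omega>}"

lemma sigma_M [measurable]: "\<sigma> \<in> borel_measurable M"
  unfolding \<sigma>_def[abs_def] by measurable

lemma w_M [measurable]: "w \<in> borel_measurable M"
  unfolding w_def[abs_def] by measurable

lemma w_pos: "0 < w \<omega>" by (simp add: w_def)

lemma act_M [measurable]: "act t \<in> sets M" unfolding act_def by measurable

lemma xi_M' [measurable]: "\<xi> \<in> borel_measurable M" by (rule xi_M)

lemma D_final:
  assumes t: "t \<in> grid h"
  shows "AE \<omega> in M. \<sigma> \<omega> \<le> t \<longrightarrow> D t \<omega> = \<xi> \<omega> - B \<omega>"
  using Y_after[OF grid_nonneg[OF t]] by eventually_elim (auto simp: \<sigma>_def D_def Yb_def)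

definition Qw :: "real \<Rightarrow> ennreal" where
  "Qw t = (\<integral>\<^sup>+\<omega>. ennreal (w \<omega>) * (Qi t \<omega>) \<partial>M)"

lemma Q_int_M [measurable]: "A \<in> sets borel \<Longrightarrow> (\<lambda>\<omega>. \<integral>\<^sup>+s\<in>A. Q \<omega> s \<partial>lborel) \<in> borel_measurable M"
proof -
  assume [measurable]: "A \<in> sets borel"
  show ?thesis by measurable
qed

text \<open>The active paths split by whether T has been reached. Before T the whole step lies below
  \<sigma>, so exp(3 L (t + h)) is at most w; after T only t < \<sigma> is known, and there the
  local error carries just exp(3 L t).\<close>

lemma active_step:
  assumes t: "t \<in> grid h"
  shows "ennreal (exp (3 * L * t)) * (sqn (act t) (D t))
    \<le> ennreal (exp (3 * L * (t + h))) * (sqn (act t) (D (t + h))) + Qw t"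
proof -
  define U where "U = {\<omega>\<in>space M. t < T \<omega>}"
  define V where "V = {\<omega>\<in>space M. T \<omega> \<le> t} \<inter> {\<omega>\<in>space M. t < \<tau> \<omega>}"
  have U: "U \<in> sets (F t)" unfolding U_def by (rule stopping_gt[OF T_stop order_refl])
  have V: "V \<in> sets (F t)" unfolding V_def
    by (intro sets.Int stopping_le[OF T_stop order_refl] stopping_gt[OF tau_stop order_refl])
  have UV: "indicator (act t) \<omega> = (indicator U \<omega> + indicator V \<omega> :: ennreal)" for \<omega>
    unfolding act_def U_def V_def \<sigma>_def by (auto simp: indicator_def)
  note [measurable] = sets_F_M[OF U] sets_F_M[OF V] D_M[OF t] D_M[OF grid_step[OF t]]
  have split: "(\<integral>\<^sup>+\<omega>\<in>act t. X \<omega> \<partial>M) = (\<integral>\<^sup>+\<omega>\<in>U. X \<omega> \<partial>M) + (\<integral>\<^sup>+\<omega>\<in>V. X \<omega> \<partial>M)"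
    if [measurable]: "X \<in> borel_measurable M" for X :: "'a \<Rightarrow> ennreal"
    unfolding UV distrib_left by (rule nn_integral_add) measurable
  let ?e = "ennreal (exp (3 * L * t))" and ?e' = "ennreal (exp (3 * L * (t + h)))" and ?x = "ennreal (exp (3 * L * h))"
  let ?dU = "\<integral>\<^sup>+\<omega>\<in>U. ennreal ((D (t + h) \<omega>)\<^sup>2) \<partial>M" and ?dV = "\<integral>\<^sup>+\<omega>\<in>V. ennreal ((D (t + h) \<omega>)\<^sup>2) \<partial>M"
  let ?qU = "\<integral>\<^sup>+\<omega>\<in>U. (Qi t \<omega>) \<partial>M" and ?qV = "\<integral>\<^sup>+\<omega>\<in>V. (Qi t \<omega>) \<partial>M"
  have ee: "?e * ?x = ?e'" by (simp add: ennreal_mult[symmetric] exp_add[symmetric] distrib_left)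
  have 1: "?e * (sqn U (D t)) \<le> ?e' * ?dU + ?e' * ?qU"
  proof -
    have "?e * (sqn U (D t)) \<le> ?e * (?x * (?dU + ?qU))"
      by (intro mult_left_mono step_before[OF t U]) (auto simp: U_def)
    also have "\<dots> = ?e' * ?dU + ?e' * ?qU" unfolding mult.assoc[symmetric] ee by (rule distrib_left)
    finally show ?thesis .
  qed
  have 2: "?e * (sqn V (D t)) \<le> ?e' * ?dV + ?e * ?qV"
  proof -
    have "?e * (sqn V (D t)) \<le> ?e * (?x * ?dV + ?qV)"
      by (intro mult_left_mono step_after[OF t V]) (auto simp: V_def)
    also have "\<dots> = ?e' * ?dV + ?e * ?qV" unfolding distrib_left mult.assoc[symmetric] ee ..
    finally show ?thesis .
  qed
  have 3: "?e' * ?qU + ?e * ?qV \<le> Qw t"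
  proof -
    let ?q = "\<lambda>\<omega>. \<integral>\<^sup>+s\<in>{t..<t+h}. Q \<omega> s \<partial>lborel"
    have "?e' * ?qU + ?e * ?qV = (\<integral>\<^sup>+\<omega>. ?e' * (?q \<omega> * indicator U \<omega>) + ?e * (?q \<omega> * indicator V \<omega>) \<partial>M)"
      by (subst nn_integral_add) (simp_all add: nn_integral_cmult)
    also have "\<dots> \<le> Qw t"
      unfolding Qw_def
    proof (rule nn_integral_mono)
      fix \<omega> assume \<omega>: "\<omega> \<in> space M"
      show "?e' * (?q \<omega> * indicator U \<omega>) + ?e * (?q \<omega> * indicator V \<omega>) \<le> ennreal (w \<omega>) * ?q \<omega>"
      proof (cases "\<omega> \<in> U")
        case True
        then have "t + h \<le> \<sigma> \<omega>" using T_step[OF \<omega> t] unfolding U_def \<sigma>_def by auto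
        then have "?e' \<le> ennreal (w \<omega>)" unfolding w_def using L_pos by (intro ennreal_leI) simp
        moreover have "\<omega> \<notin> V" using True by (auto simp: U_def V_def)
        ultimately show ?thesis using True by (simp add: mult_right_mono)
      next
        case False
        show ?thesis
        proof (cases "\<omega> \<in> V")
          case True
          then have "t \<le> \<sigma> \<omega>" unfolding V_def \<sigma>_def by auto
          then have "?e \<le> ennreal (w \<omega>)" unfolding w_def using L_pos by (intro ennreal_leI) simp
          then show ?thesis using True False by (simp add: mult_right_mono)
        qed (use False in simp)
      qed
    qed
    finally show ?thesis .
  qed
  have "?e * (sqn (act t) (D t)) \<le> (?e' * ?dU + ?e' * ?qU) + (?e' * ?dV + ?e * ?qV)"
  proof -
    have "?e * (sqn (act t) (D t))
      = ?e * (sqn U (D t)) + ?e * (sqn V (D t))"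
      by (subst split, measurable) (rule distrib_left)
    then show ?thesis using add_mono[OF 1 2] by simp
  qed
  also have "\<dots> = ?e' * (?dU + ?dV) + (?e' * ?qU + ?e * ?qV)" by (simp add: distrib_left add_ac)
  also have "\<dots> \<le> ?e' * (?dU + ?dV) + Qw t" by (intro add_left_mono 3)
  also have "?dU + ?dV = (sqn (act t) (D (t + h)))" by (rule split[symmetric]) measurable
  finally show ?thesis .
qed

text \<open>The grid overshoots \<^term>\<open>\<sigma> \<omega>\<close> by at most \<^term>\<open>h\<close> in the last active step, whence the factor
  \<^term>\<open>exp (3 * L * h)\<close>.\<close>

definition fin :: "'a \<Rightarrow> ennreal" where
  "fin \<omega> = ennreal (exp (3 * L * h) * w \<omega> * (\<xi> \<omega> - B \<omega>)\<^sup>2)"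

text \<open>The quantity that telescopes. A path that stops is moved from the first term to the
  second, so that passing from t to t + h costs only the local error \<open>Qw t\<close>.\<close>

definition S :: "real \<Rightarrow> ennreal" where
  "S t = ennreal (exp (3 * L * t)) * (sqn (act t) (D t)) + (\<integral>\<^sup>+\<omega>\<in>space M - act t. fin \<omega> \<partial>M)"

lemma fin_M [measurable]: "fin \<in> borel_measurable M" unfolding fin_def[abs_def] by measurable

text \<open>Only paths that stop during the step need care: at t + h their error is the terminal
  one, and its weight exp(3 L (t + h)) exceeds w by at most the factor exp(3 L h) built into
  \<open>fin\<close>.\<close>

lemma S_step:
  assumes t: "t \<in> grid h"
  shows "S t \<le> S (t + h) + Qw t"
proof -
  have t': "t + h \<in> grid h" by (rule grid_step[OF t])
  note [measurable] = D_M[OF t] D_M[OF t']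
  let ?e' = "ennreal (exp (3 * L * (t + h)))"
  have "?e' * (sqn (act t) (D (t + h))) + (\<integral>\<^sup>+\<omega>\<in>space M - act t. fin \<omega> \<partial>M)
    = (\<integral>\<^sup>+\<omega>. ?e' * (ennreal ((D (t + h) \<omega>)\<^sup>2) * indicator (act t) \<omega>) + fin \<omega> * indicator (space M - act t) \<omega> \<partial>M)"
    by (subst nn_integral_add) (simp_all add: nn_integral_cmult)
  also have "\<dots> \<le> (\<integral>\<^sup>+\<omega>. ?e' * (ennreal ((D (t + h) \<omega>)\<^sup>2) * indicator (act (t + h)) \<omega>) + fin \<omega> * indicator (space M - act (t + h)) \<omega> \<partial>M)"
  proof (rule nn_integral_mono_AE, use D_final[OF t'] AE_space in eventually_elim)
    case (elim \<omega>)
    show ?case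
    proof (cases "\<omega> \<in> act t \<and> \<omega> \<notin> act (t + h)")
      case True
      then have s: "t < \<sigma> \<omega>" "\<sigma> \<omega> \<le> t + h" using elim unfolding act_def by auto
      then have "t + h \<le> h + \<sigma> \<omega>" by simp
      then have "exp (3 * L * (t + h)) \<le> exp (3 * L * (h + \<sigma> \<omega>))" using L_pos by simp
      also have "\<dots> = exp (3 * L * h) * w \<omega>" unfolding w_def by (simp add: exp_add[symmetric] distrib_left)
      finally have "exp (3 * L * (t + h)) * (\<xi> \<omega> - B \<omega>)\<^sup>2 \<le> exp (3 * L * h) * w \<omega> * (\<xi> \<omega> - B \<omega>)\<^sup>2"
        by (rule mult_right_mono) simp
      then have "?e' * ennreal ((D (t + h) \<omega>)\<^sup>2) \<le> fin \<omega>"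
        using elim s unfolding fin_def by (simp add: ennreal_mult[symmetric] ennreal_leI)
      then show ?thesis using True elim by simp
    next
      case False
      then show ?thesis using h_pos by (auto simp: act_def indicator_def)
    qed
  qed
  also have "\<dots> = S (t + h)" unfolding S_def
    by (subst nn_integral_add) (simp_all add: nn_integral_cmult)
  finally have 1: "?e' * (sqn (act t) (D (t + h))) + (\<integral>\<^sup>+\<omega>\<in>space M - act t. fin \<omega> \<partial>M) \<le> S (t + h)" .
  have "S t \<le> (?e' * (sqn (act t) (D (t + h))) + Qw t) + (\<integral>\<^sup>+\<omega>\<in>space M - act t. fin \<omega> \<partial>M)"
    unfolding S_def by (intro add_right_mono active_step[OF t])
  also have "\<dots> = (?e' * (sqn (act t) (D (t + h))) + (\<integral>\<^sup>+\<omega>\<in>space M - act t. fin \<omega> \<partial>M)) + Qw t"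
    by (simp add: add_ac)
  also have "\<dots> \<le> S (t + h) + Qw t" by (intro add_right_mono 1)
  finally show ?thesis .
qed

lemma grid_add: "t \<in> grid h \<Longrightarrow> t + real m * h \<in> grid h"
proof (induction m)
  case (Suc m)
  then show ?case using grid_step[of "t + real m * h"] by (simp add: algebra_simps)
qed simp

lemma S_telescope:
  assumes t: "t \<in> grid h"
  shows "S t \<le> S (t + real m * h) + (\<integral>\<^sup>+\<omega>. ennreal (w \<omega>) * (\<integral>\<^sup>+s\<in>{t..<t + real m * h}. Q \<omega> s \<partial>lborel) \<partial>M)"
proof (induction m)
  case (Suc m)
  let ?t = "t + real m * h"
  have tm: "?t \<in> grid h" by (rule grid_add[OF t])
  have eq: "t + real (Suc m) * h = ?t + h" by (simp add: algebra_simps)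
  have "S t \<le> S ?t + (\<integral>\<^sup>+\<omega>. ennreal (w \<omega>) * (\<integral>\<^sup>+s\<in>{t..<?t}. Q \<omega> s \<partial>lborel) \<partial>M)" by (rule Suc)
  also have "\<dots> \<le> (S (?t + h) + Qw ?t) + (\<integral>\<^sup>+\<omega>. ennreal (w \<omega>) * (\<integral>\<^sup>+s\<in>{t..<?t}. Q \<omega> s \<partial>lborel) \<partial>M)"
    by (intro add_right_mono S_step[OF tm])
  also have "\<dots> = S (?t + h) + ((\<integral>\<^sup>+\<omega>. ennreal (w \<omega>) * (\<integral>\<^sup>+s\<in>{t..<?t}. Q \<omega> s \<partial>lborel) \<partial>M) + Qw ?t)"
    by (simp add: add_ac)
  also have "(\<integral>\<^sup>+\<omega>. ennreal (w \<omega>) * (\<integral>\<^sup>+s\<in>{t..<?t}. Q \<omega> s \<partial>lborel) \<partial>M) + Qw ?t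
    = (\<integral>\<^sup>+\<omega>. ennreal (w \<omega>) * (\<integral>\<^sup>+s\<in>{t..<?t + h}. Q \<omega> s \<partial>lborel) \<partial>M)"
    unfolding Qw_def
  proof (subst nn_integral_add[symmetric], measurable, intro nn_integral_cong)
    fix \<omega> assume \<omega>: "\<omega> \<in> space M"
    have [measurable]: "Q \<omega> \<in> borel_measurable lborel"
      using measurable_compose[OF measurable_Pair1'[OF \<omega>] Q_joint] by simp
    have add: "(\<integral>\<^sup>+s\<in>{t..<u}. Q \<omega> s \<partial>lborel) + (\<integral>\<^sup>+s\<in>{u..<u + h}. Q \<omega> s \<partial>lborel) = (\<integral>\<^sup>+s\<in>{t..<u + h}. Q \<omega> s \<partial>lborel)"
      if "t \<le> u" for u
      by (subst nn_integral_add[symmetric], simp, simp, intro nn_integral_cong) (use h_pos that in \<open>auto simp: indicator_def\<close>)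
    have "t \<le> ?t" using h_pos by simp
    note add[OF this]
    then show "ennreal (w \<omega>) * (\<integral>\<^sup>+s\<in>{t..<?t}. Q \<omega> s \<partial>lborel) + ennreal (w \<omega>) * (\<integral>\<^sup>+s\<in>{?t..<?t + h}. Q \<omega> s \<partial>lborel)
      = ennreal (w \<omega>) * (\<integral>\<^sup>+s\<in>{t..<?t + h}. Q \<omega> s \<partial>lborel)" by (simp add: distrib_left[symmetric])
  qed
  finally show ?case unfolding eq .
qed simp

text \<open>Both weights occurring in S are at least 1.\<close>

lemma D_le_S:
  assumes t: "t \<in> grid h"
  shows "(\<integral>\<^sup>+\<omega>. ennreal ((D t \<omega>)\<^sup>2) \<partial>M) \<le> S t"
proof -
  note [measurable] = D_M[OF t]
  let ?e = "ennreal (exp (3 * L * t))"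
  have e1: "1 \<le> ?e" using L_pos grid_nonneg[OF t] by (simp add: ennreal_1[symmetric] del: ennreal_1)
  have "(\<integral>\<^sup>+\<omega>. ennreal ((D t \<omega>)\<^sup>2) \<partial>M) \<le> (\<integral>\<^sup>+\<omega>. ?e * (ennreal ((D t \<omega>)\<^sup>2) * indicator (act t) \<omega>) + fin \<omega> * indicator (space M - act t) \<omega> \<partial>M)"
  proof (rule nn_integral_mono_AE, use D_final[OF t] AE_space in eventually_elim)
    case (elim \<omega>)
    show ?case
    proof (cases "\<omega> \<in> act t")
      case True
      then show ?thesis using mult_right_mono[OF e1, of "ennreal ((D t \<omega>)\<^sup>2)"] by simp
    next
      case False
      then have "D t \<omega> = \<xi> \<omega> - B \<omega>" using elim by (auto simp: act_def)
      moreover have "1 \<le> exp (3 * L * h) * w \<omega>"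
      proof -
        have "0 \<le> \<sigma> \<omega>" using tau_nonneg[OF elim(2)] unfolding \<sigma>_def by simp
        then have "1 \<le> exp (3 * L * h + 3 * L * \<sigma> \<omega>)" using L_pos h_pos by simp
        then show ?thesis unfolding w_def exp_add .
      qed
      ultimately have "ennreal ((D t \<omega>)\<^sup>2) \<le> fin \<omega>"
        unfolding fin_def using mult_right_mono[of 1 "exp (3 * L * h) * w \<omega>" "(\<xi> \<omega> - B \<omega>)\<^sup>2"] by (intro ennreal_leI) simp
      then show ?thesis using False elim by simp
    qed
  qed
  also have "\<dots> = S t" unfolding S_def
    by (subst nn_integral_add) (simp_all add: nn_integral_cmult)
  finally show ?thesis .
qed

section \<open>The remainder at infinity\<close>

lemma R_tendsto: "(\<lambda>n. exp (3 * L * (real n * h)) * (\<integral>\<omega>. (indicator {\<omega>. real n * h \<le> T \<omega>} \<omega> * R (real n * h) \<omega>)\<^sup>2 \<partial>M)) \<longlonglongrightarrow> 0"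
proof -
  define i where "i = (\<lambda>n::nat. \<integral>\<omega>. (indicator {\<omega>. real n * h \<le> T \<omega>} \<omega> * R (real n * h) \<omega>)\<^sup>2 \<partial>M)"
  define c where "c = (\<lambda>n::nat. (1 - 3 * L * h) powr (- real n) * sqrt (i n))"
  have i0: "0 \<le> i n" for n unfolding i_def by (rule integral_nonneg_AE) simp
  have "summable c" using R_space unfolding scheme_space_def c_def i_def by blast
  \<comment> \<open>The terms of the summable series tend to 0, and their squares are second moments
    with the squared weight.\<close>
  then have "c \<longlonglongrightarrow> 0" by (rule summable_LIMSEQ_zero)
  then have c2: "(\<lambda>n. (c n)\<^sup>2) \<longlonglongrightarrow> 0" using tendsto_power[of c 0 sequentially 2] by simp
  define y where "y = 3 * L * h"
  have y: "0 < y" "y < 1" using L_pos h_pos Lh unfolding y_def by (auto simp: mult.assoc)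
  have le: "exp (3 * L * (real n * h)) * i n \<le> (c n)\<^sup>2" for n
  proof -
    \<comment> \<open>This inequality makes the weight (1 - 3 L h)^(-n) of the scheme's space
      dominate exp(3 L n h).\<close>
    have "ln (1 - y) \<le> - y" using ln_add_one_self_le_self2[of "- y"] y by simp
    then have "real n * y \<le> - real n * ln (1 - y)" using mult_left_mono[of "ln (1 - y)" "- y" "real n"] by simp
    then have 1: "exp (real n * y) \<le> (1 - y) powr (- real n)" using y by (simp add: powr_def)
    have "exp (real n * y) \<le> (exp (real n * y))\<^sup>2" using y by (simp add: power2_eq_square)
    also have "\<dots> \<le> ((1 - y) powr (- real n))\<^sup>2" using 1 by (intro power_mono) auto
    finally have "exp (real n * y) * i n \<le> ((1 - y) powr (- real n))\<^sup>2 * i n" using i0 by (rule mult_right_mono)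
    also have "\<dots> = (c n)\<^sup>2" unfolding c_def y_def using i0 by (simp add: power_mult_distrib)
    finally show ?thesis unfolding y_def by (simp add: mult_ac)
  qed
  have "(\<lambda>n. exp (3 * L * (real n * h)) * i n) \<longlonglongrightarrow> 0"
    by (rule tendsto_sandwich[OF _ _ tendsto_const c2]) (use le i0 in auto)
  then show ?thesis unfolding i_def .
qed

text \<open>On active paths exp(3 L t) is at most w. The contributions of Y and of the terminal
  value B then have integrable majorants and vanish because \<sigma> is finite; for the values of R
  no common majorant is at hand, and \<open>R_tendsto\<close> takes over.\<close>

lemma active_tendsto:
  assumes wK: "(\<integral>\<^sup>+\<omega>. ennreal (w \<omega> * (K \<omega>)\<^sup>2) \<partial>M) < \<infinity>" and wB: "(\<integral>\<^sup>+\<omega>. ennreal (w \<omega> * (B \<omega>)\<^sup>2) \<partial>M) < \<infinity>"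
  shows "(\<lambda>n. ennreal (exp (3 * L * (real n * h))) * (sqn (act (real n * h)) (D (real n * h)))) \<longlonglongrightarrow> 0"
proof -
  have ng: "real n * h \<in> grid h" for n :: nat unfolding grid_def by (rule rangeI)
  have dom: "(\<lambda>n. \<integral>\<^sup>+\<omega>\<in>act (real n * h). ennreal (w \<omega> * (X \<omega>)\<^sup>2) \<partial>M) \<longlonglongrightarrow> 0"
    if [measurable]: "X \<in> borel_measurable M" and fin: "(\<integral>\<^sup>+\<omega>. ennreal (w \<omega> * (X \<omega>)\<^sup>2) \<partial>M) < \<infinity>" for X :: "'a \<Rightarrow> real"
  proof -
    have "(\<lambda>n. \<integral>\<^sup>+\<omega>\<in>act (real n * h). ennreal (w \<omega> * (X \<omega>)\<^sup>2) \<partial>M) \<longlonglongrightarrow> (\<integral>\<^sup>+\<omega>. 0 \<partial>M)"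
    proof (rule nn_integral_dominated_convergence[where w = "\<lambda>\<omega>. ennreal (w \<omega> * (X \<omega>)\<^sup>2)"])
      show "AE \<omega> in M. (\<lambda>n. ennreal (w \<omega> * (X \<omega>)\<^sup>2) * indicator (act (real n * h)) \<omega>) \<longlonglongrightarrow> 0"
      proof (rule AE_I2)
        fix \<omega>
        \<comment> \<open>A path is inactive from the first grid point beyond \<sigma> on, so the
          integrand is eventually 0.\<close>
        obtain N :: nat where N: "\<sigma> \<omega> / h \<le> real N" using real_arch_simple by blast
        have "\<forall>\<^sub>F n in sequentially. ennreal (w \<omega> * (X \<omega>)\<^sup>2) * indicator (act (real n * h)) \<omega> = 0"
          using eventually_ge_at_top[of N]
        proof eventually_elim
          case (elim n)
          have "\<sigma> \<omega> \<le> real N * h" using N h_pos by (simp add: field_simps)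
          also have "\<dots> \<le> real n * h" using elim h_pos by simp
          finally show ?case by (simp add: act_def)
        qed
        then show "(\<lambda>n. ennreal (w \<omega> * (X \<omega>)\<^sup>2) * indicator (act (real n * h)) \<omega>) \<longlonglongrightarrow> 0"
          by (rule tendsto_eventually)
      qed
      show "AE \<omega> in M. ennreal (w \<omega> * (X \<omega>)\<^sup>2) * indicator (act (real n * h)) \<omega> \<le> ennreal (w \<omega> * (X \<omega>)\<^sup>2)" for n
        by (rule AE_I2) (auto split: split_indicator)
    qed (use fin in auto)
    then show ?thesis by simp
  qed
  define r where "r = (\<lambda>n::nat. exp (3 * L * (real n * h)) * (\<integral>\<omega>. (indicator {\<omega>. real n * h \<le> T \<omega>} \<omega> * R (real n * h) \<omega>)\<^sup>2 \<partial>M))"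
  have r: "(\<lambda>n. ennreal (r n)) \<longlonglongrightarrow> 0"
    using tendsto_ennrealI[OF R_tendsto] unfolding r_def by simp
  let ?u = "\<lambda>n. 2 * (\<integral>\<^sup>+\<omega>\<in>act (real n * h). ennreal (w \<omega> * (K \<omega>)\<^sup>2) \<partial>M)
    + 2 * (\<integral>\<^sup>+\<omega>\<in>act (real n * h). ennreal (w \<omega> * (B \<omega>)\<^sup>2) \<partial>M) + 2 * ennreal (r n)"
  have u0: "?u \<longlonglongrightarrow> 0"
  proof -
    have "?u \<longlonglongrightarrow> 2 * 0 + 2 * 0 + 2 * 0"
      by (intro tendsto_add ennreal_tendsto_cmult dom wK wB r) auto
    then show ?thesis by simp
  qed
  have le: "ennreal (exp (3 * L * (real n * h))) * (sqn (act (real n * h)) (D (real n * h))) \<le> ?u n" for n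
  proof -
    let ?t = "real n * h"
    let ?e = "exp (3 * L * ?t)"
    note [measurable] = D_M[OF ng] meas_F_M[OF R_F[OF ng]]
    let ?v = "\<lambda>\<omega>. (indicator {\<omega>. ?t \<le> T \<omega>} \<omega> * R ?t \<omega>)\<^sup>2"
    have iv: "integrable M ?v"
    proof -
      have "integrable M (\<lambda>\<omega>. (indicator {\<omega>\<in>space M. ?t \<le> T \<omega>} \<omega> * R ?t \<omega>)\<^sup>2)"
        by (rule square_integrable_indicator[OF _ R_L2[OF ng]]) measurable
      moreover have "integrable M ?v = integrable M (\<lambda>\<omega>. (indicator {\<omega>\<in>space M. ?t \<le> T \<omega>} \<omega> * R ?t \<omega>)\<^sup>2)"
        by (rule Bochner_Integration.integrable_cong) (auto simp: indicator_def)
      ultimately show ?thesis by simp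
    qed
    have [measurable]: "?v \<in> borel_measurable M" using iv by auto
    have "ennreal ?e * (\<integral>\<^sup>+\<omega>\<in>act ?t. ennreal ((D ?t \<omega>)\<^sup>2) \<partial>M) = (\<integral>\<^sup>+\<omega>. ennreal ?e * (ennreal ((D ?t \<omega>)\<^sup>2) * indicator (act ?t) \<omega>) \<partial>M)"
      by (rule nn_integral_cmult[symmetric]) measurable
    also have "\<dots> \<le> (\<integral>\<^sup>+\<omega>. 2 * (ennreal (w \<omega> * (K \<omega>)\<^sup>2) * indicator (act ?t) \<omega>) + 2 * (ennreal (w \<omega> * (B \<omega>)\<^sup>2) * indicator (act ?t) \<omega>)
      + 2 * (ennreal ?e * ennreal (?v \<omega>)) \<partial>M)"
    proof (rule nn_integral_mono_AE, use K_Y[OF grid_nonneg[OF ng[of n]]] in eventually_elim)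
      case (elim \<omega>)
      show ?case
      proof (cases "\<omega> \<in> act ?t")
        case True
        then have s: "?t < \<sigma> \<omega>" by (simp add: act_def)
        have ew: "?e \<le> w \<omega>" unfolding w_def using s L_pos by simp
        have Y2: "(Y ?t \<omega>)\<^sup>2 \<le> (K \<omega>)\<^sup>2" using elim K_nonneg[of \<omega>] by (intro power2_le_iff_abs_le[THEN iffD2]) auto
        have "(D ?t \<omega>)\<^sup>2 \<le> 2 * (Y ?t \<omega>)\<^sup>2 + 2 * (Yb ?t \<omega>)\<^sup>2"
          using real_sq_add_le[of 1 "Y ?t \<omega>" "- Yb ?t \<omega>"] by (simp add: D_def)
        then have "?e * (D ?t \<omega>)\<^sup>2 \<le> ?e * (2 * (Y ?t \<omega>)\<^sup>2 + 2 * (Yb ?t \<omega>)\<^sup>2)"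
          by (rule mult_left_mono) simp
        also have "\<dots> = 2 * (?e * (Y ?t \<omega>)\<^sup>2) + 2 * (?e * (Yb ?t \<omega>)\<^sup>2)" by (simp add: algebra_simps)
        also have "\<dots> \<le> 2 * (w \<omega> * (K \<omega>)\<^sup>2) + 2 * (w \<omega> * (B \<omega>)\<^sup>2 + ?e * ?v \<omega>)"
        proof (intro add_mono mult_left_mono)
          show "?e * (Y ?t \<omega>)\<^sup>2 \<le> w \<omega> * (K \<omega>)\<^sup>2" using ew Y2 w_pos[of \<omega>] by (intro mult_mono) auto
          have wB0: "0 \<le> w \<omega> * (B \<omega>)\<^sup>2" using w_pos[of \<omega>] by simp
          show "?e * (Yb ?t \<omega>)\<^sup>2 \<le> w \<omega> * (B \<omega>)\<^sup>2 + ?e * ?v \<omega>"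
          proof (cases "T \<omega> \<le> ?t")
            case True
            have "?e * (B \<omega>)\<^sup>2 \<le> w \<omega> * (B \<omega>)\<^sup>2" using ew by (rule mult_right_mono) simp
            moreover have "0 \<le> ?e * ?v \<omega>" by simp
            ultimately have "?e * (B \<omega>)\<^sup>2 \<le> w \<omega> * (B \<omega>)\<^sup>2 + ?e * ?v \<omega>" by linarith
            then show ?thesis unfolding Yb_def using True by simp
          next
            case False
            then show ?thesis unfolding Yb_def using wB0 by simp
          qed
        qed auto
        finally have "ennreal (?e * (D ?t \<omega>)\<^sup>2) \<le> ennreal (2 * (w \<omega> * (K \<omega>)\<^sup>2) + 2 * (w \<omega> * (B \<omega>)\<^sup>2 + ?e * ?v \<omega>))"
          by (rule ennreal_leI)
        also have "\<dots> = 2 * ennreal (w \<omega> * (K \<omega>)\<^sup>2) + 2 * ennreal (w \<omega> * (B \<omega>)\<^sup>2) + 2 * (ennreal ?e * ennreal (?v \<omega>))"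
        proof -
          have "0 \<le> w \<omega> * (K \<omega>)\<^sup>2" "0 \<le> w \<omega> * (B \<omega>)\<^sup>2" using w_pos[of \<omega>] by simp_all
          then show ?thesis by (simp add: ennreal_mult distrib_left add.assoc del: power_mult_distrib)
        qed
        finally show ?thesis using True by (simp add: ennreal_mult)
      qed simp
    qed
    also have "\<dots> = 2 * (\<integral>\<^sup>+\<omega>\<in>act ?t. ennreal (w \<omega> * (K \<omega>)\<^sup>2) \<partial>M) + 2 * (\<integral>\<^sup>+\<omega>\<in>act ?t. ennreal (w \<omega> * (B \<omega>)\<^sup>2) \<partial>M)
      + 2 * (ennreal ?e * (\<integral>\<^sup>+\<omega>. ennreal (?v \<omega>) \<partial>M))"
      by (simp add: nn_integral_add nn_integral_cmult)
    also have "ennreal ?e * (\<integral>\<^sup>+\<omega>. ennreal (?v \<omega>) \<partial>M) = ennreal (r n)"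
      unfolding r_def by (subst nn_integral_eq_integral[OF iv]) (auto simp: ennreal_mult')
    finally show ?thesis .
  qed
  show ?thesis
    by (rule tendsto_sandwich[OF _ _ tendsto_const u0]) (use le in auto)
qed

lemma error_bound:
  assumes wK: "(\<integral>\<^sup>+\<omega>. ennreal (w \<omega> * (K \<omega>)\<^sup>2) \<partial>M) < \<infinity>" and wB: "(\<integral>\<^sup>+\<omega>. ennreal (w \<omega> * (B \<omega>)\<^sup>2) \<partial>M) < \<infinity>"
    and t: "t \<in> grid h"
  shows "(\<integral>\<^sup>+\<omega>. ennreal ((D t \<omega>)\<^sup>2) \<partial>M) \<le> (\<integral>\<^sup>+\<omega>. fin \<omega> \<partial>M) + (\<integral>\<^sup>+\<omega>. ennreal (w \<omega>) * (\<integral>\<^sup>+s. Q \<omega> s \<partial>lborel) \<partial>M)"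
proof -
  obtain n0 :: nat where n0: "t = real n0 * h" using t by (auto simp: grid_def)
  let ?a = "\<lambda>n. ennreal (exp (3 * L * (real n * h))) * (sqn (act (real n * h)) (D (real n * h)))"
  let ?b = "(\<integral>\<^sup>+\<omega>. fin \<omega> \<partial>M) + (\<integral>\<^sup>+\<omega>. ennreal (w \<omega>) * (\<integral>\<^sup>+s. Q \<omega> s \<partial>lborel) \<partial>M)"
  have "S t \<le> ?a (m + n0) + ?b" for m
  proof -
    have tm: "t + real m * h = real (m + n0) * h" unfolding n0 by (simp add: algebra_simps)
    have "S t \<le> S (t + real m * h) + (\<integral>\<^sup>+\<omega>. ennreal (w \<omega>) * (\<integral>\<^sup>+s\<in>{t..<t + real m * h}. Q \<omega> s \<partial>lborel) \<partial>M)"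
      by (rule S_telescope[OF t])
    also have "\<dots> \<le> (?a (m + n0) + (\<integral>\<^sup>+\<omega>. fin \<omega> \<partial>M)) + (\<integral>\<^sup>+\<omega>. ennreal (w \<omega>) * (\<integral>\<^sup>+s. Q \<omega> s \<partial>lborel) \<partial>M)"
      unfolding S_def tm
      by (intro add_mono order_refl nn_integral_mono mult_left_mono) (auto split: split_indicator)
    finally show ?thesis by (simp add: add.assoc)
  qed
  moreover have "(\<lambda>m. ?a (m + n0) + ?b) \<longlonglongrightarrow> 0 + ?b"
    by (intro tendsto_add tendsto_const LIMSEQ_ignore_initial_segment[OF active_tendsto[OF wK wB]])
  ultimately have "S t \<le> 0 + ?b" by (intro LIMSEQ_le_const) auto
  then show ?thesis using D_le_S[OF t] by simp
qed

end

section \<open>Moment bounds and constants independent of h\<close>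

lemma mult_le_sum_squares: "(a::real) * b \<le> a\<^sup>2 + b\<^sup>2"
proof -
  have "0 \<le> (a - b)\<^sup>2 + a\<^sup>2 + b\<^sup>2" by simp
  then show ?thesis by (simp add: power2_diff)
qed

text \<open>This crude product bound separates the weight from the data: an exponential moment
  controls the first square, a second moment of the energy of Z the other. The extended value is
  kept because that energy may be infinite on a null set.\<close>

lemma ennreal_mult_le_sum_squares: "ennreal a * z \<le> ennreal (a\<^sup>2) + z ^ 2"
proof (cases z)
  case (real r)
  show ?thesis
  proof (cases "0 \<le> a")
    case True
    have "ennreal a * z = ennreal (a * r)" using real True by (simp add: ennreal_mult)
    also have "\<dots> \<le> ennreal (a\<^sup>2 + r\<^sup>2)" by (intro ennreal_leI mult_le_sum_squares)
    also have "\<dots> = ennreal (a\<^sup>2) + z ^ 2" using real by (simp add: ennreal_power)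
    finally show ?thesis .
  qed (simp add: ennreal_neg)
next
  case top
  have "(\<top>::ennreal) ^ 2 = \<top>" by (simp add: power2_eq_square)
  then show ?thesis using top by simp
qed

lemma diff_power4_le: "((a::real) - b) ^ 4 \<le> 8 * a ^ 4 + 8 * b ^ 4"
proof -
  have 1: "(a - b)\<^sup>2 \<le> 2 * a\<^sup>2 + 2 * b\<^sup>2" using real_sq_add_le[of 1 a "- b"] by simp
  have "(a - b) ^ 4 = ((a - b)\<^sup>2)\<^sup>2" by simp
  also have "\<dots> \<le> (2 * a\<^sup>2 + 2 * b\<^sup>2)\<^sup>2" by (intro power_mono 1) simp
  also have "\<dots> \<le> 2 * (2 * a\<^sup>2)\<^sup>2 + 2 * (2 * b\<^sup>2)\<^sup>2" using real_sq_add_le[of 1 "2 * a\<^sup>2" "2 * b\<^sup>2"] by simp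
  also have "\<dots> = 8 * a ^ 4 + 8 * b ^ 4" by (simp add: power_mult_distrib)
  finally show ?thesis .
qed

context scheme
begin

lemma Q_total:
  assumes \<omega>: "\<omega> \<in> space M"
  shows "(\<integral>\<^sup>+s. Q \<omega> s \<partial>lborel) = ennreal (3 / (2 * L)) * (\<integral>\<^sup>+s. ennreal ((dF \<omega> s)\<^sup>2) \<partial>lborel)
    + ennreal (10 / (9 * L) * (\<kappa> \<omega>)\<^sup>2) * ennreal \<bar>\<tau> \<omega> - T \<omega>\<bar>
    + ennreal (50 * L * h) * (ennreal (h * (\<kappa> \<omega>)\<^sup>2) * ennreal (T \<omega>) + (\<integral>\<^sup>+s. ennreal (zeta \<omega> s) \<partial>lborel))"
proof -
  note [measurable] = dF_section[OF \<omega>] zeta_section[OF \<omega>]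
  have "emeasure lborel {min (\<tau> \<omega>) (T \<omega>)..<max (\<tau> \<omega>) (T \<omega>)} = ennreal \<bar>\<tau> \<omega> - T \<omega>\<bar>"
    by (subst emeasure_lborel_Ico) (auto simp: max_def min_def)
  moreover have "emeasure lborel {0..<T \<omega>} = ennreal (T \<omega>)" using T_nonneg[OF \<omega>] by simp
  ultimately show ?thesis
    unfolding Q_def by (simp add: nn_integral_add nn_integral_cmult)
qed

text \<open>The squared weight is exp(6 L \<sigma>). The factor T arises from summing the
  contribution of \<kappa> over all steps and is traded for an exponential by L T \<le> exp(L
  \<sigma>); with h \<le> 1 / (12 L) this gives exp(8 L \<sigma>) and the constant 144 L^4. Both
  exponents lie below \<rho> \<sigma>.\<close>

lemma power_bounds:
  assumes \<rho>: "16 * L \<le> \<rho>" and \<omega>: "\<omega> \<in> space M"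
  shows "(w \<omega>)\<^sup>2 \<le> exp (\<rho> * \<tau> \<omega>) + exp (\<rho> * T \<omega>)"
    and "(w \<omega> * (h * T \<omega>))\<^sup>2 \<le> (exp (\<rho> * \<tau> \<omega>) + exp (\<rho> * T \<omega>)) / (144 * L ^ 4)"
proof -
  have s0: "0 \<le> \<sigma> \<omega>" using T_nonneg[OF \<omega>] unfolding \<sigma>_def by simp
  have le: "exp (c * \<sigma> \<omega>) \<le> exp (\<rho> * \<tau> \<omega>) + exp (\<rho> * T \<omega>)" if "c \<le> \<rho>" for c
  proof -
    have "exp (c * \<sigma> \<omega>) \<le> exp (\<rho> * \<sigma> \<omega>)" using that s0 by (simp add: mult_right_mono)
    also have "\<dots> \<le> exp (\<rho> * \<tau> \<omega>) + exp (\<rho> * T \<omega>)" unfolding \<sigma>_def by (simp add: max_def)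
    finally show ?thesis .
  qed
  have "(w \<omega>)\<^sup>2 = exp (6 * L * \<sigma> \<omega>)" unfolding w_def exp_double[symmetric] by (simp add: mult.assoc)
  also have "\<dots> \<le> exp (\<rho> * \<tau> \<omega>) + exp (\<rho> * T \<omega>)" using \<rho> L_pos by (intro le) simp
  finally show "(w \<omega>)\<^sup>2 \<le> exp (\<rho> * \<tau> \<omega>) + exp (\<rho> * T \<omega>)" .
  have "h * T \<omega> \<le> (1 / (12 * L)) * (exp (L * \<sigma> \<omega>) / L)"
  proof (rule mult_mono)
    show "h \<le> 1 / (12 * L)" using Lh L_pos by (simp add: field_simps)
    have "L * T \<omega> \<le> L * \<sigma> \<omega>" unfolding \<sigma>_def using L_pos by simp
    also have "\<dots> \<le> exp (L * \<sigma> \<omega>)" using exp_ge_add_one_self[of "L * \<sigma> \<omega>"] by linarith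
    finally show "T \<omega> \<le> exp (L * \<sigma> \<omega>) / L" using L_pos by (simp add: field_simps)
  qed (use T_nonneg[OF \<omega>] L_pos in auto)
  then have "w \<omega> * (h * T \<omega>) \<le> w \<omega> * ((1 / (12 * L)) * (exp (L * \<sigma> \<omega>) / L))"
    using w_pos[of \<omega>] by (intro mult_left_mono) auto
  also have "\<dots> = exp (4 * L * \<sigma> \<omega>) / (12 * L\<^sup>2)"
    unfolding w_def by (simp add: exp_add[symmetric] power2_eq_square mult.assoc)
  finally have "(w \<omega> * (h * T \<omega>))\<^sup>2 \<le> (exp (4 * L * \<sigma> \<omega>) / (12 * L\<^sup>2))\<^sup>2"
    using w_pos[of \<omega>] T_nonneg[OF \<omega>] h_pos by (intro power_mono) auto
  also have "\<dots> = exp (8 * L * \<sigma> \<omega>) / (144 * L ^ 4)"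
    by (simp add: power_divide power_mult_distrib exp_double[symmetric] mult.assoc)
  also have "\<dots> \<le> (exp (\<rho> * \<tau> \<omega>) + exp (\<rho> * T \<omega>)) / (144 * L ^ 4)"
    using \<rho> L_pos by (intro divide_right_mono le) auto
  finally show "(w \<omega> * (h * T \<omega>))\<^sup>2 \<le> (exp (\<rho> * \<tau> \<omega>) + exp (\<rho> * T \<omega>)) / (144 * L ^ 4)" .
qed

text \<open>The excess over the main term is of order h and has three sources: the overshoot factor
  exp(3 L h) in \<open>fin\<close>, the term with h, \<kappa>^2 and T, and the energy of Z. Each is
  the weight times a square-integrable quantity, hence controlled by constants free of h.\<close>

lemma final_bound:
  assumes \<rho>: "16 * L \<le> \<rho>"
    and c0: "0 \<le> cX" "0 \<le> cI" "0 \<le> cB" "0 \<le> cK" "0 \<le> cZ"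
    and X: "(\<integral>\<^sup>+\<omega>. ennreal (exp (\<rho> * \<tau> \<omega>) + exp (\<rho> * T \<omega>)) \<partial>M) \<le> ennreal cX"
    and I: "(\<integral>\<^sup>+\<omega>. ennreal ((\<xi> \<omega>) ^ 4) \<partial>M) \<le> ennreal cI"
    and B4: "(\<integral>\<^sup>+\<omega>. ennreal ((B \<omega>) ^ 4) \<partial>M) \<le> ennreal cB"
    and K4: "(\<integral>\<^sup>+\<omega>. ennreal ((\<kappa> \<omega>) ^ 4) \<partial>M) \<le> ennreal cK"
    and Z4: "(\<integral>\<^sup>+\<omega>. (\<integral>\<^sup>+s. ennreal (zeta \<omega> s) \<partial>lborel) ^ 2 \<partial>M) \<le> ennreal cZ"
    and t: "t \<in> grid h"
  shows "(\<integral>\<^sup>+\<omega>. ennreal ((D t \<omega>)\<^sup>2) \<partial>M)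
    \<le> ennreal ((4 * L * (cX + 8 * cI + 8 * cB) + 50 * L * (cX / (144 * L ^ 4) + cK + cX + cZ)) * h)
      + (\<integral>\<^sup>+\<omega>. ennreal (w \<omega>) * (ennreal ((\<xi> \<omega> - B \<omega>)\<^sup>2) + ennreal (10 / (9 * L) * (\<kappa> \<omega>)\<^sup>2 * \<bar>\<tau> \<omega> - T \<omega>\<bar>)
          + ennreal (3 / (2 * L)) * (\<integral>\<^sup>+s. ennreal ((dF \<omega> s)\<^sup>2) \<partial>lborel)) \<partial>M)"
proof -
  define x where "x = (\<lambda>\<omega>. exp (\<rho> * \<tau> \<omega>) + exp (\<rho> * T \<omega>))"
  define z where "z = (\<lambda>\<omega>. \<integral>\<^sup>+s. ennreal (zeta \<omega> s) \<partial>lborel)"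
  have [measurable]: "x \<in> borel_measurable M" "z \<in> borel_measurable M" unfolding x_def z_def by measurable
  have x0: "0 \<le> x \<omega>" for \<omega> unfolding x_def by simp
  have w2: "(w \<omega>)\<^sup>2 \<le> x \<omega>" if "\<omega> \<in> space M" for \<omega> using power_bounds(1)[OF \<rho> that] unfolding x_def .
  have wT: "(w \<omega> * (h * T \<omega>))\<^sup>2 \<le> x \<omega> / (144 * L ^ 4)" if "\<omega> \<in> space M" for \<omega>
    using power_bounds(2)[OF \<rho> that] unfolding x_def .
  have Xx: "(\<integral>\<^sup>+\<omega>. ennreal (x \<omega>) \<partial>M) \<le> ennreal cX" using X unfolding x_def .
  have Zz: "(\<integral>\<^sup>+\<omega>. (z \<omega>) ^ 2 \<partial>M) \<le> ennreal cZ" using Z4 unfolding z_def .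
  have wsq: "(\<integral>\<^sup>+\<omega>. ennreal (w \<omega> * (V \<omega>)\<^sup>2) \<partial>M) < \<infinity>"
    \<comment> \<open>The weighted second moments required for the remainder at infinity follow from
      an exponential moment and a fourth moment.\<close>
    if [measurable]: "V \<in> borel_measurable M" and V4: "(\<integral>\<^sup>+\<omega>. ennreal ((V \<omega>) ^ 4) \<partial>M) < \<infinity>" for V
  proof -
    have "(\<integral>\<^sup>+\<omega>. ennreal (w \<omega> * (V \<omega>)\<^sup>2) \<partial>M) \<le> (\<integral>\<^sup>+\<omega>. ennreal (x \<omega>) + ennreal ((V \<omega>) ^ 4) \<partial>M)"
    proof (rule nn_integral_mono)
      fix \<omega> assume \<omega>: "\<omega> \<in> space M"
      have "w \<omega> * (V \<omega>)\<^sup>2 \<le> (w \<omega>)\<^sup>2 + ((V \<omega>)\<^sup>2)\<^sup>2" by (rule mult_le_sum_squares)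
      also have "\<dots> \<le> x \<omega> + (V \<omega>) ^ 4" using w2[OF \<omega>] by simp
      finally have "ennreal (w \<omega> * (V \<omega>)\<^sup>2) \<le> ennreal (x \<omega> + (V \<omega>) ^ 4)" by (rule ennreal_leI)
      then show "ennreal (w \<omega> * (V \<omega>)\<^sup>2) \<le> ennreal (x \<omega>) + ennreal ((V \<omega>) ^ 4)" using x0 by simp
    qed
    also have "\<dots> = (\<integral>\<^sup>+\<omega>. ennreal (x \<omega>) \<partial>M) + (\<integral>\<^sup>+\<omega>. ennreal ((V \<omega>) ^ 4) \<partial>M)"
      by (rule nn_integral_add) measurable
    also have "\<dots> < \<infinity>" using order_le_less_trans[OF Xx] V4 by simp
    finally show ?thesis .
  qed
  have wB: "(\<integral>\<^sup>+\<omega>. ennreal (w \<omega> * (B \<omega>)\<^sup>2) \<partial>M) < \<infinity>"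
    by (rule wsq) (use order_le_less_trans[OF B4] in auto)
  have wK: "(\<integral>\<^sup>+\<omega>. ennreal (w \<omega> * (K \<omega>)\<^sup>2) \<partial>M) < \<infinity>"
  proof -
    have "(\<integral>\<^sup>+\<omega>. ennreal (w \<omega> * (K \<omega>)\<^sup>2) \<partial>M) \<le> (\<integral>\<^sup>+\<omega>. ennreal (w \<omega> * (\<kappa> \<omega>)\<^sup>2) \<partial>M)"
    proof (intro nn_integral_mono ennreal_leI mult_left_mono power_mono)
      fix \<omega>
      show "K \<omega> \<le> \<kappa> \<omega>" unfolding \<kappa>_def using K_nonneg[of \<omega>] L_pos by (simp add: distrib_right)
    qed (use w_pos K_nonneg in \<open>auto intro: less_imp_le\<close>)
    also have "\<dots> < \<infinity>" by (rule wsq) (use order_le_less_trans[OF K4] in auto)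
    finally show ?thesis .
  qed
  let ?m = "\<lambda>\<omega>. ennreal (w \<omega>) * (ennreal ((\<xi> \<omega> - B \<omega>)\<^sup>2) + ennreal (10 / (9 * L) * (\<kappa> \<omega>)\<^sup>2 * \<bar>\<tau> \<omega> - T \<omega>\<bar>)
          + ennreal (3 / (2 * L)) * (\<integral>\<^sup>+s. ennreal ((dF \<omega> s)\<^sup>2) \<partial>lborel))"
  let ?r = "\<lambda>\<omega>. ennreal (4 * L) * (ennreal (x \<omega>) + ennreal 8 * ennreal ((\<xi> \<omega>) ^ 4) + ennreal 8 * ennreal ((B \<omega>) ^ 4))
    + ennreal (50 * L) * (ennreal (1 / (144 * L ^ 4)) * ennreal (x \<omega>) + ennreal ((\<kappa> \<omega>) ^ 4) + ennreal (x \<omega>) + (z \<omega>) ^ 2)"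
  \<comment> \<open>As 3 L h is at most 1/4, the quadratic term of the exponential bound adds no
    more than 3/4 of L h.\<close>
  have exph: "exp (3 * L * h) \<le> 1 + 4 * L * h"
  proof -
    have y: "0 \<le> 3 * (L * h)" "3 * (L * h) \<le> 1 / 4" using L_pos h_pos Lh by auto
    then have "exp (3 * (L * h)) \<le> 1 + 3 * (L * h) + (3 * (L * h))\<^sup>2" by (intro exp_bound) auto
    also have "(3 * (L * h))\<^sup>2 \<le> 1 / 4 * (3 * (L * h))" unfolding power2_eq_square using y by (intro mult_right_mono) auto
    finally show ?thesis using y by (simp add: mult.assoc)
  qed
  have "(\<integral>\<^sup>+\<omega>. ennreal ((D t \<omega>)\<^sup>2) \<partial>M) \<le> (\<integral>\<^sup>+\<omega>. fin \<omega> \<partial>M) + (\<integral>\<^sup>+\<omega>. ennreal (w \<omega>) * (\<integral>\<^sup>+s. Q \<omega> s \<partial>lborel) \<partial>M)"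
    by (rule error_bound[OF wK wB t])
  also have "\<dots> = (\<integral>\<^sup>+\<omega>. fin \<omega> + ennreal (w \<omega>) * (\<integral>\<^sup>+s. Q \<omega> s \<partial>lborel) \<partial>M)"
    by (rule nn_integral_add[symmetric]) measurable
  also have "\<dots> \<le> (\<integral>\<^sup>+\<omega>. ennreal h * ?r \<omega> + ?m \<omega> \<partial>M)"
  proof (rule nn_integral_mono)
    fix \<omega> assume \<omega>: "\<omega> \<in> space M"
    have w0: "0 \<le> w \<omega>" using w_pos[of \<omega>] by simp
    let ?\<xi> = "w \<omega> * (\<xi> \<omega> - B \<omega>)\<^sup>2"
    have \<xi>0: "0 \<le> ?\<xi>" using w0 by simp
    have f: "fin \<omega> \<le> ennreal ?\<xi> + ennreal h * (ennreal (4 * L) * (ennreal (x \<omega>) + ennreal 8 * ennreal ((\<xi> \<omega>) ^ 4) + ennreal 8 * ennreal ((B \<omega>) ^ 4)))"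
    proof -
      have "?\<xi> \<le> (w \<omega>)\<^sup>2 + ((\<xi> \<omega> - B \<omega>)\<^sup>2)\<^sup>2" by (rule mult_le_sum_squares)
      also have "\<dots> \<le> x \<omega> + (8 * (\<xi> \<omega>) ^ 4 + 8 * (B \<omega>) ^ 4)"
        using w2[OF \<omega>] diff_power4_le[of "\<xi> \<omega>" "B \<omega>"] by (intro add_mono) auto
      finally have 1: "?\<xi> \<le> x \<omega> + 8 * (\<xi> \<omega>) ^ 4 + 8 * (B \<omega>) ^ 4" by simp
      have "exp (3 * L * h) * ?\<xi> \<le> (1 + 4 * L * h) * ?\<xi>" using exph \<xi>0 by (rule mult_right_mono)
      also have "\<dots> = ?\<xi> + h * (4 * L * ?\<xi>)" by (simp add: distrib_right)
      also have "\<dots> \<le> ?\<xi> + h * (4 * L * (x \<omega> + 8 * (\<xi> \<omega>) ^ 4 + 8 * (B \<omega>) ^ 4))"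
        using 1 h_pos L_pos by (intro add_left_mono mult_left_mono) auto
      finally have "fin \<omega> \<le> ennreal (?\<xi> + h * (4 * L * (x \<omega> + 8 * (\<xi> \<omega>) ^ 4 + 8 * (B \<omega>) ^ 4)))"
        unfolding fin_def by (intro ennreal_leI) (simp add: mult.assoc)
      also have "\<dots> = ennreal ?\<xi> + ennreal (h * (4 * L * (x \<omega> + 8 * (\<xi> \<omega>) ^ 4 + 8 * (B \<omega>) ^ 4)))"
        using \<xi>0 h_pos L_pos x0[of \<omega>] by (intro ennreal_plus) auto
      also have "ennreal (h * (4 * L * (x \<omega> + 8 * (\<xi> \<omega>) ^ 4 + 8 * (B \<omega>) ^ 4)))
        = ennreal h * (ennreal (4 * L) * (ennreal (x \<omega>) + ennreal 8 * ennreal ((\<xi> \<omega>) ^ 4) + ennreal 8 * ennreal ((B \<omega>) ^ 4)))"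
      proof -
        have "ennreal (x \<omega> + 8 * (\<xi> \<omega>) ^ 4 + 8 * (B \<omega>) ^ 4) = ennreal (x \<omega>) + ennreal 8 * ennreal ((\<xi> \<omega>) ^ 4) + ennreal 8 * ennreal ((B \<omega>) ^ 4)"
          using x0[of \<omega>] by (simp add: ennreal_mult del: ennreal_numeral)
        moreover have "0 \<le> x \<omega> + 8 * (\<xi> \<omega>) ^ 4 + 8 * (B \<omega>) ^ 4" using x0[of \<omega>] by simp
        ultimately show ?thesis using h_pos L_pos by (simp only: ennreal_mult mult_nonneg_nonneg less_imp_le zero_le_numeral)
      qed
      finally show ?thesis .
    qed
    have q: "ennreal (w \<omega>) * (ennreal (50 * L * h) * (ennreal (h * (\<kappa> \<omega>)\<^sup>2) * ennreal (T \<omega>) + z \<omega>))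
      \<le> ennreal h * (ennreal (50 * L) * (ennreal (1 / (144 * L ^ 4)) * ennreal (x \<omega>) + ennreal ((\<kappa> \<omega>) ^ 4) + ennreal (x \<omega>) + (z \<omega>) ^ 2))"
    proof -
      have a: "ennreal (w \<omega>) * (ennreal (h * (\<kappa> \<omega>)\<^sup>2) * ennreal (T \<omega>)) \<le> ennreal (1 / (144 * L ^ 4)) * ennreal (x \<omega>) + ennreal ((\<kappa> \<omega>) ^ 4)"
      proof -
        have "ennreal (w \<omega>) * (ennreal (h * (\<kappa> \<omega>)\<^sup>2) * ennreal (T \<omega>)) = ennreal (w \<omega> * (h * (\<kappa> \<omega>)\<^sup>2 * T \<omega>))"
          using w0 h_pos T_nonneg[OF \<omega>] by (simp add: ennreal_mult)
        also have "w \<omega> * (h * (\<kappa> \<omega>)\<^sup>2 * T \<omega>) = (w \<omega> * (h * T \<omega>)) * (\<kappa> \<omega>)\<^sup>2" by simp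
        also have "\<dots> \<le> (w \<omega> * (h * T \<omega>))\<^sup>2 + ((\<kappa> \<omega>)\<^sup>2)\<^sup>2" by (rule mult_le_sum_squares)
        also have "\<dots> \<le> 1 / (144 * L ^ 4) * x \<omega> + (\<kappa> \<omega>) ^ 4" using wT[OF \<omega>] by simp
        finally have "ennreal (w \<omega>) * (ennreal (h * (\<kappa> \<omega>)\<^sup>2) * ennreal (T \<omega>)) \<le> ennreal (1 / (144 * L ^ 4) * x \<omega> + (\<kappa> \<omega>) ^ 4)"
          by (simp add: ennreal_leI)
        also have "\<dots> = ennreal (1 / (144 * L ^ 4)) * ennreal (x \<omega>) + ennreal ((\<kappa> \<omega>) ^ 4)"
        proof -
          have "0 \<le> 1 / (144 * L ^ 4)" by simp
          then show ?thesis using ennreal_lincomb[of "1 / (144 * L ^ 4)" 1 "x \<omega>" "(\<kappa> \<omega>) ^ 4"] x0[of \<omega>] by simp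
        qed
        finally show ?thesis .
      qed
      have b: "ennreal (w \<omega>) * z \<omega> \<le> ennreal (x \<omega>) + (z \<omega>) ^ 2"
        using ennreal_mult_le_sum_squares[of "w \<omega>" "z \<omega>"] ennreal_leI[OF w2[OF \<omega>]] by (meson add_right_mono order_trans)
      have "ennreal (w \<omega>) * (ennreal (50 * L * h) * (ennreal (h * (\<kappa> \<omega>)\<^sup>2) * ennreal (T \<omega>) + z \<omega>))
        = ennreal (50 * L * h) * (ennreal (w \<omega>) * (ennreal (h * (\<kappa> \<omega>)\<^sup>2) * ennreal (T \<omega>)) + ennreal (w \<omega>) * z \<omega>)"
        unfolding distrib_left[symmetric] by (rule mult.left_commute)
      also have "\<dots> \<le> ennreal (50 * L * h) * ((ennreal (1 / (144 * L ^ 4)) * ennreal (x \<omega>) + ennreal ((\<kappa> \<omega>) ^ 4)) + (ennreal (x \<omega>) + (z \<omega>) ^ 2))"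
        by (intro mult_left_mono add_mono a b) simp
      also have "\<dots> = ennreal h * (ennreal (50 * L) * (ennreal (1 / (144 * L ^ 4)) * ennreal (x \<omega>) + ennreal ((\<kappa> \<omega>) ^ 4) + ennreal (x \<omega>) + (z \<omega>) ^ 2))"
      proof -
        have "ennreal (50 * L * h) = ennreal h * ennreal (50 * L)"
          using h_pos L_pos by (simp add: ennreal_mult[symmetric] mult.commute)
        then show ?thesis by (simp only: mult.assoc add.assoc)
      qed
      finally show ?thesis .
    qed
    have "fin \<omega> + ennreal (w \<omega>) * (\<integral>\<^sup>+s. Q \<omega> s \<partial>lborel)
      = fin \<omega> + (ennreal (w \<omega>) * (ennreal (50 * L * h) * (ennreal (h * (\<kappa> \<omega>)\<^sup>2) * ennreal (T \<omega>) + z \<omega>))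
        + ennreal (w \<omega>) * (ennreal (10 / (9 * L) * (\<kappa> \<omega>)\<^sup>2 * \<bar>\<tau> \<omega> - T \<omega>\<bar>) + ennreal (3 / (2 * L)) * (\<integral>\<^sup>+s. ennreal ((dF \<omega> s)\<^sup>2) \<partial>lborel)))"
    proof -
      have 1: "(\<integral>\<^sup>+s. ennreal (zeta \<omega> s) \<partial>lborel) = z \<omega>" by (simp add: z_def)
      have 2: "ennreal (10 / (9 * L) * (\<kappa> \<omega>)\<^sup>2 * \<bar>\<tau> \<omega> - T \<omega>\<bar>) = ennreal (10 / (9 * L) * (\<kappa> \<omega>)\<^sup>2) * ennreal \<bar>\<tau> \<omega> - T \<omega>\<bar>"
        by (rule ennreal_mult'') simp
      show ?thesis unfolding Q_total[OF \<omega>] 1 2 by (simp only: distrib_left add_ac)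
    qed
    also have "\<dots> \<le> (ennreal ?\<xi> + ennreal h * (ennreal (4 * L) * (ennreal (x \<omega>) + ennreal 8 * ennreal ((\<xi> \<omega>) ^ 4) + ennreal 8 * ennreal ((B \<omega>) ^ 4))))
       + (ennreal h * (ennreal (50 * L) * (ennreal (1 / (144 * L ^ 4)) * ennreal (x \<omega>) + ennreal ((\<kappa> \<omega>) ^ 4) + ennreal (x \<omega>) + (z \<omega>) ^ 2))
        + ennreal (w \<omega>) * (ennreal (10 / (9 * L) * (\<kappa> \<omega>)\<^sup>2 * \<bar>\<tau> \<omega> - T \<omega>\<bar>) + ennreal (3 / (2 * L)) * (\<integral>\<^sup>+s. ennreal ((dF \<omega> s)\<^sup>2) \<partial>lborel)))"
      by (intro add_mono f q order_refl)
    also have "\<dots> = ennreal h * ?r \<omega> + ?m \<omega>"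
    proof -
      have "ennreal ?\<xi> = ennreal (w \<omega>) * ennreal ((\<xi> \<omega> - B \<omega>)\<^sup>2)" using w0 by (simp add: ennreal_mult)
      then show ?thesis by (simp only: distrib_left add_ac)
    qed
    finally show "fin \<omega> + ennreal (w \<omega>) * (\<integral>\<^sup>+s. Q \<omega> s \<partial>lborel) \<le> ennreal h * ?r \<omega> + ?m \<omega>" .
  qed
  also have "\<dots> = (\<integral>\<^sup>+\<omega>. ennreal h * ?r \<omega> \<partial>M) + (\<integral>\<^sup>+\<omega>. ?m \<omega> \<partial>M)"
    by (rule nn_integral_add) measurable
  also have "(\<integral>\<^sup>+\<omega>. ennreal h * ?r \<omega> \<partial>M) = ennreal h * (ennreal (4 * L) * ((\<integral>\<^sup>+\<omega>. ennreal (x \<omega>) \<partial>M) + ennreal 8 * (\<integral>\<^sup>+\<omega>. ennreal ((\<xi> \<omega>) ^ 4) \<partial>M) + ennreal 8 * (\<integral>\<^sup>+\<omega>. ennreal ((B \<omega>) ^ 4) \<partial>M))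
    + ennreal (50 * L) * (ennreal (1 / (144 * L ^ 4)) * (\<integral>\<^sup>+\<omega>. ennreal (x \<omega>) \<partial>M) + (\<integral>\<^sup>+\<omega>. ennreal ((\<kappa> \<omega>) ^ 4) \<partial>M) + (\<integral>\<^sup>+\<omega>. ennreal (x \<omega>) \<partial>M) + (\<integral>\<^sup>+\<omega>. (z \<omega>) ^ 2 \<partial>M)))"
    by (simp add: nn_integral_add nn_integral_cmult del: ennreal_numeral)
  also have "\<dots> \<le> ennreal h * (ennreal (4 * L) * (ennreal cX + ennreal 8 * ennreal cI + ennreal 8 * ennreal cB)
    + ennreal (50 * L) * (ennreal (1 / (144 * L ^ 4)) * ennreal cX + ennreal cK + ennreal cX + ennreal cZ))"
    by (intro mult_left_mono add_mono Xx I B4 K4 Zz) auto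
  also have "\<dots> = ennreal ((4 * L * (cX + 8 * cI + 8 * cB) + 50 * L * (cX / (144 * L ^ 4) + cK + cX + cZ)) * h)"
  proof -
    define a where "a = 1 / (144 * L ^ 4)"
    have a0: "0 \<le> a" unfolding a_def by simp
    have "ennreal h * (ennreal (4 * L) * (ennreal cX + ennreal 8 * ennreal cI + ennreal 8 * ennreal cB)
      + ennreal (50 * L) * (ennreal a * ennreal cX + ennreal cK + ennreal cX + ennreal cZ))
      = ennreal (h * (4 * L * (cX + 8 * cI + 8 * cB) + 50 * L * (a * cX + cK + cX + cZ)))"
      using c0 h_pos L_pos a0
      by (simp only: ennreal_mult[symmetric] ennreal_plus[symmetric] mult_nonneg_nonneg add_nonneg_nonneg less_imp_le zero_le_numeral)
    then show ?thesis unfolding a_def by (simp add: mult.commute)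
  qed
  finally show ?thesis by (simp add: add_right_mono)
qed

end

section \<open>The error bound\<close>

theorem mainTheorem1:
  fixes M :: "'a measure" and W :: "real \<Rightarrow> 'a \<Rightarrow> real^'d::finite"
    and \<tau> :: "'a \<Rightarrow> real" and \<xi> :: "'a \<Rightarrow> real" and f :: "real \<Rightarrow> 'a \<Rightarrow> real \<Rightarrow> real"
    and Lf m p0 p h0 :: real
    and \<tau>h :: "real \<Rightarrow> 'a \<Rightarrow> real" and \<xi>b :: "real \<Rightarrow> 'a \<Rightarrow> real"
    and fh :: "real \<Rightarrow> real \<Rightarrow> 'a \<Rightarrow> real \<Rightarrow> real"
    and Y :: "real \<Rightarrow> 'a \<Rightarrow> real" and Z :: "real \<Rightarrow> 'a \<Rightarrow> real^'d"
  defines "F \<equiv> bm_filtration M W"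
  assumes BM: "brownian_motion M W"
    and tau_stop: "stopping_time F \<tau>" and tau_nonneg: "\<forall>\<omega>\<in>space M. 0 \<le> \<tau> \<omega>"
    and m_pos: "m > 0" and exp_m: "integrable M (\<lambda>\<omega>. exp (m * \<tau> \<omega>))"
    and p0: "p0 \<ge> 4"
    and xi_meas: "\<xi> \<in> borel_measurable (filtration.pre_sigma (space M) F \<tau>)"
    and xi_Lp0: "(\<integral>\<^sup>+\<omega>. ennreal (\<bar>\<xi> \<omega>\<bar> powr p0) \<partial>M) < \<infinity>"
    and Lf_pos: "Lf > 0"
    and f_lip: "\<forall>s \<omega> y y'. \<bar>f s \<omega> y - f s \<omega> y'\<bar> \<le> Lf * \<bar>y - y'\<bar>"
    and f_prog: "\<forall>y. progressive F (\<lambda>s \<omega>. f s \<omega> y)"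
    and sol: "bsde_solution M W \<tau> \<xi> f Y Z"
    \<comment> \<open>(h)\<close>
    and h0_pos: "h0 > 0" and h0_bound: "h0 < min Lf (1 / (12 * Lf))"
    \<comment> \<open>discrete data, for every h in (0,h0]\<close>
    and tauh_grid: "\<forall>h\<in>{0<..h0}. \<forall>\<omega>\<in>space M. \<tau>h h \<omega> \<in> grid h"
    and tauh_stop: "\<forall>h\<in>{0<..h0}. stopping_time F (\<tau>h h)"
    \<comment> \<open>(R-q) with q = 4\<close>
    and Rq: "\<exists>\<rho>. \<rho> > 4 * 4 * Lf \<and> integrable M (\<lambda>\<omega>. exp (\<rho> * \<tau> \<omega>)) \<and>
               (\<integral>\<^sup>+\<omega>. (SUP h\<in>{0<..h0}. ennreal (exp (\<rho> * \<tau>h h \<omega>))) \<partial>M) < \<infinity>"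
    \<comment> \<open>(pi-F) with p > 8\<close>
    and p_gt: "p > 8"
    and fh_lip: "\<forall>h\<in>{0<..h0}. \<forall>t\<in>grid h. \<forall>\<omega> y y'. \<bar>fh h t \<omega> y - fh h t \<omega> y'\<bar> \<le> Lf * \<bar>y - y'\<bar>"
    and fh_adapt: "\<forall>h\<in>{0<..h0}. \<forall>t\<in>grid h. \<forall>A. A \<in> borel_measurable (F t) \<longrightarrow>
                     (\<lambda>\<omega>. fh h t \<omega> (A \<omega>)) \<in> borel_measurable (F t)"
    and fh_int: "(\<integral>\<^sup>+\<omega>. (SUP h\<in>{0<..h0}. SUP t\<in>grid h \<inter> {0..max (\<tau> \<omega>) (\<tau>h h \<omega>)}.
                     ennreal (\<bar>fh h t \<omega> 0\<bar> powr p)) \<partial>M) < \<infinity>"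
    \<comment> \<open>(pi-T) with p = 8\<close>
    and xib_meas: "\<forall>h\<in>{0<..h0}. \<xi>b h \<in> borel_measurable (filtration.pre_sigma (space M) F (\<tau>h h))"
    and xib_int: "(\<integral>\<^sup>+\<omega>. (SUP h\<in>{0<..h0}. ennreal (\<bar>\<xi>b h \<omega>\<bar> ^ 8)) \<partial>M) < \<infinity>"
  shows "\<exists>(V::'a \<Rightarrow> real) (C::real).
           V \<in> borel_measurable M \<and> integrable M (\<lambda>\<omega>. (V \<omega>)\<^sup>2) \<and> (\<forall>\<omega>\<in>space M. V \<omega> \<ge> 0) \<and>
           C > 0 \<and>
           (\<forall>h\<in>{0<..h0}. \<forall>Yb. discrete_solution M F Lf h (\<tau>h h) (\<xi>b h) (fh h) Yb \<longrightarrow>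
              (SUP t\<in>grid h. \<integral>\<^sup>+\<omega>. ennreal ((Y t \<omega> - Yb t \<omega>)\<^sup>2) \<partial>M)
              \<le> ennreal (C * h) +
                 (\<integral>\<^sup>+\<omega>. ennreal (exp (3 * Lf * max (\<tau> \<omega>) (\<tau>h h \<omega>))) *
                    (ennreal ((\<xi> \<omega> - \<xi>b h \<omega>)\<^sup>2) + ennreal (2 * V \<omega> * \<bar>\<tau> \<omega> - \<tau>h h \<omega>\<bar>)
                     + ennreal (3 / (2 * Lf)) *
                       (\<integral>\<^sup>+s\<in>{0..\<tau> \<omega>}. ennreal ((f s \<omega> (Y s \<omega>) - fh h (phi h s) \<omega> (Y s \<omega>))\<^sup>2) \<partial>lborel))
                  \<partial>M))"
proof -
  interpret prob_space M using BM by (simp add: brownian_motion_def)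
  interpret br: brownian M W by unfold_locales (rule BM)
  have F: "F = bm_filtration M W" by (simp add: F_def)
  obtain \<rho> where \<rho>: "16 * Lf < \<rho>" "integrable M (\<lambda>\<omega>. exp (\<rho> * \<tau> \<omega>))"
    "(\<integral>\<^sup>+\<omega>. (SUP h\<in>{0<..h0}. ennreal (exp (\<rho> * \<tau>h h \<omega>))) \<partial>M) < \<infinity>"
    using Rq by auto
  have pre_M: "X \<in> borel_measurable M" if "stopping_time F S" "X \<in> borel_measurable (filtration.pre_sigma (space M) F S)"
    for S X :: "'a \<Rightarrow> real"
    using br.measurable_pre_sigma_M that unfolding F by blast
  have xi_M[measurable]: "\<xi> \<in> borel_measurable M" by (rule pre_M[OF tau_stop xi_meas])
  interpret bs: bsde M W \<tau> \<xi> f Lf Y Z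
    by unfold_locales (use tau_stop tau_nonneg xi_M f_lip f_prog sol in \<open>auto simp: F\<close>)
  have hb: "h > 0" "Lf * h \<le> 1 / 12" if "h \<in> {0<..h0}" for h
  proof -
    show "h > 0" using that by simp
    have "h < 1 / (12 * Lf)" using that h0_bound by auto
    then have "Lf * h \<le> Lf * (1 / (12 * Lf))" using Lf_pos by (intro mult_left_mono) auto
    then show "Lf * h \<le> 1 / 12" using Lf_pos by simp
  qed
  have max_nn: "0 \<le> max (\<tau> \<omega>) (S \<omega>)" if "\<omega> \<in> space M" for \<omega> and S :: "'a \<Rightarrow> real"
    using tau_nonneg that by (auto simp: le_max_iff_disj)

  have Y_sup: "(\<integral>\<^sup>+\<omega>. (SUP s\<in>{0..}. ennreal (\<bar>Y s \<omega>\<bar> ^ 4)) \<partial>M) < \<infinity>"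
    using sol unfolding bsde_solution_def by auto
  obtain gY where gY: "gY \<in> borel_measurable M" "(\<integral>\<^sup>+\<omega>. gY \<omega> \<partial>M) < \<infinity>"
    "\<forall>u\<in>borel_measurable M. (\<forall>\<omega>\<in>space M. u \<omega> \<le> (SUP s\<in>{0..}. ennreal (\<bar>Y s \<omega>\<bar> ^ 4))) \<longrightarrow> (AE \<omega> in M. u \<omega> \<le> gY \<omega>)"
    using nn_integral_lower_envelope[OF Y_sup] by (elim bexE conjE)
  obtain gF where gF: "gF \<in> borel_measurable M" "(\<integral>\<^sup>+\<omega>. gF \<omega> \<partial>M) < \<infinity>"
    "\<forall>u\<in>borel_measurable M. (\<forall>\<omega>\<in>space M. u \<omega> \<le> (SUP h\<in>{0<..h0}. SUP t\<in>grid h \<inter> {0..max (\<tau> \<omega>) (\<tau>h h \<omega>)}. ennreal (\<bar>fh h t \<omega> 0\<bar> powr p)))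
      \<longrightarrow> (AE \<omega> in M. u \<omega> \<le> gF \<omega>)"
    using nn_integral_lower_envelope[OF fh_int] by (elim bexE conjE)
  note [measurable] = gY(1) gF(1)
  \<comment> \<open>\<open>enn2real\<close> sends infinity to 0, which is harmless because gY and gF
    are finite almost everywhere. The maximum with 1 covers values below 1, for which the power p
    does not dominate the fourth power.\<close>
  define m where "m = (\<lambda>\<omega>. max 1 (enn2real (gY \<omega>) + enn2real (gF \<omega>)))"
  \<comment> \<open>The fourth root puts K in L4, so that the squared envelope, and with it V, is in
    L2.\<close>
  define K where "K = (\<lambda>\<omega>. root 4 (m \<omega>))"
  have [measurable]: "m \<in> borel_measurable M" unfolding m_def by measurable
  have KM[measurable]: "K \<in> borel_measurable M" unfolding K_def by measurable
  have m1: "1 \<le> m \<omega>" for \<omega> by (simp add: m_def)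
  have K4: "K \<omega> ^ 4 = m \<omega>" for \<omega> unfolding K_def using m1[of \<omega>] by (simp add: real_root_pow_pos2)
  have K1: "1 \<le> K \<omega>" for \<omega> unfolding K_def using m1[of \<omega>] by simp
  have K4_int: "(\<integral>\<^sup>+\<omega>. ennreal (K \<omega> ^ 4) \<partial>M) < \<infinity>"
  proof -
    have "(\<integral>\<^sup>+\<omega>. ennreal (K \<omega> ^ 4) \<partial>M) \<le> (\<integral>\<^sup>+\<omega>. 1 + (gY \<omega> + gF \<omega>) \<partial>M)"
    proof (rule nn_integral_mono)
      fix \<omega>
      have e: "ennreal (enn2real y) \<le> y" for y by (cases y) auto
      have "ennreal (m \<omega>) \<le> ennreal (1 + (enn2real (gY \<omega>) + enn2real (gF \<omega>)))"
        unfolding m_def by (intro ennreal_leI) auto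
      also have "\<dots> = 1 + (ennreal (enn2real (gY \<omega>)) + ennreal (enn2real (gF \<omega>)))" by simp
      also have "\<dots> \<le> 1 + (gY \<omega> + gF \<omega>)" by (intro add_mono e order_refl)
      finally show "ennreal (K \<omega> ^ 4) \<le> 1 + (gY \<omega> + gF \<omega>)" unfolding K4 .
    qed
    also have "\<dots> = 1 + ((\<integral>\<^sup>+\<omega>. gY \<omega> \<partial>M) + (\<integral>\<^sup>+\<omega>. gF \<omega> \<partial>M))"
      by (simp add: nn_integral_add emeasure_space_1)
    also have "\<dots> < \<infinity>" using gY(2) gF(2) by simp
    finally show ?thesis .
  qed
  have K4_integrable: "integrable M (\<lambda>\<omega>. K \<omega> ^ 4)"
    by (rule integrableI_bounded) (use K4_int m1 in \<open>auto simp: K4 abs_of_nonneg order_trans[OF zero_le_one]\<close>)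
  have K2: "integrable M (\<lambda>\<omega>. (K \<omega>)\<^sup>2)"
  proof (rule square_integrable_imp_integrable)
    show "integrable M (\<lambda>\<omega>. ((K \<omega>)\<^sup>2)\<^sup>2)" using K4_integrable by simp
  qed measurable
  have K_Y: "AE \<omega> in M. \<bar>Y s \<omega>\<bar> \<le> K \<omega>" if s: "0 \<le> s" for s
  proof -
    note [measurable] = bs.Y_M[OF s]
    have "AE \<omega> in M. ennreal (\<bar>Y s \<omega>\<bar> ^ 4) \<le> gY \<omega>"
      by (rule gY(3)[rule_format]) (use s in \<open>auto intro!: SUP_upper\<close>)
    moreover have "AE \<omega> in M. gY \<omega> \<noteq> \<infinity>" by (rule nn_integral_PInf_AE) (use gY in auto)
    ultimately show ?thesis
    proof eventually_elim
      case (elim \<omega>)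
      then have "\<bar>Y s \<omega>\<bar> ^ 4 \<le> enn2real (gY \<omega>)"
        using enn2real_mono[of "ennreal (\<bar>Y s \<omega>\<bar> ^ 4)" "gY \<omega>"] by (simp add: less_top)
      also have "\<dots> \<le> K \<omega> ^ 4" unfolding K4 m_def by (simp add: le_max_iff_disj)
      finally show ?case by (rule power_le_imp_le_base[of _ 3, simplified]) (use K1[of \<omega>] in auto)
    qed
  qed
  have K_g: "AE \<omega> in M. t \<le> max (\<tau> \<omega>) (\<tau>h h \<omega>) \<longrightarrow> \<bar>fh h t \<omega> 0\<bar> \<le> K \<omega>"
    if h: "h \<in> {0<..h0}" and t: "t \<in> grid h" for h t
  proof -
    have t0: "0 \<le> t" using t hb(1)[OF h] by (auto simp: grid_def)
    have [measurable]: "\<tau>h h \<in> borel_measurable M" using tauh_stop h br.stopping_M unfolding F by blast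
    have "(\<lambda>\<omega>. fh h t \<omega> 0) \<in> borel_measurable (F t)" using fh_adapt h t by auto
    then have [measurable]: "(\<lambda>\<omega>. fh h t \<omega> 0) \<in> borel_measurable M" using br.meas_F_M unfolding F by blast
    \<comment> \<open>A single member of the family, set to 0 when t lies beyond the random horizon;
      it is measurable and everywhere below the supremum, so the envelope applies to it.\<close>
    define u where "u = (\<lambda>\<omega>. if t \<le> max (\<tau> \<omega>) (\<tau>h h \<omega>) then ennreal (\<bar>fh h t \<omega> 0\<bar> powr p) else 0)"
    have "AE \<omega> in M. u \<omega> \<le> gF \<omega>"
    proof (rule gF(3)[rule_format])
      show "u \<in> borel_measurable M" unfolding u_def by measurable
      show "u \<omega> \<le> (SUP h\<in>{0<..h0}. SUP t\<in>grid h \<inter> {0..max (\<tau> \<omega>) (\<tau>h h \<omega>)}. ennreal (\<bar>fh h t \<omega> 0\<bar> powr p))" for \<omega>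
      proof (cases "t \<le> max (\<tau> \<omega>) (\<tau>h h \<omega>)")
        case True
        show ?thesis
          by (rule SUP_upper2[OF h], rule SUP_upper2[of t]) (use t t0 True in \<open>auto simp: u_def\<close>)
      qed (simp add: u_def)
    qed
    moreover have "AE \<omega> in M. gF \<omega> \<noteq> \<infinity>" by (rule nn_integral_PInf_AE) (use gF in auto)
    ultimately show ?thesis
    proof eventually_elim
      case (elim \<omega>)
      show ?case
      proof
        assume "t \<le> max (\<tau> \<omega>) (\<tau>h h \<omega>)"
        then have le: "\<bar>fh h t \<omega> 0\<bar> powr p \<le> enn2real (gF \<omega>)"
          using elim enn2real_mono[of "ennreal (\<bar>fh h t \<omega> 0\<bar> powr p)" "gF \<omega>"] by (simp add: u_def less_top)
        show "\<bar>fh h t \<omega> 0\<bar> \<le> K \<omega>"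
        proof (cases "\<bar>fh h t \<omega> 0\<bar> \<le> 1")
          case True
          then show ?thesis using K1[of \<omega>] by simp
        next
          case False
          then have "\<bar>fh h t \<omega> 0\<bar> ^ 4 = \<bar>fh h t \<omega> 0\<bar> powr 4" by (simp add: powr_numeral)
          also have "\<dots> \<le> \<bar>fh h t \<omega> 0\<bar> powr p" using False p_gt by (intro powr_mono) auto
          also have "\<dots> \<le> K \<omega> ^ 4" using le unfolding K4 m_def by (simp add: le_max_iff_disj add_increasing)
          finally show ?thesis by (rule power_le_imp_le_base[of _ 3, simplified]) (use K1[of \<omega>] in auto)
        qed
      qed
    qed
  qed

  define kap where "kap = (\<lambda>\<omega>. (1 + Lf) * K \<omega>)"
  have [measurable]: "kap \<in> borel_measurable M" unfolding kap_def by measurable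
  have kap4: "(\<integral>\<^sup>+\<omega>. ennreal ((kap \<omega>) ^ 4) \<partial>M) < \<infinity>"
  proof -
    have "(\<integral>\<^sup>+\<omega>. ennreal ((kap \<omega>) ^ 4) \<partial>M) = (\<integral>\<^sup>+\<omega>. ennreal ((1 + Lf) ^ 4) * ennreal (K \<omega> ^ 4) \<partial>M)"
      unfolding kap_def by (intro nn_integral_cong) (simp add: power_mult_distrib ennreal_mult)
    also have "\<dots> = ennreal ((1 + Lf) ^ 4) * (\<integral>\<^sup>+\<omega>. ennreal (K \<omega> ^ 4) \<partial>M)"
      by (rule nn_integral_cmult) measurable
    also have "\<dots> < \<infinity>" using K4_int by (simp add: ennreal_mult_less_top)
    finally show ?thesis .
  qed
  have xi4: "(\<integral>\<^sup>+\<omega>. ennreal ((\<xi> \<omega>) ^ 4) \<partial>M) < \<infinity>"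
  proof -
    have "(\<integral>\<^sup>+\<omega>. ennreal ((\<xi> \<omega>) ^ 4) \<partial>M) \<le> (\<integral>\<^sup>+\<omega>. 1 + ennreal (\<bar>\<xi> \<omega>\<bar> powr p0) \<partial>M)"
    proof (rule nn_integral_mono)
      fix \<omega>
      have "(\<xi> \<omega>) ^ 4 \<le> 1 + \<bar>\<xi> \<omega>\<bar> powr p0"
      proof (cases "\<bar>\<xi> \<omega>\<bar> \<le> 1")
        case True
        then have "\<bar>\<xi> \<omega>\<bar> ^ 4 \<le> 1" by (intro power_le_one) auto
        then show ?thesis by (simp add: add_increasing2)
      next
        case False
        then have "\<bar>\<xi> \<omega>\<bar> ^ 4 = \<bar>\<xi> \<omega>\<bar> powr 4" by (simp add: powr_numeral)
        also have "\<dots> \<le> \<bar>\<xi> \<omega>\<bar> powr p0" using False p0 by (intro powr_mono) auto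
        finally show ?thesis by simp
      qed
      then have "ennreal ((\<xi> \<omega>) ^ 4) \<le> ennreal (1 + \<bar>\<xi> \<omega>\<bar> powr p0)" by (rule ennreal_leI)
      then show "ennreal ((\<xi> \<omega>) ^ 4) \<le> 1 + ennreal (\<bar>\<xi> \<omega>\<bar> powr p0)" by simp
    qed
    also have "\<dots> = 1 + (\<integral>\<^sup>+\<omega>. ennreal (\<bar>\<xi> \<omega>\<bar> powr p0) \<partial>M)"
      by (simp add: nn_integral_add emeasure_space_1)
    also have "\<dots> < \<infinity>" using xi_Lp0 by simp
    finally show ?thesis .
  qed
  have zeta4: "(\<integral>\<^sup>+\<omega>. (\<integral>\<^sup>+s. ennreal (bs.zeta \<omega> s) \<partial>lborel) ^ 2 \<partial>M) < \<infinity>"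
  proof -
    have "(\<integral>\<^sup>+\<omega>. (\<integral>\<^sup>+s. ennreal (bs.zeta \<omega> s) \<partial>lborel) ^ 2 \<partial>M)
      \<le> (\<integral>\<^sup>+\<omega>. (\<integral>\<^sup>+s\<in>{0..}. ennreal ((norm (Z s \<omega>))\<^sup>2) \<partial>lborel) ^ 2 \<partial>M)"
      by (intro nn_integral_mono power_mono) (auto simp: bs.zeta_def split: split_indicator)
    also have "\<dots> < \<infinity>" using sol unfolding bsde_solution_def by auto
    finally show ?thesis .
  qed
  have to_real: "\<exists>c. 0 \<le> c \<and> e \<le> ennreal c" if "e < \<infinity>" for e :: ennreal
    using that by (cases e) auto
  obtain cI where cI: "0 \<le> cI" "(\<integral>\<^sup>+\<omega>. ennreal ((\<xi> \<omega>) ^ 4) \<partial>M) \<le> ennreal cI" using to_real[OF xi4] by blast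
  obtain cK where cK: "0 \<le> cK" "(\<integral>\<^sup>+\<omega>. ennreal ((kap \<omega>) ^ 4) \<partial>M) \<le> ennreal cK" using to_real[OF kap4] by blast
  obtain cZ where cZ: "0 \<le> cZ" "(\<integral>\<^sup>+\<omega>. (\<integral>\<^sup>+s. ennreal (bs.zeta \<omega> s) \<partial>lborel) ^ 2 \<partial>M) \<le> ennreal cZ" using to_real[OF zeta4] by blast
  \<comment> \<open>The summand 1 comes from bounding a fourth power by 1 plus the eighth
    power.\<close>
  have "1 + (\<integral>\<^sup>+\<omega>. (SUP h\<in>{0<..h0}. ennreal (\<bar>\<xi>b h \<omega>\<bar> ^ 8)) \<partial>M) < \<infinity>" using xib_int by simp
  from to_real[OF this] obtain cB where cB: "0 \<le> cB" "1 + (\<integral>\<^sup>+\<omega>. (SUP h\<in>{0<..h0}. ennreal (\<bar>\<xi>b h \<omega>\<bar> ^ 8)) \<partial>M) \<le> ennreal cB" by blast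
  have "(\<integral>\<^sup>+\<omega>. ennreal (exp (\<rho> * \<tau> \<omega>)) \<partial>M) + (\<integral>\<^sup>+\<omega>. (SUP h\<in>{0<..h0}. ennreal (exp (\<rho> * \<tau>h h \<omega>))) \<partial>M) < \<infinity>"
    using \<rho>(2,3) by (simp add: nn_integral_eq_integral)
  from to_real[OF this] obtain cX where cX: "0 \<le> cX"
    "(\<integral>\<^sup>+\<omega>. ennreal (exp (\<rho> * \<tau> \<omega>)) \<partial>M) + (\<integral>\<^sup>+\<omega>. (SUP h\<in>{0<..h0}. ennreal (exp (\<rho> * \<tau>h h \<omega>))) \<partial>M) \<le> ennreal cX" by blast

  \<comment> \<open>Half of the coefficient 10 / (9 Lf) of the strip between the two stopping times
    in Q, because the claim carries the factor 2 V.\<close>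
  define V where "V = (\<lambda>\<omega>. 5 / (9 * Lf) * (kap \<omega>)\<^sup>2)"
  \<comment> \<open>The summand 1 secures strict positivity; every other constant is already uniform
    in h.\<close>
  define C where "C = 1 + (4 * Lf * (cX + 8 * cI + 8 * cB) + 50 * Lf * (cX / (144 * Lf ^ 4) + cK + cX + cZ))"
  have Vm: "V \<in> borel_measurable M" unfolding V_def by measurable
  have V2: "integrable M (\<lambda>\<omega>. (V \<omega>)\<^sup>2)"
  proof -
    have "integrable M (\<lambda>\<omega>. kap \<omega> ^ 4)" by (rule integrableI_bounded) (use kap4 in \<open>auto simp: power_abs\<close>)
    then have "integrable M (\<lambda>\<omega>. (5 / (9 * Lf))\<^sup>2 * kap \<omega> ^ 4)" by (rule integrable_mult_right)
    moreover have "(V \<omega>)\<^sup>2 = (5 / (9 * Lf))\<^sup>2 * kap \<omega> ^ 4" for \<omega>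
      unfolding V_def power_mult_distrib by simp
    ultimately show ?thesis by simp
  qed
  have V0: "V \<omega> \<ge> 0" for \<omega> unfolding V_def using Lf_pos by simp
  have C0: "C > 0" unfolding C_def using cI cK cZ cB cX Lf_pos by (intro add_pos_nonneg add_nonneg_nonneg mult_nonneg_nonneg) auto
  show ?thesis
  proof (intro exI[of _ V] exI[of _ C] conjI ballI allI impI Vm V2 V0 C0)
    fix h Yb assume h: "h \<in> {0<..h0}" and ds: "discrete_solution M F Lf h (\<tau>h h) (\<xi>b h) (fh h) Yb"
    have Tst: "stopping_time F (\<tau>h h)" using tauh_stop h by blast
    have [measurable]: "\<tau>h h \<in> borel_measurable M" using Tst br.stopping_M unfolding F by blast
    have bM[measurable]: "\<xi>b h \<in> borel_measurable M" by (rule pre_M[OF Tst]) (use xib_meas h in blast)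
    have b4: "(\<integral>\<^sup>+\<omega>. ennreal ((\<xi>b h \<omega>) ^ 4) \<partial>M) \<le> ennreal cB"
    proof -
      have "(\<integral>\<^sup>+\<omega>. ennreal ((\<xi>b h \<omega>) ^ 4) \<partial>M) \<le> (\<integral>\<^sup>+\<omega>. 1 + ennreal (\<bar>\<xi>b h \<omega>\<bar> ^ 8) \<partial>M)"
      proof (rule nn_integral_mono)
        fix \<omega>
        have "0 \<le> ((\<xi>b h \<omega>) ^ 4 - 1)\<^sup>2" by simp
        then have "2 * (\<xi>b h \<omega>) ^ 4 \<le> 1 + (\<xi>b h \<omega>) ^ 8" by (simp add: power2_diff)
        moreover have "0 \<le> (\<xi>b h \<omega>) ^ 4" "\<bar>\<xi>b h \<omega>\<bar> ^ 8 = (\<xi>b h \<omega>) ^ 8" by simp_all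
        ultimately have "(\<xi>b h \<omega>) ^ 4 \<le> 1 + \<bar>\<xi>b h \<omega>\<bar> ^ 8" by linarith
        then have "ennreal ((\<xi>b h \<omega>) ^ 4) \<le> ennreal (1 + \<bar>\<xi>b h \<omega>\<bar> ^ 8)" by (rule ennreal_leI)
        then show "ennreal ((\<xi>b h \<omega>) ^ 4) \<le> 1 + ennreal (\<bar>\<xi>b h \<omega>\<bar> ^ 8)" by simp
      qed
      also have "\<dots> = 1 + (\<integral>\<^sup>+\<omega>. ennreal (\<bar>\<xi>b h \<omega>\<bar> ^ 8) \<partial>M)" by (simp add: nn_integral_add emeasure_space_1)
      also have "\<dots> \<le> 1 + (\<integral>\<^sup>+\<omega>. (SUP h\<in>{0<..h0}. ennreal (\<bar>\<xi>b h \<omega>\<bar> ^ 8)) \<partial>M)"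
        using h by (intro add_left_mono nn_integral_mono SUP_upper2[of h]) auto
      also have "\<dots> \<le> ennreal cB" by (rule cB(2))
      finally show ?thesis .
    qed
    have b2: "integrable M (\<lambda>\<omega>. (\<xi>b h \<omega>)\<^sup>2)"
    proof (rule square_integrable_imp_integrable)
      have "integrable M (\<lambda>\<omega>. (\<xi>b h \<omega>) ^ 4)"
        by (rule integrableI_bounded) (use order_le_less_trans[OF b4] in \<open>auto simp: power_abs\<close>)
      then show "integrable M (\<lambda>\<omega>. ((\<xi>b h \<omega>)\<^sup>2)\<^sup>2)" by simp
    qed measurable
    obtain R where R: "scheme_space M F Lf h (\<tau>h h) R"
      "\<And>t. t \<in> grid h \<Longrightarrow> AE \<omega> in M. R t \<omega> = scheme_op M F h (\<tau>h h) (\<xi>b h) (fh h) R t \<omega>"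
      "\<And>t. t \<in> grid h \<Longrightarrow> AE \<omega> in M. Yb t \<omega> = (if \<tau>h h \<omega> \<le> t then \<xi>b h \<omega> else R t \<omega>)"
      using ds unfolding discrete_solution_def by blast
    interpret sc: scheme M W \<tau> \<xi> f Lf Y Z h "\<tau>h h" "\<xi>b h" "fh h" K R
    proof unfold_locales
      show "0 \<le> K \<omega>" for \<omega> using K1[of \<omega>] by simp
      show "\<tau>h h \<omega> \<in> grid h" if "\<omega> \<in> space M" for \<omega> using tauh_grid h that by blast
      show "\<bar>fh h t \<omega> y - fh h t \<omega> y'\<bar> \<le> Lf * \<bar>y - y'\<bar>" if "t \<in> grid h" for t \<omega> y y' using fh_lip h that by blast
      show "(\<lambda>\<omega>. fh h t \<omega> (A \<omega>)) \<in> borel_measurable (bm_filtration M W t)"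
        if "t \<in> grid h" "A \<in> borel_measurable (bm_filtration M W t)" for t A using fh_adapt h that unfolding F by blast
      show "\<xi>b h \<in> borel_measurable (filtration.pre_sigma (space M) (bm_filtration M W) (\<tau>h h))" using xib_meas h unfolding F by blast
      show "stopping_time (bm_filtration M W) (\<tau>h h)" using Tst unfolding F .
      show "scheme_space M (bm_filtration M W) Lf h (\<tau>h h) R" using R(1) unfolding F .
      show "AE \<omega> in M. R t \<omega> = scheme_op M (bm_filtration M W) h (\<tau>h h) (\<xi>b h) (fh h) R t \<omega>" if "t \<in> grid h" for t
        using R(2)[OF that] unfolding F .
      show "AE \<omega> in M. t \<le> max (\<tau> \<omega>) (\<tau>h h \<omega>) \<longrightarrow> \<bar>fh h t \<omega> 0\<bar> \<le> K \<omega>" if "t \<in> grid h" for t by (rule K_g[OF h that])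
    qed (use Lf_pos hb[OF h] KM K2 K_Y b2 in auto)
    let ?R = "\<integral>\<^sup>+\<omega>. ennreal (exp (3 * Lf * max (\<tau> \<omega>) (\<tau>h h \<omega>))) *
                    (ennreal ((\<xi> \<omega> - \<xi>b h \<omega>)\<^sup>2) + ennreal (2 * V \<omega> * \<bar>\<tau> \<omega> - \<tau>h h \<omega>\<bar>)
                     + ennreal (3 / (2 * Lf)) *
                       (\<integral>\<^sup>+s\<in>{0..\<tau> \<omega>}. ennreal ((f s \<omega> (Y s \<omega>) - fh h (phi h s) \<omega> (Y s \<omega>))\<^sup>2) \<partial>lborel))
                  \<partial>M"
    have kk: "sc.\<kappa> = kap" unfolding sc.\<kappa>_def[abs_def] kap_def ..
    have X: "(\<integral>\<^sup>+\<omega>. ennreal (exp (\<rho> * \<tau> \<omega>) + exp (\<rho> * \<tau>h h \<omega>)) \<partial>M) \<le> ennreal cX"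
    proof -
      have "(\<integral>\<^sup>+\<omega>. ennreal (exp (\<rho> * \<tau> \<omega>) + exp (\<rho> * \<tau>h h \<omega>)) \<partial>M)
        = (\<integral>\<^sup>+\<omega>. ennreal (exp (\<rho> * \<tau> \<omega>)) \<partial>M) + (\<integral>\<^sup>+\<omega>. ennreal (exp (\<rho> * \<tau>h h \<omega>)) \<partial>M)"
        by (simp add: nn_integral_add)
      also have "\<dots> \<le> (\<integral>\<^sup>+\<omega>. ennreal (exp (\<rho> * \<tau> \<omega>)) \<partial>M) + (\<integral>\<^sup>+\<omega>. (SUP h\<in>{0<..h0}. ennreal (exp (\<rho> * \<tau>h h \<omega>))) \<partial>M)"
        using h by (intro add_left_mono nn_integral_mono SUP_upper2[of h]) auto
      also have "\<dots> \<le> ennreal cX" by (rule cX(2))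
      finally show ?thesis .
    qed
    show "(SUP t\<in>grid h. \<integral>\<^sup>+\<omega>. ennreal ((Y t \<omega> - Yb t \<omega>)\<^sup>2) \<partial>M)
              \<le> ennreal (C * h) +
                 ?R"
    proof (rule SUP_least)
      fix t assume t: "t \<in> grid h"
      \<comment> \<open>The given discrete solution agrees with \<open>sc.Yb\<close> almost surely
        at each grid time, which suffices for a moment at fixed t.\<close>
      have "(\<integral>\<^sup>+\<omega>. ennreal ((Y t \<omega> - Yb t \<omega>)\<^sup>2) \<partial>M) = (\<integral>\<^sup>+\<omega>. ennreal ((sc.D t \<omega>)\<^sup>2) \<partial>M)"
        by (rule nn_integral_cong_AE, use R(3)[OF t] in eventually_elim) (simp add: sc.D_def sc.Yb_def)
      also have "\<dots> \<le> ennreal ((4 * Lf * (cX + 8 * cI + 8 * cB) + 50 * Lf * (cX / (144 * Lf ^ 4) + cK + cX + cZ)) * h)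
        + (\<integral>\<^sup>+\<omega>. ennreal (sc.w \<omega>) * (ennreal ((\<xi> \<omega> - \<xi>b h \<omega>)\<^sup>2) + ennreal (10 / (9 * Lf) * (kap \<omega>)\<^sup>2 * \<bar>\<tau> \<omega> - \<tau>h h \<omega>\<bar>)
          + ennreal (3 / (2 * Lf)) * (\<integral>\<^sup>+s. ennreal ((sc.dF \<omega> s)\<^sup>2) \<partial>lborel)) \<partial>M)"
        using sc.final_bound[OF _ cX(1) cI(1) cB(1) cK(1) cZ(1) X cI(2) b4 _ cZ(2) t] \<rho>(1) cK(2) unfolding kk by simp
      also have "\<dots> \<le> ennreal (C * h) +
                 ?R"
      proof (rule add_mono)
        have "(4 * Lf * (cX + 8 * cI + 8 * cB) + 50 * Lf * (cX / (144 * Lf ^ 4) + cK + cX + cZ)) * h \<le> C * h"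
          unfolding C_def using hb(1)[OF h] by (intro mult_right_mono) auto
        then show "ennreal ((4 * Lf * (cX + 8 * cI + 8 * cB) + 50 * Lf * (cX / (144 * Lf ^ 4) + cK + cX + cZ)) * h) \<le> ennreal (C * h)"
          by (rule ennreal_leI)
        show "(\<integral>\<^sup>+\<omega>. ennreal (sc.w \<omega>) * (ennreal ((\<xi> \<omega> - \<xi>b h \<omega>)\<^sup>2) + ennreal (10 / (9 * Lf) * (kap \<omega>)\<^sup>2 * \<bar>\<tau> \<omega> - \<tau>h h \<omega>\<bar>)
            + ennreal (3 / (2 * Lf)) * (\<integral>\<^sup>+s. ennreal ((sc.dF \<omega> s)\<^sup>2) \<partial>lborel)) \<partial>M)
          \<le> ?R"
        proof (rule nn_integral_mono)
          fix \<omega>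
          have 1: "sc.w \<omega> = exp (3 * Lf * max (\<tau> \<omega>) (\<tau>h h \<omega>))" by (simp add: sc.w_def sc.\<sigma>_def)
          have 2: "10 / (9 * Lf) * (kap \<omega>)\<^sup>2 = 2 * V \<omega>" by (simp add: V_def)
          \<comment> \<open>dF is supported in the half-open interval up to \<tau>, the claim
            integrates over the closed one; monotonicity of the nonnegative integral covers the
            passage.\<close>
          have 3: "(\<integral>\<^sup>+s. ennreal ((sc.dF \<omega> s)\<^sup>2) \<partial>lborel)
            \<le> (\<integral>\<^sup>+s\<in>{0..\<tau> \<omega>}. ennreal ((f s \<omega> (Y s \<omega>) - fh h (phi h s) \<omega> (Y s \<omega>))\<^sup>2) \<partial>lborel)"
            by (rule nn_integral_mono) (auto simp: sc.dF_def split: split_indicator)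
          show "ennreal (sc.w \<omega>) * (ennreal ((\<xi> \<omega> - \<xi>b h \<omega>)\<^sup>2) + ennreal (10 / (9 * Lf) * (kap \<omega>)\<^sup>2 * \<bar>\<tau> \<omega> - \<tau>h h \<omega>\<bar>)
              + ennreal (3 / (2 * Lf)) * (\<integral>\<^sup>+s. ennreal ((sc.dF \<omega> s)\<^sup>2) \<partial>lborel))
            \<le> ennreal (exp (3 * Lf * max (\<tau> \<omega>) (\<tau>h h \<omega>))) *
                    (ennreal ((\<xi> \<omega> - \<xi>b h \<omega>)\<^sup>2) + ennreal (2 * V \<omega> * \<bar>\<tau> \<omega> - \<tau>h h \<omega>\<bar>)
                     + ennreal (3 / (2 * Lf)) *
                       (\<integral>\<^sup>+s\<in>{0..\<tau> \<omega>}. ennreal ((f s \<omega> (Y s \<omega>) - fh h (phi h s) \<omega> (Y s \<omega>))\<^sup>2) \<partial>lborel))"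
            unfolding 1 2 by (intro mult_left_mono add_left_mono 3) auto
        qed
      qed
      finally show "(\<integral>\<^sup>+\<omega>. ennreal ((Y t \<omega> - Yb t \<omega>)\<^sup>2) \<partial>M) \<le> ennreal (C * h) +
                 ?R" .
    qed
  qed
qed

end
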